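(* Let $X$ be a compact metric space of finite covering dimension $d \in \mathbb{N}$ ($d = 0$ allowed). Let $n \in \mathbb{N}$ and let $a,b \in \mathrm{M}_n(\mathrm{C}(X))$ be positive, and suppose that $$\mathrm{rank}(a)(x) + 9d \leq \mathrm{rank}(b)(x), \quad \forall x \in X.$$ Then $a \precsim b$.
   Context: $\mathrm{C}(X)$ is the $C^*$-algebra of continuous complex-valued functions on $X$; elements of $\mathrm{M}_n(\mathrm{C}(X))$ are viewed as continuous functions $X \to \mathrm{M}_n(\mathbb{C})$, and $\mathrm{rank}(a)(x)$ is the rank of the matrix $a(x)$. For a $C^*$-algebra $A$, $\mathrm{M}_\infty(A)=\bigcup_n \mathrm{M}_n(A)$, where $\mathrm{M}_n(A)$ is included in $\mathrm{M}_{n+1}(A)$ as the upper left corner. For positive $a,b\in \mathrm{M}_\infty(A)$, $a \precsim b$ ($a$ is Cuntz subequivalent to $b$) means that there is a sequence $(v_i)$ in $\mathrm{M}_\infty(A)$ with $\|v_i b v_i^* - a\| \to 0$; here $A = \mathrm{C}(X)$. *)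

theory Defs
  imports
    "HOL-Analysis.Analysis"
    "Jordan_Normal_Form.Schur_Decomposition"
    "Jordan_Normal_Form.DL_Rank"
begin

(* Covering dimension of the subspace X: every finite open cover of X has a finite open
   refinement in which no point lies in more than d + 1 members. *)
definition covering_dim_le :: "'a::topological_space set \<Rightarrow> nat \<Rightarrow> bool" where
  "covering_dim_le X d \<longleftrightarrow>
     (\<forall>\<U>. finite \<U> \<and> (\<forall>U\<in>\<U>. openin (top_of_set X) U) \<and> \<Union>\<U> = X \<longrightarrow>
       (\<exists>\<V>. finite \<V> \<and> (\<forall>V\<in>\<V>. openin (top_of_set X) V) \<and> \<Union>\<V> = X \<and>
            (\<forall>V\<in>\<V>. \<exists>U\<in>\<U>. V \<subseteq> U) \<and>
            (\<forall>x\<in>X. card {V\<in>\<V>. x \<in> V} \<le> d + 1)))"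

(* The empty space, whose dimension is -1 by the usual convention, gets dimension 0 here. *)
definition has_covering_dim :: "'a::topological_space set \<Rightarrow> nat \<Rightarrow> bool" where
  "has_covering_dim X d \<longleftrightarrow> covering_dim_le X d \<and> (\<forall>k<d. \<not> covering_dim_le X k)"

(* M_n(C(X)), as matrix-valued functions on X with continuous entries.  Such functions are
   arbitrary outside X; everything below depends only on their values on X. *)
definition matC :: "'a::topological_space set \<Rightarrow> nat \<Rightarrow> ('a \<Rightarrow> complex mat) set" where
  "matC X n = {a. (\<forall>x\<in>X. a x \<in> carrier_mat n n) \<and>
                  (\<forall>i<n. \<forall>j<n. continuous_on X (\<lambda>x. a x $$ (i, j)))}"

(* The spectrum of a as an element of the unital algebra M_n(C(X)). *)
definition matC_spectrum ::
    "'a::topological_space set \<Rightarrow> nat \<Rightarrow> ('a \<Rightarrow> complex mat) \<Rightarrow> complex set" where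
  "matC_spectrum X n a =
     {z. \<not> (\<exists>c\<in>matC X n. \<forall>x\<in>X.
              c x * (a x - z \<cdot>\<^sub>m 1\<^sub>m n) = 1\<^sub>m n \<and>
              (a x - z \<cdot>\<^sub>m 1\<^sub>m n) * c x = 1\<^sub>m n)}"

definition matC_positive ::
    "'a::topological_space set \<Rightarrow> nat \<Rightarrow> ('a \<Rightarrow> complex mat) \<Rightarrow> bool" where
  "matC_positive X n a \<longleftrightarrow>
     a \<in> matC X n \<and> (\<forall>x\<in>X. mat_adjoint (a x) = a x) \<and> matC_spectrum X n a \<subseteq> \<real>\<^sub>\<ge>\<^sub>0"

definition cvec_norm :: "complex vec \<Rightarrow> real" where
  "cvec_norm v = L2_set (\<lambda>i. cmod (vec_index v i)) {..<dim_vec v}"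

definition mat_opnorm :: "complex mat \<Rightarrow> real" where
  "mat_opnorm M = Sup {cvec_norm (M *\<^sub>v v) |v. v \<in> carrier_vec (dim_col M) \<and> cvec_norm v \<le> 1}"

(* The C*-norm; inserting 0 only matters for X = {}. *)
definition matC_norm :: "'a set \<Rightarrow> ('a \<Rightarrow> complex mat) \<Rightarrow> real" where
  "matC_norm X a = Sup (insert 0 ((\<lambda>x. mat_opnorm (a x)) ` X))"

(* The inclusion of the n x n matrices into the k x k matrices, n \<le> k, as upper left corner. *)
definition corner :: "nat \<Rightarrow> complex mat \<Rightarrow> complex mat" where
  "corner k M = mat k k (\<lambda>(i, j). if i < dim_row M \<and> j < dim_col M then M $$ (i, j) else 0)"

(* Cuntz subequivalence in the union of all M_k(C(X)), for a, b in M_n(C(X)).  The size K i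
   of v i may vary with i; n \<le> K i is no restriction, since v i can be enlarged by zeros. *)
definition cuntz_subeq ::
    "'a::topological_space set \<Rightarrow> nat \<Rightarrow> ('a \<Rightarrow> complex mat) \<Rightarrow> ('a \<Rightarrow> complex mat) \<Rightarrow> bool" where
  "cuntz_subeq X n a b \<longleftrightarrow>
     (\<exists>(K :: nat \<Rightarrow> nat) v. (\<forall>i. n \<le> K i \<and> v i \<in> matC X (K i)) \<and>
        (\<lambda>i. matC_norm X (\<lambda>x. v i x * corner (K i) (b x) * mat_adjoint (v i x)
                                - corner (K i) (a x))) \<longlonglongrightarrow> 0)"

end

theory Submission
  imports Defs
begin

text \<open>
  Write \<open>r\<close> and \<open>s\<close> for the ranks of \<open>a\<close> and \<open>b\<close> at a point. The result rests on a dimension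
  count. Let \<open>E\<close> be a subspace of dimension \<open>r\<close> and \<open>K\<close> one of codimension \<open>s \<ge> r\<close> in complex
  \<open>n\<close>-space. The matrices \<open>T\<close> that send some nonzero vector of \<open>E\<close> into \<open>K\<close> form a set of real
  codimension \<open>2(s - r + 1)\<close>. If \<open>(E, K)\<close> runs through a family with \<open>d\<close> real parameters and
  \<open>d \<le> 2(s - r)\<close>, then one constant \<open>T\<close> is injective on \<open>E\<close> modulo \<open>K\<close> for all members at once.
  The pairs of interest at a point \<open>x\<close> are \<open>E\<close>, spanned by the eigenvectors of \<open>a x\<close> with
  eigenvalues away from zero, and \<open>K\<close>, spanned by the eigenvectors of \<open>b x\<close> with eigenvalues near
  zero.

  Such a \<open>T\<close> gives Cuntz subequivalence. Let \<open>w = \<psi>(b) T \<phi>(a)\<close>, where \<open>\<phi>\<close> and \<open>\<psi>\<close> are cut-off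
  functions that vanish near zero. Injectivity of \<open>T\<close> modulo \<open>K\<close> makes
  \<open>a \<le> e + C w\<^sup>* b w\<close> as quadratic forms, for some constant \<open>C\<close>. Put \<open>y = C w\<^sup>* b w\<close>. Then
  \<open>v = a\<^sup>1\<^sup>/\<^sup>2 (y + e)\<^sup>-\<^sup>1\<^sup>/\<^sup>2 w\<^sup>*\<close>, scaled by the root of \<open>C\<close>, satisfies
  \<open>a - v b v\<^sup>* = e a\<^sup>1\<^sup>/\<^sup>2 (y + e)\<^sup>-\<^sup>1 a\<^sup>1\<^sup>/\<^sup>2\<close>, which has norm at most \<open>e\<close>. This is
  \<open>cuntz_subeq_if_dominated\<close>.

  Three points need care. First, a space of covering dimension \<open>d\<close> does not make \<open>x \<mapsto> (a x, b x)\<close>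
  a family with \<open>d\<close> parameters in any metric sense: a path can fill a cube. So \<open>a\<close> and \<open>b\<close> are
  replaced by convex combinations \<open>a'\<close>, \<open>b'\<close> of finitely many of their values. The weights form a
  partition of unity of multiplicity at most \<open>d + 1\<close>, so \<open>a'\<close> and \<open>b'\<close> factor through
  the nerve of a cover, which does have dimension at most \<open>d\<close>. The field becomes
  \<open>w = \<psi>(b') T \<phi>(a')\<close>. On the range of the cut-off \<open>\<psi>(b')\<close> the form of \<open>b'\<close> is bounded below by a
  constant larger than the distance from \<open>b\<close> to \<open>b'\<close>, so the form of \<open>b\<close> itself is bounded below
  there, and this makes \<open>w\<^sup>* b w\<close> large enough.

  Second, spectral subspaces jump. The dimension count is therefore carried out by counting finite
  sets at scale \<open>1 / m\<close> (\<open>general_position\<close>): the weights are rounded to multiples of \<open>1 / m\<close>, which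
  leaves a number of points of order at most \<open>m\<^sup>d\<^sup>+\<^sup>1\<close>, and \<open>T\<close> is chosen from a grid of matrices so that it is
  injective modulo \<open>K\<close> with margin \<open>L / m\<close> at all these points, where \<open>L\<close> was prescribed before
  \<open>m\<close>. Between a point and its rounding the matrices move by a fixed multiple of \<open>1 / m\<close>, and so do
  the overlaps of eigenvectors whose eigenvalues are separated by a fixed gap
  (\<open>eigenvector_overlap\<close>). For large \<open>L\<close> the margin beats this error, and injectivity
  holds at every point (\<open>transversality_estimate\<close>).

  Third, the rank is only semicontinuous and positive eigenvalues may come arbitrarily close to
  zero. By compactness there is one \<open>\<sigma> > 0\<close> such that near every point the number of eigenvalues of
  \<open>b'\<close> above \<open>\<sigma> / 2\<close> is at least the rank of \<open>b\<close> at some \<open>z\<close>, while the number of eigenvalues of \<open>a'\<close>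
  above a prescribed level is at most the rank of \<open>a\<close> at the same \<open>z\<close> (\<open>uniform_spectral_gap\<close> with
  \<open>few_large_eigenvalues_near\<close> and \<open>many_large_eigenvalues_near\<close>).
\<close>

no_notation vec_nth (infixl "$" 90)
no_notation inner (infix "\<bullet>" 70)

section \<open>Adjoints, norms and unitary matrices\<close>

lemma adjoint_carrier [simp, intro]: "A \<in> carrier_mat m n \<Longrightarrow> mat_adjoint A \<in> carrier_mat n m"
  unfolding mat_adjoint_def by auto

lemma adjoint_dim [simp]: "dim_row (mat_adjoint A) = dim_col A" "dim_col (mat_adjoint A) = dim_row A"
  unfolding mat_adjoint_def by auto

lemma adjoint_index [simp]:
  fixes A :: "complex mat"
  assumes "i < dim_col A" "j < dim_row A"
  shows "mat_adjoint A $$ (i, j) = cnj (A $$ (j, i))"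
  using assms unfolding mat_adjoint_def by (simp add: mat_of_rows_index)

lemma adjoint_adjoint [simp]: "mat_adjoint (mat_adjoint A) = (A :: complex mat)"
  by (rule eq_matI) auto

lemma adjoint_mult:
  fixes A B :: "complex mat"
  assumes "A \<in> carrier_mat m n" "B \<in> carrier_mat n k"
  shows "mat_adjoint (A * B) = mat_adjoint B * mat_adjoint A"
  using assms by (intro eq_matI) (auto simp: scalar_prod_def mult.commute)

lemma adjoint_one [simp]: "mat_adjoint (1\<^sub>m n) = (1\<^sub>m n :: complex mat)"
  by (rule eq_matI) auto

lemma adjoint_mat_diag [simp]:
  "mat_adjoint (mat_diag n (\<lambda>i. complex_of_real (f i))) = mat_diag n (\<lambda>i. complex_of_real (f i))"
  by (rule eq_matI) (auto simp: mat_diag_def)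

lemma cscalar_adjoint:
  fixes A :: "complex mat"
  assumes "A \<in> carrier_mat m n" "v \<in> carrier_vec n" "w \<in> carrier_vec m"
  shows "(A *\<^sub>v v) \<bullet>c w = v \<bullet>c (mat_adjoint A *\<^sub>v w)"
proof -
  have "(A *\<^sub>v v) \<bullet>c w = (\<Sum>i<m. \<Sum>j<n. A $$ (i,j) * v $ j * cnj (w $ i))"
    using assms by (auto simp: scalar_prod_def sum_distrib_right atLeast0LessThan intro!: sum.cong)
  also have "\<dots> = (\<Sum>j<n. \<Sum>i<m. A $$ (i,j) * v $ j * cnj (w $ i))"
    by (rule sum.swap)
  also have "\<dots> = v \<bullet>c (mat_adjoint A *\<^sub>v w)"
    using assms by (auto simp: scalar_prod_def sum_distrib_left atLeast0LessThan mult_ac intro!: sum.cong)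
  finally show ?thesis .
qed

lemma cscalar_self: "v \<bullet>c v = complex_of_real ((cvec_norm v)\<^sup>2)"
proof -
  have "(cvec_norm v)\<^sup>2 = (\<Sum>i<dim_vec v. (cmod (v $ i))\<^sup>2)"
    unfolding cvec_norm_def L2_set_def by (simp add: sum_nonneg)
  thus ?thesis
    by (simp add: scalar_prod_def atLeast0LessThan complex_norm_square del: of_real_power)
qed

lemma cvec_norm_nonneg [simp]: "0 \<le> cvec_norm v"
  unfolding cvec_norm_def by (rule L2_set_nonneg)

lemma cvec_norm_zero [simp]: "cvec_norm (0\<^sub>v n) = 0"
  unfolding cvec_norm_def by (simp add: L2_set_def)

lemma cvec_norm_smult: "cvec_norm (c \<cdot>\<^sub>v v) = cmod c * cvec_norm v"
  unfolding cvec_norm_def by (auto simp: L2_set_right_distrib norm_mult intro!: L2_set_cong)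

lemma cvec_norm_triangle:
  assumes "v \<in> carrier_vec n" "w \<in> carrier_vec n"
  shows "cvec_norm (v + w) \<le> cvec_norm v + cvec_norm w"
proof -
  have "cvec_norm (v + w) = L2_set (\<lambda>i. cmod (v $ i + w $ i)) {..<n}"
    using assms unfolding cvec_norm_def by (auto intro!: L2_set_cong)
  also have "\<dots> \<le> L2_set (\<lambda>i. cmod (v $ i) + cmod (w $ i)) {..<n}"
    by (intro L2_set_mono) (auto intro: norm_triangle_ineq)
  also have "\<dots> \<le> cvec_norm v + cvec_norm w"
    using assms L2_set_triangle_ineq unfolding cvec_norm_def by auto
  finally show ?thesis .
qed

lemma cvec_norm_component: "i < dim_vec v \<Longrightarrow> cmod (v $ i) \<le> cvec_norm v"
  unfolding cvec_norm_def by (rule member_le_L2_set) auto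

lemma cvec_norm_le_sum: "cvec_norm v \<le> (\<Sum>i<dim_vec v. cmod (v $ i))"
  unfolding cvec_norm_def by (rule L2_set_le_sum) auto

lemma cvec_norm_le_bound:
  assumes "v \<in> carrier_vec n" "\<And>i. i < n \<Longrightarrow> cmod (v $ i) \<le> e"
  shows "cvec_norm v \<le> n * e"
proof -
  have "(\<Sum>i<n. cmod (v $ i)) \<le> (\<Sum>i<n. e)" using assms by (intro sum_mono) auto
  thus ?thesis using cvec_norm_le_sum[of v] assms(1) by auto
qed

lemma cvec_norm_eq_0: "v \<in> carrier_vec n \<Longrightarrow> cvec_norm v = 0 \<longleftrightarrow> v = 0\<^sub>v n"
  unfolding cvec_norm_def by (subst L2_set_eq_0_iff) auto

lemma cscalar_CS:
  assumes "v \<in> carrier_vec n" "w \<in> carrier_vec n"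
  shows "cmod (v \<bullet>c w) \<le> cvec_norm v * cvec_norm w"
proof -
  have "cmod (v \<bullet>c w) \<le> (\<Sum>i<n. cmod (v $ i) * cmod (w $ i))"
    using assms by (auto simp: scalar_prod_def atLeast0LessThan norm_mult intro!: sum_norm_le)
  also have "\<dots> \<le> cvec_norm v * cvec_norm w"
    using assms L2_set_mult_ineq[of "\<lambda>i. cmod (v $ i)" "\<lambda>i. cmod (w $ i)" "{..<n}"]
    unfolding cvec_norm_def by auto
  finally show ?thesis .
qed

lemma mat_vec_index:
  fixes A :: "complex mat"
  assumes "A \<in> carrier_mat m n" "v \<in> carrier_vec n" "i < m"
  shows "(A *\<^sub>v v) $ i = (\<Sum>j<n. A $$ (i, j) * v $ j)"
  using assms by (simp add: scalar_prod_def atLeast0LessThan)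

lemma scaled_mat_vec:
  fixes M :: "complex mat"
  assumes "M \<in> carrier_mat m n" "v \<in> carrier_vec n"
  shows "(c \<cdot>\<^sub>m M) *\<^sub>v v = c \<cdot>\<^sub>v (M *\<^sub>v v)"
  using assms by (intro eq_vecI) (auto simp: scalar_prod_def sum_distrib_left mult.assoc)

lemma mat_vec_component_bound:
  fixes A :: "complex mat"
  assumes "A \<in> carrier_mat m n" "v \<in> carrier_vec n" "i < m" "\<And>j. j < n \<Longrightarrow> cmod (A $$ (i, j)) \<le> e"
  shows "cmod ((A *\<^sub>v v) $ i) \<le> n * e * cvec_norm v"
proof -
  have "cmod ((A *\<^sub>v v) $ i) \<le> (\<Sum>j<n. cmod (A $$ (i,j) * v $ j))"
    using assms by (auto simp: scalar_prod_def atLeast0LessThan intro!: sum_norm_le)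
  also have "\<dots> \<le> (\<Sum>j<n. e * cvec_norm v)"
  proof (rule sum_mono)
    fix j assume "j \<in> {..<n}"
    hence "cmod (A $$ (i,j)) \<le> e" "cmod (v $ j) \<le> cvec_norm v"
      using assms cvec_norm_component by auto
    thus "cmod (A $$ (i,j) * v $ j) \<le> e * cvec_norm v"
      unfolding norm_mult by (intro mult_mono) (auto intro: order_trans[OF norm_ge_zero])
  qed
  finally show ?thesis by simp
qed

lemma mat_vec_bound:
  fixes A :: "complex mat"
  assumes "A \<in> carrier_mat m n" "v \<in> carrier_vec n"
    "\<And>i j. i < m \<Longrightarrow> j < n \<Longrightarrow> cmod (A $$ (i, j)) \<le> e"
  shows "cvec_norm (A *\<^sub>v v) \<le> m * n * e * cvec_norm v"
  using cvec_norm_le_bound[of "A *\<^sub>v v" m "n * e * cvec_norm v"] mat_vec_component_bound assms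
  by (auto simp: mult.assoc)

definition unitary_mat :: "nat \<Rightarrow> complex mat \<Rightarrow> bool" where
  "unitary_mat n U \<longleftrightarrow> U \<in> carrier_mat n n \<and> mat_adjoint U * U = 1\<^sub>m n \<and> U * mat_adjoint U = 1\<^sub>m n"

lemma unitary_adjoint: "unitary_mat n U \<Longrightarrow> unitary_mat n (mat_adjoint U)"
  unfolding unitary_mat_def by auto

lemma unitary_one: "unitary_mat n (1\<^sub>m n)"
  unfolding unitary_mat_def by auto

lemma unitary_mult:
  assumes "unitary_mat n U" "unitary_mat n V"
  shows "unitary_mat n (U * V)"
proof -
  note * = assms[unfolded unitary_mat_def]
  have c [simp]: "U \<in> carrier_mat n n" "V \<in> carrier_mat n n" using * by auto
  have "mat_adjoint (U * V) * (U * V) = mat_adjoint V * (mat_adjoint U * U * V)"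
    by (simp add: adjoint_mult[OF c] assoc_mult_mat[of _ n n _ n _ n] mult_carrier_mat[of _ n n _ n])
  also have "\<dots> = 1\<^sub>m n" using * by (simp add: left_mult_one_mat[of _ n n])
  finally have 1: "mat_adjoint (U * V) * (U * V) = 1\<^sub>m n" .
  have "U * V * mat_adjoint (U * V) = U * (V * mat_adjoint V * mat_adjoint U)"
    by (simp add: adjoint_mult[OF c] assoc_mult_mat[of _ n n _ n _ n] mult_carrier_mat[of _ n n _ n])
  also have "\<dots> = 1\<^sub>m n" using * by (simp add: left_mult_one_mat[of _ n n])
  finally show ?thesis using 1 mult_carrier_mat[OF c] unfolding unitary_mat_def by auto
qed

lemma unitary_cancel [simp]:
  assumes "unitary_mat n U" "v \<in> carrier_vec n"
  shows "mat_adjoint U *\<^sub>v (U *\<^sub>v v) = v" "U *\<^sub>v (mat_adjoint U *\<^sub>v v) = v"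
  using assms unfolding unitary_mat_def
  by (simp_all add: assoc_mult_mat_vec[symmetric, of _ n n _ n])

lemma unitary_cscalar:
  assumes "unitary_mat n U" "v \<in> carrier_vec n" "w \<in> carrier_vec n"
  shows "(U *\<^sub>v v) \<bullet>c (U *\<^sub>v w) = v \<bullet>c w"
proof -
  have c: "U \<in> carrier_mat n n" using assms unfolding unitary_mat_def by auto
  show ?thesis using cscalar_adjoint[OF c assms(2), of "U *\<^sub>v w"] assms c by simp
qed

lemma unitary_norm:
  assumes "unitary_mat n U" "v \<in> carrier_vec n"
  shows "cvec_norm (U *\<^sub>v v) = cvec_norm v"
  using unitary_cscalar[OF assms assms(2)] unfolding cscalar_self
  by (simp del: of_real_power)

lemma unitary_component:
  assumes "unitary_mat n U" "i < n" "j < n"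
  shows "cmod (U $$ (i,j)) \<le> 1"
proof -
  have c: "U \<in> carrier_mat n n" using assms unfolding unitary_mat_def by auto
  have "(U *\<^sub>v unit_vec n j) $ i = U $$ (i,j)" using c assms by (auto simp: scalar_prod_right_unit)
  moreover have "cvec_norm (unit_vec n j) = 1" using assms
    using cscalar_self[of "unit_vec n j"] by (simp add: power2_eq_1_iff del: of_real_power)
       (metis cvec_norm_nonneg not_one_le_zero le_minus_one_simps(3) neg_le_0_iff_le)
  ultimately show ?thesis
    using cvec_norm_component[of i "U *\<^sub>v unit_vec n j"] unitary_norm[OF assms(1), of "unit_vec n j"] c assms
    by auto
qed

section \<open>The spectral theorem\<close>

lemma unitary_matI:
  assumes "U \<in> carrier_mat n n" "mat_adjoint U * U = 1\<^sub>m n"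
  shows "unitary_mat n U"
  using assms mat_mult_left_right_inverse[OF adjoint_carrier[OF assms(1)] assms(1)]
  unfolding unitary_mat_def by auto

text \<open>The Gram--Schmidt process of the library yields an orthogonal, not an orthonormal, basis starting
  with \<open>v\<close>; dividing its members by their norms gives the columns of \<open>W\<close>.\<close>

lemma unit_vector_extends_to_unitary:
  fixes v :: "complex vec"
  assumes v: "v \<in> carrier_vec n" and v0: "v \<noteq> 0\<^sub>v n"
  obtains W c where "unitary_mat n W" "col W 0 = c \<cdot>\<^sub>v v"
proof -
  interpret cof_vec_space n "TYPE(complex)" .
  have n: "n \<noteq> 0" using v v0 by auto
  define b where "b = basis_completion v"
  define ws where "ws = gram_schmidt n b"
  from basis_completion[OF v v0, folded b_def]
  have span_b: "span (set b) = carrier_vec n" and dist_b: "distinct b"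
    and indep: "\<not> lin_dep (set b)" and b: "set b \<subseteq> carrier_vec n" and hdb: "hd b = v"
    and len_b: "length b = n" by auto
  from hdb len_b n obtain vs where bv: "b = v # vs" by (cases b, auto)
  from gram_schmidt_result[OF b dist_b indep refl, folded ws_def]
  have ws: "set ws \<subseteq> carrier_vec n" "corthogonal ws" "length ws = n"
    by (auto simp: len_b)
  from gram_schmidt_hd[OF v, of vs, folded bv] have hdws: "hd ws = v" unfolding ws_def .
  have ws0: "ws ! 0 = v" using hdws ws(3) n by (metis hd_conv_nth list.size(3))
  have wsc: "ws ! j \<in> carrier_vec n" if "j < n" for j using ws that by auto
  define W where "W = mat n n (\<lambda>(i, j). complex_of_real (inverse (cvec_norm (ws ! j))) * (ws ! j) $ i)"
  have W: "W \<in> carrier_mat n n" unfolding W_def by auto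
  have "mat_adjoint W * W = 1\<^sub>m n"
  proof (rule eq_matI)
    fix i j assume ij: "i < dim_row (1\<^sub>m n :: complex mat)" "j < dim_col (1\<^sub>m n :: complex mat)"
    have "(mat_adjoint W * W) $$ (i, j) =
       complex_of_real (inverse (cvec_norm (ws ! i))) * complex_of_real (inverse (cvec_norm (ws ! j))) * (ws ! j \<bullet>c ws ! i)"
      using ij wsc[of i] wsc[of j] W unfolding W_def
      by (auto simp: scalar_prod_def sum_distrib_left mult_ac intro!: sum.cong)
    also have "\<dots> = 1\<^sub>m n $$ (i, j)"
    proof (cases "i = j")
      case True
      have "ws ! i \<bullet>c ws ! i \<noteq> 0" using corthogonalD[OF ws(2), of i i] ij ws(3) by auto
      hence "cvec_norm (ws ! i) \<noteq> 0" unfolding cscalar_self by auto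
      moreover have "ws ! i \<bullet>c ws ! i = complex_of_real ((cvec_norm (ws ! i))\<^sup>2)" by (rule cscalar_self)
      ultimately show ?thesis using True ij by (auto simp: power2_eq_square field_simps)
    next
      case False
      hence "ws ! j \<bullet>c ws ! i = 0" using corthogonalD[OF ws(2), of j i] ij ws(3) by auto
      thus ?thesis using False ij by auto
    qed
    finally show "(mat_adjoint W * W) $$ (i, j) = 1\<^sub>m n $$ (i, j)" .
  qed (use W in auto)
  hence "unitary_mat n W" using W by (rule unitary_matI[rotated])
  moreover have "col W 0 = complex_of_real (inverse (cvec_norm v)) \<cdot>\<^sub>v v"
    using n v ws0 by (intro eq_vecI) (auto simp: W_def)
  ultimately show ?thesis using that by blast
qed

definition diagonalizes :: "nat \<Rightarrow> complex mat \<Rightarrow> (nat \<Rightarrow> real) \<Rightarrow> complex mat \<Rightarrow> bool" where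
  "diagonalizes n U D M \<longleftrightarrow> unitary_mat n U \<and> M = U * mat_diag n (\<lambda>i. complex_of_real (D i)) * mat_adjoint U"

lemma exists_eigenvector:
  fixes A :: "complex mat"
  assumes A: "A \<in> carrier_mat n n" and n: "n \<noteq> 0"
  obtains e v where "v \<in> carrier_vec n" "v \<noteq> 0\<^sub>v n" "A *\<^sub>v v = e \<cdot>\<^sub>v v"
proof -
  have "\<not> constant (poly (char_poly A))"
    using degree_monic_char_poly[OF A] n constant_degree by metis
  then obtain e where "poly (char_poly A) e = 0"
    using fundamental_theorem_of_algebra by blast
  hence "eigenvalue A e" using eigenvalue_root_char_poly[OF A] by simp
  thus ?thesis using that A unfolding eigenvalue_def eigenvector_def by auto
qed

lemma adjoint_block:
  fixes A :: "complex mat"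
  assumes "A \<in> carrier_mat m m"
  shows "mat_adjoint (four_block_mat (1\<^sub>m 1) (0\<^sub>m 1 m) (0\<^sub>m m 1) A)
    = four_block_mat (1\<^sub>m 1) (0\<^sub>m 1 m) (0\<^sub>m m 1) (mat_adjoint A)"
  by (rule eq_matI) (use assms in auto)

lemma one_block: "four_block_mat (1\<^sub>m 1) (0\<^sub>m 1 m) (0\<^sub>m m 1) (1\<^sub>m m) = (1\<^sub>m (Suc m) :: complex mat)"
  by (rule eq_matI) auto

lemma diag_block: "mat_diag (Suc m) (case_nat e f)
    = four_block_mat (mat 1 1 (\<lambda>_. e)) (0\<^sub>m 1 m) (0\<^sub>m m 1) (mat_diag m f :: complex mat)"
  by (rule eq_matI) (auto simp: mat_diag_def split: nat.splits)

lemma block_diag_mult: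
  fixes A1 A2 B1 B2 :: "complex mat"
  assumes "A1 \<in> carrier_mat 1 1" "A2 \<in> carrier_mat 1 1" "B1 \<in> carrier_mat m m" "B2 \<in> carrier_mat m m"
  shows "four_block_mat A1 (0\<^sub>m 1 m) (0\<^sub>m m 1) B1 * four_block_mat A2 (0\<^sub>m 1 m) (0\<^sub>m m 1) B2
    = four_block_mat (A1 * A2) (0\<^sub>m 1 m) (0\<^sub>m m 1) (B1 * B2)"
  using assms mult_carrier_mat[OF assms(1,2)] mult_carrier_mat[OF assms(3,4)]
  by (subst mult_four_block_mat[of _ 1 1 _ m _ m _ _ 1 _ m])
     (simp_all add: left_mult_zero_mat[of _ m m] left_mult_zero_mat[of _ m 1] left_mult_zero_mat[of _ 1 1]
       left_mult_zero_mat[of _ 1 m] right_mult_zero_mat[of _ 1 1] right_mult_zero_mat[of _ m m])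

lemma adjoint_congruence:
  fixes A U :: "complex mat"
  assumes A: "A \<in> carrier_mat n n" "mat_adjoint A = A" and U: "U \<in> carrier_mat n m"
  shows "mat_adjoint (mat_adjoint U * A * U) = mat_adjoint U * A * U"
proof -
  have "mat_adjoint (mat_adjoint U * A * U) = mat_adjoint U * (A * U)"
    using assms by (subst adjoint_mult[of _ m n _ m])
      (auto simp: adjoint_mult[of _ m n _ n])
  thus ?thesis using A U by (subst assoc_mult_mat[of _ m n _ n _ m]) auto
qed

text \<open>Induction on the size. In an orthonormal basis that starts with an eigenvector the first column
  vanishes below the diagonal; because the matrix is Hermitian, so does the first row, and a smaller
  Hermitian block remains.\<close>

theorem hermitian_diagonalizable:
  fixes M :: "complex mat"
  assumes "M \<in> carrier_mat n n" "mat_adjoint M = M"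
  shows "\<exists>U D. diagonalizes n U D M"
  using assms
proof (induction n arbitrary: M)
  case 0
  have "unitary_mat 0 (1\<^sub>m 0)" by (rule unitary_one)
  moreover have "M = 1\<^sub>m 0 * mat_diag 0 (\<lambda>i. complex_of_real 0) * mat_adjoint (1\<^sub>m 0)"
    by (rule eq_matI) (use 0 in auto)
  ultimately show ?case unfolding diagonalizes_def
    by (intro exI[of _ "1\<^sub>m 0"] exI[of _ "\<lambda>_. 0"]) auto
next
  case (Suc m)
  let ?n = "Suc m"
  note M = Suc.prems
  obtain e v where v: "v \<in> carrier_vec ?n" "v \<noteq> 0\<^sub>v ?n" and ev: "M *\<^sub>v v = e \<cdot>\<^sub>v v"
    by (rule exists_eigenvector[OF M(1)]) auto
  obtain W c where W: "unitary_mat ?n W" and W0: "col W 0 = c \<cdot>\<^sub>v v"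
    using unit_vector_extends_to_unitary[OF v] by blast
  have Wc: "W \<in> carrier_mat ?n ?n" using W unfolding unitary_mat_def by auto
  have evW: "M *\<^sub>v col W 0 = e \<cdot>\<^sub>v col W 0"
    unfolding W0 using M v ev by (auto simp: mult_mat_vec smult_smult_assoc mult.commute)
  define M' where "M' = mat_adjoint W * M * W"
  have M': "M' \<in> carrier_mat ?n ?n" using Wc M unfolding M'_def by auto
  have M'h: "mat_adjoint M' = M'" unfolding M'_def by (rule adjoint_congruence[OF M Wc])
  have M'0: "M' $$ (i, 0) = (if i = 0 then e else 0)" if "i < ?n" for i
  proof -
    have "M' = mat_adjoint W * (M * W)" unfolding M'_def
      using Wc M by (auto simp: assoc_mult_mat[of _ ?n ?n _ ?n _ ?n])
    hence "M' $$ (i, 0) = row (mat_adjoint W) i \<bullet> (M *\<^sub>v col W 0)"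
      using Wc M that by (auto simp: mult_mat_vec_def)
    also have "\<dots> = e * (row (mat_adjoint W) i \<bullet> col W 0)"
      unfolding evW using Wc that by (subst scalar_prod_smult_distrib[of _ ?n]) (auto intro!: carrier_vecI)
    also have "row (mat_adjoint W) i \<bullet> col W 0 = (mat_adjoint W * W) $$ (i, 0)"
      using Wc that by auto
    also have "\<dots> = (if i = 0 then 1 else 0)"
      using W that unfolding unitary_mat_def by auto
    finally show ?thesis by auto
  qed
  have M'0': "M' $$ (0, i) = (if i = 0 then e else 0)" if "i < ?n" for i
  proof -
    have "cnj e = e" using arg_cong[OF M'h, of "\<lambda>A. A $$ (0, 0)"] M' M'0[of 0] by auto
    moreover have "M' $$ (0, i) = cnj (M' $$ (i, 0))"
      using arg_cong[OF M'h, of "\<lambda>A. A $$ (0, i)"] M' that by auto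
    ultimately show ?thesis using M'0[OF that] by auto
  qed
  have e: "e = complex_of_real (Re e)"
    using arg_cong[OF M'h, of "\<lambda>A. A $$ (0, 0)"] M' M'0[of 0]
    by (auto simp: complex_eq_iff)
  define A where "A = mat m m (\<lambda>(i, j). M' $$ (Suc i, Suc j))"
  have A: "A \<in> carrier_mat m m" unfolding A_def by auto
  have Ah: "mat_adjoint A = A"
  proof (rule eq_matI)
    fix i j assume "i < dim_row A" "j < dim_col A"
    thus "mat_adjoint A $$ (i, j) = A $$ (i, j)"
      using arg_cong[OF M'h, of "\<lambda>A. A $$ (Suc i, Suc j)"] M' A by (auto simp: A_def)
  qed (use A in auto)
  from Suc.IH[OF A Ah] obtain V D where V: "unitary_mat m V"
    and AV: "A = V * mat_diag m (\<lambda>i. complex_of_real (D i)) * mat_adjoint V"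
    unfolding diagonalizes_def by blast
  have Vc: "V \<in> carrier_mat m m" using V unfolding unitary_mat_def by auto
  define P where "P = four_block_mat (1\<^sub>m 1) (0\<^sub>m 1 m) (0\<^sub>m m 1) V"
  have Pc: "P \<in> carrier_mat ?n ?n" using Vc unfolding P_def by (auto simp: four_block_mat_def Let_def)
  have Pu: "unitary_mat ?n P"
  proof (rule unitary_matI[OF Pc])
    show "mat_adjoint P * P = 1\<^sub>m ?n"
      unfolding P_def adjoint_block[OF Vc]
      using V Vc unfolding unitary_mat_def
      by (subst block_diag_mult) (auto simp: one_block)
  qed
  let ?D = "\<lambda>i. complex_of_real (case_nat (Re e) D i)"
  have D: "?D = case_nat e (\<lambda>i. complex_of_real (D i))"
    using e by (auto split: nat.splits)
  have M'eq: "M' = four_block_mat (mat 1 1 (\<lambda>_. e)) (0\<^sub>m 1 m) (0\<^sub>m m 1) A"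
    using M' A M'0 M'0' by (intro eq_matI) (auto simp: A_def)
  let ?D' = "mat_diag m (\<lambda>i. complex_of_real (D i))" and ?e = "mat 1 1 (\<lambda>_. e)"
  have "four_block_mat (1\<^sub>m 1) (0\<^sub>m 1 m) (0\<^sub>m m 1) V * four_block_mat ?e (0\<^sub>m 1 m) (0\<^sub>m m 1) ?D'
      * four_block_mat (1\<^sub>m 1) (0\<^sub>m 1 m) (0\<^sub>m m 1) (mat_adjoint V)
    = four_block_mat (1\<^sub>m 1 * ?e) (0\<^sub>m 1 m) (0\<^sub>m m 1) (V * ?D')
      * four_block_mat (1\<^sub>m 1) (0\<^sub>m 1 m) (0\<^sub>m m 1) (mat_adjoint V)"
    using Vc by (subst block_diag_mult) auto
  also have "\<dots> = four_block_mat (1\<^sub>m 1 * ?e * 1\<^sub>m 1) (0\<^sub>m 1 m) (0\<^sub>m m 1) (V * ?D' * mat_adjoint V)"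
    using Vc by (intro block_diag_mult) auto
  also have "1\<^sub>m 1 * ?e * 1\<^sub>m 1 = ?e" by simp
  finally have "P * mat_diag ?n ?D * mat_adjoint P = M'"
    unfolding D diag_block P_def adjoint_block[OF Vc] M'eq AV .
  moreover have "M = W * M' * mat_adjoint W"
  proof -
    have "W * M' * mat_adjoint W = (W * mat_adjoint W) * M * (W * mat_adjoint W)"
      unfolding M'_def using Wc M
      by (auto simp: assoc_mult_mat[of _ ?n ?n _ ?n _ ?n] mult_carrier_mat[of _ ?n ?n _ ?n])
    thus ?thesis using W M unfolding unitary_mat_def by auto
  qed
  ultimately have "M = W * (P * mat_diag ?n ?D * mat_adjoint P) * mat_adjoint W" by simp
  also have "\<dots> = (W * P) * mat_diag ?n ?D * mat_adjoint (W * P)"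
    unfolding adjoint_mult[OF Wc Pc] using Wc Pc
    by (simp add: assoc_mult_mat[of _ ?n ?n _ ?n _ ?n] mult_carrier_mat[of _ ?n ?n _ ?n])
  finally show ?case using unitary_mult[OF W Pu] unfolding diagonalizes_def by blast
qed

section \<open>Functional calculus of a single Hermitian matrix\<close>

text \<open>If \<open>U\<close> and \<open>D\<close> diagonalize \<open>M\<close>, then \<open>spectral_mat n U (\<lambda>i. f (D i))\<close> is the matrix \<open>f(M)\<close> of
  the functional calculus. Keeping \<open>U\<close> and the eigenvalue list explicit avoids the question whether
  \<open>f(M)\<close> depends on the choice of the eigenbasis.\<close>

definition spectral_mat :: "nat \<Rightarrow> complex mat \<Rightarrow> (nat \<Rightarrow> real) \<Rightarrow> complex mat" where
  "spectral_mat n U F = U * mat_diag n (\<lambda>i. complex_of_real (F i)) * mat_adjoint U"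

lemma diagonalizes_spectral_mat: "diagonalizes n U D M \<longleftrightarrow> unitary_mat n U \<and> M = spectral_mat n U D"
  unfolding diagonalizes_def spectral_mat_def ..

lemma unitary_carrier [simp]: "unitary_mat n U \<Longrightarrow> U \<in> carrier_mat n n"
  unfolding unitary_mat_def by auto

lemma spectral_mat_carrier [simp]: "unitary_mat n U \<Longrightarrow> spectral_mat n U F \<in> carrier_mat n n"
  unfolding spectral_mat_def by (auto intro!: mult_carrier_mat[of _ n n])

lemma spectral_mat_vec:
  assumes "unitary_mat n U" "v \<in> carrier_vec n"
  shows "spectral_mat n U F *\<^sub>v v = U *\<^sub>v vec n (\<lambda>i. complex_of_real (F i) * (mat_adjoint U *\<^sub>v v) $ i)"
proof -
  have U: "U \<in> carrier_mat n n" using assms by simp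
  have "mat_diag n (\<lambda>i. complex_of_real (F i)) *\<^sub>v (mat_adjoint U *\<^sub>v v)
    = vec n (\<lambda>i. complex_of_real (F i) * (mat_adjoint U *\<^sub>v v) $ i)"
    using U assms(2) by (intro eq_vecI)
      (auto simp: mat_diag_def scalar_prod_def if_distrib[of "\<lambda>x. x * _"] cong: if_cong)
  moreover have "spectral_mat n U F *\<^sub>v v = U *\<^sub>v (mat_diag n (\<lambda>i. complex_of_real (F i)) *\<^sub>v (mat_adjoint U *\<^sub>v v))"
    unfolding spectral_mat_def using U assms(2)
    by (simp add: assoc_mult_mat_vec[of _ n n _ n] mult_carrier_mat[of _ n n _ n] mult_mat_vec_carrier[of _ n n])
  ultimately show ?thesis by simp
qed

lemma spectral_mat_adjoint [simp]:
  assumes "unitary_mat n U"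
  shows "mat_adjoint (spectral_mat n U F) = spectral_mat n U F"
proof -
  have U: "U \<in> carrier_mat n n" using assms by simp
  show ?thesis
    using adjoint_congruence[of "mat_diag n (\<lambda>i. complex_of_real (F i))" n "mat_adjoint U" n] U
    unfolding spectral_mat_def by simp
qed

lemma spectral_mat_mult:
  assumes "unitary_mat n U"
  shows "spectral_mat n U F * spectral_mat n U G = spectral_mat n U (\<lambda>i. F i * G i)"
proof -
  have U: "U \<in> carrier_mat n n" using assms by simp
  let ?F = "mat_diag n (\<lambda>i. complex_of_real (F i))" and ?G = "mat_diag n (\<lambda>i. complex_of_real (G i))"
  have "spectral_mat n U F * spectral_mat n U G = U * (?F * ((mat_adjoint U * U) * (?G * mat_adjoint U)))"
    unfolding spectral_mat_def using U
    by (simp add: assoc_mult_mat[of _ n n _ n _ n] mult_carrier_mat[of _ n n _ n])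
  also have "\<dots> = U * ((?F * ?G) * mat_adjoint U)"
    using assms U unfolding unitary_mat_def
    by (simp add: assoc_mult_mat[of _ n n _ n _ n] mult_carrier_mat[of _ n n _ n] left_mult_one_mat[of _ n n] del: mat_diag_diag)
  also have "\<dots> = spectral_mat n U (\<lambda>i. F i * G i)"
    unfolding spectral_mat_def using U
    by (simp add: assoc_mult_mat[of _ n n _ n _ n] mult_carrier_mat[of _ n n _ n])
  finally show ?thesis .
qed

lemma spectral_mat_index:
  assumes "unitary_mat n U" "i < n" "j < n"
  shows "spectral_mat n U F $$ (i, j) = (\<Sum>k<n. U $$ (i, k) * of_real (F k) * cnj (U $$ (j, k)))"
proof -
  have U: "U \<in> carrier_mat n n" using assms by simp
  show ?thesis unfolding spectral_mat_def mat_diag_mult_right[OF U] using U assms(2,3)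
    by (auto simp: scalar_prod_def atLeast0LessThan intro!: sum.cong)
qed

lemma spectral_mat_const:
  assumes "unitary_mat n U"
  shows "spectral_mat n U (\<lambda>_. c) = complex_of_real c \<cdot>\<^sub>m 1\<^sub>m n"
proof -
  have U: "U \<in> carrier_mat n n" using assms by simp
  have "mat_diag n (\<lambda>i. complex_of_real c) = complex_of_real c \<cdot>\<^sub>m 1\<^sub>m n"
    by (rule eq_matI) (auto simp: mat_diag_def)
  thus ?thesis using assms U unfolding spectral_mat_def unitary_mat_def
    by (simp add: mult_smult_distrib[of _ n n _ n] mult_smult_assoc_mat[of _ n n _ n])
qed

lemma spectral_mat_add:
  assumes "unitary_mat n U"
  shows "spectral_mat n U (\<lambda>i. F i + G i) = spectral_mat n U F + spectral_mat n U G"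
  using assms spectral_mat_carrier[OF assms]
  by (intro eq_matI) (auto simp: spectral_mat_index sum.distrib algebra_simps carrier_matD[OF spectral_mat_carrier[OF assms]])

lemma spectral_mat_smult:
  assumes "unitary_mat n U"
  shows "spectral_mat n U (\<lambda>i. c * F i) = complex_of_real c \<cdot>\<^sub>m spectral_mat n U F"
  using assms
  by (intro eq_matI) (auto simp: spectral_mat_index sum_distrib_left algebra_simps carrier_matD[OF spectral_mat_carrier[OF assms]])

lemma spectral_mat_cong:
  "(\<And>i. i < n \<Longrightarrow> F i = G i) \<Longrightarrow> spectral_mat n U F = spectral_mat n U G"
  unfolding spectral_mat_def mat_diag_def by (intro arg_cong2[where f = times] cong_mat refl) auto

lemma norm_sq_sum: "v \<in> carrier_vec n \<Longrightarrow> (cvec_norm v)\<^sup>2 = (\<Sum>i<n. (cmod (v $ i))\<^sup>2)"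
  unfolding cvec_norm_def L2_set_def by (auto simp: sum_nonneg)

lemma adjoint_vec_carrier: "A \<in> carrier_mat m n \<Longrightarrow> v \<in> carrier_vec m \<Longrightarrow> mat_adjoint A *\<^sub>v v \<in> carrier_vec n"
  by (rule mult_mat_vec_carrier) auto

lemma norm_sq_coordinates:
  assumes "unitary_mat n U" "v \<in> carrier_vec n"
  shows "(cvec_norm v)\<^sup>2 = (\<Sum>i<n. (cmod ((mat_adjoint U *\<^sub>v v) $ i))\<^sup>2)"
  using unitary_norm[OF unitary_adjoint[OF assms(1)] assms(2)] norm_sq_sum[of "mat_adjoint U *\<^sub>v v" n]
    adjoint_vec_carrier[of U n n v] assms by simp

lemma spectral_mat_norm_sq:
  assumes "unitary_mat n U" "v \<in> carrier_vec n"
  shows "(cvec_norm (spectral_mat n U F *\<^sub>v v))\<^sup>2 = (\<Sum>i<n. (F i)\<^sup>2 * (cmod ((mat_adjoint U *\<^sub>v v) $ i))\<^sup>2)"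
  unfolding spectral_mat_vec[OF assms]
  by (subst unitary_norm[OF assms(1)], simp, subst norm_sq_sum[of _ n])
     (auto simp: norm_mult power_mult_distrib)

text \<open>On Hermitian matrices the quadratic form is real; taking the real part makes it a real number for
  every matrix.\<close>

definition qform :: "complex mat \<Rightarrow> complex vec \<Rightarrow> real" where
  "qform M v = Re ((M *\<^sub>v v) \<bullet>c v)"

lemma qform_spectral_mat:
  assumes "unitary_mat n U" "v \<in> carrier_vec n"
  shows "qform (spectral_mat n U F) v = (\<Sum>i<n. F i * (cmod ((mat_adjoint U *\<^sub>v v) $ i))\<^sup>2)"
proof -
  define c where "c = mat_adjoint U *\<^sub>v v"
  let ?d = "vec n (\<lambda>i. complex_of_real (F i) * c $ i)"
  have U: "U \<in> carrier_mat n n" using assms by simp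
  have c: "c \<in> carrier_vec n" unfolding c_def using adjoint_vec_carrier[OF U assms(2)] .
  have "(spectral_mat n U F *\<^sub>v v) \<bullet>c v = ?d \<bullet>c c"
    unfolding spectral_mat_vec[OF assms] c_def by (rule cscalar_adjoint[OF U _ assms(2)]) simp
  also have "\<dots> = (\<Sum>i<n. of_real (F i) * (c $ i * cnj (c $ i)))"
    using c by (auto simp: scalar_prod_def atLeast0LessThan mult.assoc intro!: sum.cong)
  also have "\<dots> = (\<Sum>i<n. of_real (F i * (cmod (c $ i))\<^sup>2))"
    by (simp only: complex_norm_square of_real_mult)
  finally have "(spectral_mat n U F *\<^sub>v v) \<bullet>c v = of_real (\<Sum>i<n. F i * (cmod (c $ i))\<^sup>2)" by simp
  thus ?thesis unfolding qform_def c_def by simp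
qed

lemma qform_one: "v \<in> carrier_vec n \<Longrightarrow> qform (1\<^sub>m n) v = (cvec_norm v)\<^sup>2"
  unfolding qform_def by (simp add: cscalar_self del: of_real_power)

lemma qform_bound:
  assumes "M \<in> carrier_mat n n" "v \<in> carrier_vec n" "cvec_norm (M *\<^sub>v v) \<le> e * cvec_norm v"
  shows "\<bar>qform M v\<bar> \<le> e * (cvec_norm v)\<^sup>2"
proof -
  have "\<bar>qform M v\<bar> \<le> cmod ((M *\<^sub>v v) \<bullet>c v)" unfolding qform_def by (rule abs_Re_le_cmod)
  also have "\<dots> \<le> cvec_norm (M *\<^sub>v v) * cvec_norm v"
    using assms by (intro cscalar_CS[of _ n]) auto
  also have "\<dots> \<le> e * cvec_norm v * cvec_norm v"
    using assms by (intro mult_right_mono) auto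
  finally show ?thesis by (simp add: power2_eq_square mult.assoc)
qed

lemma qform_minus:
  assumes "M \<in> carrier_mat n n" "N \<in> carrier_mat n n" "v \<in> carrier_vec n"
  shows "qform (M - N) v = qform M v - qform N v"
  using assms unfolding qform_def
  by (simp add: minus_mult_distrib_mat_vec[of _ n n] minus_scalar_prod_distrib[of _ n])

lemma qform_congruence:
  assumes "M \<in> carrier_mat n n" "W \<in> carrier_mat n m" "v \<in> carrier_vec m"
  shows "qform (mat_adjoint W * M * W) v = qform M (W *\<^sub>v v)"
proof -
  have W: "W *\<^sub>v v \<in> carrier_vec n" using assms by auto
  have "(mat_adjoint W * M * W) *\<^sub>v v = mat_adjoint W *\<^sub>v (M *\<^sub>v (W *\<^sub>v v))"
    using assms by (simp add: assoc_mult_mat_vec[of _ m n _ m] assoc_mult_mat_vec[of _ m n _ n] mult_carrier_mat[of _ m n _ n])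
  thus ?thesis unfolding qform_def
    using cscalar_adjoint[of "mat_adjoint W" m n "M *\<^sub>v (W *\<^sub>v v)" v] assms W by auto
qed

lemma eigenvector_of_diagonalized:
  assumes "diagonalizes n U D M" "i < n"
  shows "M *\<^sub>v (U *\<^sub>v unit_vec n i) = complex_of_real (D i) \<cdot>\<^sub>v (U *\<^sub>v unit_vec n i)"
proof -
  have U: "unitary_mat n U" and M: "M = spectral_mat n U D" using assms unfolding diagonalizes_spectral_mat by auto
  have Uc: "U \<in> carrier_mat n n" using U by simp
  have "vec n (\<lambda>k. complex_of_real (D k) * unit_vec n i $ k) = complex_of_real (D i) \<cdot>\<^sub>v unit_vec n i"
    using assms(2) by (intro eq_vecI) (auto simp: unit_vec_def)
  thus ?thesis unfolding M
    using spectral_mat_vec[OF U, of "U *\<^sub>v unit_vec n i" D] Uc U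
    by (auto simp: mult_mat_vec[OF Uc])
qed

lemma cvec_norm_unit: "i < n \<Longrightarrow> cvec_norm (unit_vec n i) = 1"
proof -
  assume i: "i < n"
  have "(cvec_norm (unit_vec n i))\<^sup>2 = (\<Sum>k<n. if k = i then 1 else 0)"
    by (subst norm_sq_sum[of _ n], simp) (intro sum.cong, auto simp: unit_vec_def)
  hence "(cvec_norm (unit_vec n i))\<^sup>2 = 1" using i by simp
  thus ?thesis using cvec_norm_nonneg[of "unit_vec n i"] by (simp add: power2_eq_1_iff)
qed

lemma eigenvalue_bound:
  assumes "diagonalizes n U D M" "i < n" "M \<in> carrier_mat n n"
    "\<And>i j. i < n \<Longrightarrow> j < n \<Longrightarrow> cmod (M $$ (i, j)) \<le> e"
  shows "\<bar>D i\<bar> \<le> n * n * e"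
proof -
  let ?v = "U *\<^sub>v unit_vec n i"
  have U: "unitary_mat n U" using assms unfolding diagonalizes_def by auto
  have v: "?v \<in> carrier_vec n" using mult_mat_vec_carrier[OF unitary_carrier[OF U]] by simp
  have "cvec_norm ?v = 1" using unitary_norm[OF U] cvec_norm_unit[OF assms(2)] by simp
  thus ?thesis
    using mat_vec_bound[OF assms(3) v assms(4)] unfolding eigenvector_of_diagonalized[OF assms(1,2)]
    by (simp add: cvec_norm_smult)
qed

lemma qform_eigenvalue:
  assumes "diagonalizes n U D M" "i < n"
  shows "qform M (U *\<^sub>v unit_vec n i) = D i"
proof -
  have U: "unitary_mat n U" and M: "M = spectral_mat n U D" using assms unfolding diagonalizes_spectral_mat by auto
  have "qform M (U *\<^sub>v unit_vec n i) = (\<Sum>k<n. D k * (cmod (unit_vec n i $ k))\<^sup>2)"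
    unfolding M using qform_spectral_mat[OF U, of "U *\<^sub>v unit_vec n i" D] U by (simp add: mult_mat_vec_carrier[of _ n n])
  also have "\<dots> = (\<Sum>k<n. if k = i then D i else 0)" by (intro sum.cong) (auto simp: unit_vec_def)
  finally show ?thesis using assms(2) by simp
qed

section \<open>Continuous fields of matrices\<close>

lemma scaled_one_vec:
  fixes v :: "complex vec"
  assumes "v \<in> carrier_vec n"
  shows "(c \<cdot>\<^sub>m 1\<^sub>m n) *\<^sub>v v = c \<cdot>\<^sub>v v"
proof (rule eq_vecI)
  fix i assume "i < dim_vec (c \<cdot>\<^sub>v v)"
  hence i: "i < n" using assms by auto
  have "((c \<cdot>\<^sub>m 1\<^sub>m n) *\<^sub>v v) $ i = (\<Sum>k<n. c * (if k = i then 1 else 0) * v $ k)"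
    using i assms by (auto simp: scalar_prod_def atLeast0LessThan)
  also have "\<dots> = (\<Sum>k<n. if k = i then c * v $ i else 0)" by (rule sum.cong) auto
  finally show "((c \<cdot>\<^sub>m 1\<^sub>m n) *\<^sub>v v) $ i = (c \<cdot>\<^sub>v v) $ i" using i assms by simp
qed (use assms in auto)

lemma matC_D:
  assumes "a \<in> matC X n"
  shows "x \<in> X \<Longrightarrow> a x \<in> carrier_mat n n"
    "i < n \<Longrightarrow> j < n \<Longrightarrow> continuous_on X (\<lambda>x. a x $$ (i, j))"
  using assms unfolding matC_def by auto

lemma matC_dim:
  assumes "a \<in> matC X n" "x \<in> X"
  shows "dim_row (a x) = n" "dim_col (a x) = n"
  using matC_D(1)[OF assms] by auto

lemma matC_const: "A \<in> carrier_mat n n \<Longrightarrow> (\<lambda>_. A) \<in> matC X n"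
  unfolding matC_def by auto

lemma matC_I:
  assumes "\<And>x. x \<in> X \<Longrightarrow> a x \<in> carrier_mat n n"
    and f: "\<And>i j. i < n \<Longrightarrow> j < n \<Longrightarrow> continuous_on X (f i j)"
    and eq: "\<And>x i j. x \<in> X \<Longrightarrow> i < n \<Longrightarrow> j < n \<Longrightarrow> a x $$ (i, j) = f i j x"
  shows "a \<in> matC X n"
proof -
  have "continuous_on X (\<lambda>x. a x $$ (i, j))" if "i < n" "j < n" for i j
    using f[OF that] eq[OF _ that] by (simp cong: continuous_on_cong)
  thus ?thesis using assms(1) unfolding matC_def by auto
qed

lemma matC_mult:
  assumes "a \<in> matC X n" "b \<in> matC X n"
  shows "(\<lambda>x. a x * b x) \<in> matC X n"
proof (rule matC_I[where f = "\<lambda>i j x. \<Sum>k<n. a x $$ (i, k) * b x $$ (k, j)"])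
  show "continuous_on X (\<lambda>x. \<Sum>k<n. a x $$ (i, k) * b x $$ (k, j))" if "i < n" "j < n" for i j
    using assms that by (auto intro!: continuous_intros matC_D)
qed (use matC_D(1)[OF assms(1)] matC_D(1)[OF assms(2)] matC_dim[OF assms(1)] matC_dim[OF assms(2)] in
    \<open>auto simp: scalar_prod_def atLeast0LessThan intro!: mult_carrier_mat[of _ n n]\<close>)

lemma matC_add:
  assumes "a \<in> matC X n" "b \<in> matC X n"
  shows "(\<lambda>x. a x + b x) \<in> matC X n"
proof (rule matC_I[where f = "\<lambda>i j x. a x $$ (i, j) + b x $$ (i, j)"])
  show "continuous_on X (\<lambda>x. a x $$ (i, j) + b x $$ (i, j))" if "i < n" "j < n" for i j
    using assms that by (auto intro!: continuous_intros matC_D)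
qed (use matC_D(1)[OF assms(1)] matC_D(1)[OF assms(2)] matC_dim[OF assms(1)] matC_dim[OF assms(2)] in auto)

lemma matC_scale:
  assumes "a \<in> matC X n" "continuous_on X f"
  shows "(\<lambda>x. f x \<cdot>\<^sub>m a x) \<in> matC X n"
proof (rule matC_I[where f = "\<lambda>i j x. f x * a x $$ (i, j)"])
  show "continuous_on X (\<lambda>x. f x * a x $$ (i, j))" if "i < n" "j < n" for i j
    using assms that by (auto intro!: continuous_intros matC_D)
qed (use matC_D(1)[OF assms(1)] matC_dim[OF assms(1)] in auto)

lemma matC_adjoint:
  assumes "a \<in> matC X n"
  shows "(\<lambda>x. mat_adjoint (a x)) \<in> matC X n"
proof (rule matC_I[where f = "\<lambda>i j x. cnj (a x $$ (j, i))"])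
  show "continuous_on X (\<lambda>x. cnj (a x $$ (j, i)))" if "i < n" "j < n" for i j
    using assms that by (auto intro!: continuous_intros matC_D)
qed (use matC_D(1)[OF assms] matC_dim[OF assms] in auto)

lemma matC_cong:
  assumes "\<And>x. x \<in> X \<Longrightarrow> a x = b x"
  shows "a \<in> matC X n \<longleftrightarrow> b \<in> matC X n"
proof -
  have "continuous_on X (\<lambda>x. a x $$ (i, j)) = continuous_on X (\<lambda>x. b x $$ (i, j))" for i j
    using assms by (intro continuous_on_cong) auto
  thus ?thesis using assms unfolding matC_def by auto
qed

lemma matC_bounded:
  fixes X :: "'a::topological_space set"
  assumes "compact X" "a \<in> matC X n"
  obtains e where "e \<ge> 0" "\<And>x i j. x \<in> X \<Longrightarrow> i < n \<Longrightarrow> j < n \<Longrightarrow> cmod (a x $$ (i, j)) \<le> e"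
proof -
  have "\<exists>B. \<forall>x\<in>X. cmod (a x $$ (i, j)) \<le> B" if "i < n" "j < n" for i j
  proof -
    have "compact ((\<lambda>x. a x $$ (i, j)) ` X)"
      using assms(1) matC_D(2)[OF assms(2) that] by (rule compact_continuous_image[rotated])
    thus ?thesis using compact_imp_bounded bounded_iff by (metis image_eqI)
  qed
  then obtain B where B: "\<And>i j x. i < n \<Longrightarrow> j < n \<Longrightarrow> x \<in> X \<Longrightarrow> cmod (a x $$ (i, j)) \<le> B i j" by metis
  define e where "e = (\<Sum>i<n. \<Sum>j<n. \<bar>B i j\<bar>)"
  have "cmod (a x $$ (i, j)) \<le> e" if "x \<in> X" "i < n" "j < n" for x i j
  proof -
    have "cmod (a x $$ (i, j)) \<le> \<bar>B i j\<bar>" using B[OF that(2,3,1)] by simp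
    also have "\<dots> \<le> (\<Sum>j<n. \<bar>B i j\<bar>)" using that by (intro member_le_sum) auto
    also have "\<dots> \<le> e" unfolding e_def using that
      by (intro member_le_sum[of i "{..<n}" "\<lambda>i. \<Sum>j<n. \<bar>B i j\<bar>"]) (auto intro: sum_nonneg)
    finally show ?thesis .
  qed
  moreover have "e \<ge> 0" unfolding e_def by (intro sum_nonneg) auto
  ultimately show ?thesis using that by blast
qed

lemma continuous_on_approx:
  fixes f :: "'a::topological_space \<Rightarrow> 'b::metric_space"
  assumes "\<And>e. e > 0 \<Longrightarrow> \<exists>g. continuous_on X g \<and> (\<forall>x\<in>X. dist (f x) (g x) < e)"
  shows "continuous_on X f"
proof -
  have "\<exists>g. continuous_on X g \<and> (\<forall>x\<in>X. dist (f x) (g x) < inverse (Suc k))" for k :: nat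
    using assms by auto
  then obtain g where g: "\<And>k. continuous_on X (g k)" "\<And>k x. x \<in> X \<Longrightarrow> dist (f x) (g k x) < inverse (Suc k)"
    by metis
  have "uniform_limit X g f sequentially"
  proof (rule uniform_limitI)
    fix e :: real assume "e > 0"
    then obtain N where N: "inverse (Suc N) < e" using reals_Archimedean by blast
    have "\<forall>x\<in>X. dist (g k x) (f x) < e" if "k \<ge> N" for k
    proof
      fix x assume "x \<in> X"
      hence "dist (f x) (g k x) < inverse (Suc k)" by (rule g)
      also have "\<dots> \<le> inverse (real (Suc N))" using that by (intro le_imp_inverse_le) auto
      also have "\<dots> < e" by (rule N)
      finally show "dist (g k x) (f x) < e" by (simp add: dist_commute)
    qed
    thus "\<forall>\<^sub>F k in sequentially. \<forall>x\<in>X. dist (g k x) (f x) < e" by (auto simp: eventually_sequentially)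
  qed
  thus ?thesis by (rule uniform_limit_theorem[rotated]) (auto simp: g)
qed

text \<open>For a polynomial \<open>g\<close> the matrix \<open>g(a x)\<close> is a polynomial in the entries of \<open>a x\<close>. The induction
  follows the inductive definition of polynomial functions, so sums and products of functions become
  sums and products of matrices.\<close>

lemma polynomial_calculus_continuous:
  assumes g: "real_polynomial_function g" and a: "a \<in> matC X n"
    and d: "\<And>x. x \<in> X \<Longrightarrow> diagonalizes n (U x) (D x) (a x)"
  shows "(\<lambda>x. spectral_mat n (U x) (\<lambda>i. g (D x i))) \<in> matC X n"
  using g
proof induction
  case (linear h)
  have h: "h t = h 1 * t" for t using linear
    by (metis bounded_linear.linear linear_scale mult.commute mult.right_neutral real_scaleR_def)
  have "(\<lambda>x. complex_of_real (h 1) \<cdot>\<^sub>m a x) \<in> matC X n" by (intro matC_scale a) auto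
  moreover have "spectral_mat n (U x) (\<lambda>i. h (D x i)) = complex_of_real (h 1) \<cdot>\<^sub>m a x" if "x \<in> X" for x
  proof -
    have "spectral_mat n (U x) (\<lambda>i. h (D x i)) = spectral_mat n (U x) (\<lambda>i. h 1 * D x i)"
      by (intro spectral_mat_cong h)
    thus ?thesis using d[OF that] by (simp add: spectral_mat_smult diagonalizes_spectral_mat)
  qed
  ultimately show ?case by (simp cong: matC_cong)
next
  case (const c)
  have "(\<lambda>x. complex_of_real c \<cdot>\<^sub>m 1\<^sub>m n) \<in> matC X n" by (rule matC_const) auto
  moreover have "spectral_mat n (U x) (\<lambda>i. c) = complex_of_real c \<cdot>\<^sub>m 1\<^sub>m n" if "x \<in> X" for x
    using d[OF that] by (simp add: spectral_mat_const diagonalizes_spectral_mat)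
  ultimately show ?case by (simp cong: matC_cong)
next
  case (add f g)
  have "spectral_mat n (U x) (\<lambda>i. f (D x i) + g (D x i))
    = spectral_mat n (U x) (\<lambda>i. f (D x i)) + spectral_mat n (U x) (\<lambda>i. g (D x i))" if "x \<in> X" for x
    using d[OF that] by (simp add: spectral_mat_add diagonalizes_spectral_mat)
  with matC_add[OF add.IH] show ?case by (simp cong: matC_cong)
next
  case (mult f g)
  have "spectral_mat n (U x) (\<lambda>i. f (D x i) * g (D x i))
    = spectral_mat n (U x) (\<lambda>i. f (D x i)) * spectral_mat n (U x) (\<lambda>i. g (D x i))" if "x \<in> X" for x
    using d[OF that] by (simp add: spectral_mat_mult diagonalizes_spectral_mat)
  with matC_mult[OF mult.IH] show ?case by (simp cong: matC_cong)
qed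

text \<open>The eigenbases \<open>U x\<close> and eigenvalues \<open>D x\<close> may vary discontinuously with \<open>x\<close>, yet \<open>f(a x)\<close> is
  continuous: on the compact interval that contains all eigenvalues \<open>f\<close> is a uniform limit of
  polynomials, and a change of \<open>f\<close> by at most \<open>e\<close> changes the entries of \<open>f(a x)\<close> by at most a
  multiple of \<open>e\<close>.\<close>

theorem functional_calculus_continuous:
  fixes f :: "real \<Rightarrow> real"
  assumes X: "compact X" and a: "a \<in> matC X n" and f: "continuous_on UNIV f"
    and d: "\<And>x. x \<in> X \<Longrightarrow> diagonalizes n (U x) (D x) (a x)"
  shows "(\<lambda>x. spectral_mat n (U x) (\<lambda>i. f (D x i))) \<in> matC X n"
proof -
  have U: "unitary_mat n (U x)" if "x \<in> X" for x using d[OF that] unfolding diagonalizes_def by auto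
  obtain e0 where e0: "\<And>x i j. x \<in> X \<Longrightarrow> i < n \<Longrightarrow> j < n \<Longrightarrow> cmod (a x $$ (i, j)) \<le> e0"
    by (rule matC_bounded[OF X a]) metis
  define R where "R = n * n * e0"
  have D: "D x i \<in> {-R..R}" if "x \<in> X" "i < n" for x i
    using eigenvalue_bound[OF d[OF that(1)] that(2) matC_D(1)[OF a that(1)] e0[OF that(1)]]
    unfolding R_def by auto
  have "continuous_on X (\<lambda>x. spectral_mat n (U x) (\<lambda>i. f (D x i)) $$ (i, j))" if ij: "i < n" "j < n" for i j
  proof (rule continuous_on_approx)
    fix e :: real assume e: "e > 0"
    have "e / (real n + 1) > 0" using e by simp
    then obtain g where g: "real_polynomial_function g" "\<And>t. t \<in> {-R..R} \<Longrightarrow> \<bar>f t - g t\<bar> < e / (real n + 1)"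
      using Stone_Weierstrass_real_polynomial_function[of "{-R..R}" f "e / (real n + 1)"]
        continuous_on_subset[OF f] by auto
    have "continuous_on X (\<lambda>x. spectral_mat n (U x) (\<lambda>i. g (D x i)) $$ (i, j))"
      using polynomial_calculus_continuous[OF g(1) a d] ij by (rule matC_D(2))
    moreover have "dist (spectral_mat n (U x) (\<lambda>i. f (D x i)) $$ (i, j)) (spectral_mat n (U x) (\<lambda>i. g (D x i)) $$ (i, j)) < e"
      if x: "x \<in> X" for x
    proof -
      have *: "cmod (U x $$ (i, k) * of_real (f (D x k) - g (D x k)) * cnj (U x $$ (j, k))) \<le> e / (real n + 1)"
        if "k < n" for k
      proof -
        have "cmod (U x $$ (i, k)) \<le> 1" "cmod (U x $$ (j, k)) \<le> 1"
          using unitary_component[OF U[OF x]] ij that by auto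
        moreover have "\<bar>f (D x k) - g (D x k)\<bar> \<le> e / (real n + 1)"
          using g(2)[OF D[OF x that]] by simp
        ultimately have "cmod (U x $$ (i, k)) * \<bar>f (D x k) - g (D x k)\<bar> * cmod (U x $$ (j, k)) \<le> 1 * (e / (real n + 1)) * 1"
          using e by (intro mult_mono) auto
        thus ?thesis by (simp add: norm_mult del: of_real_diff)
      qed
      have "dist (spectral_mat n (U x) (\<lambda>i. f (D x i)) $$ (i, j)) (spectral_mat n (U x) (\<lambda>i. g (D x i)) $$ (i, j))
         = cmod (\<Sum>k<n. U x $$ (i, k) * of_real (f (D x k) - g (D x k)) * cnj (U x $$ (j, k)))"
        using U[OF x] ij by (simp add: dist_norm spectral_mat_index sum_subtractf algebra_simps)
      also have "\<dots> \<le> (\<Sum>k<n. e / (real n + 1))"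
        using * by (intro sum_norm_le) auto
      also have "\<dots> < e" using e by (simp add: field_simps)
      finally show ?thesis .
    qed
    ultimately show "\<exists>h. continuous_on X h \<and> (\<forall>x\<in>X. dist (spectral_mat n (U x) (\<lambda>i. f (D x i)) $$ (i, j)) (h x) < e)"
      by blast
  qed
  thus ?thesis using U unfolding matC_def by auto
qed

text \<open>A negative eigenvalue at a single point makes \<open>a - D i\<close> singular there, so \<open>D i\<close> lies in the
  spectrum of the field \<open>a\<close>.\<close>

lemma matC_positive_eigenvalues:
  assumes "matC_positive X n a" "x \<in> X" "diagonalizes n U D (a x)" "i < n"
  shows "D i \<ge> 0"
proof (rule ccontr)
  assume neg: "\<not> D i \<ge> 0"
  have a: "a x \<in> carrier_mat n n" using assms unfolding matC_positive_def by (auto dest: matC_D)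
  have U: "unitary_mat n U" using assms unfolding diagonalizes_def by auto
  let ?v = "U *\<^sub>v unit_vec n i"
  have v: "?v \<in> carrier_vec n" using mult_mat_vec_carrier[OF unitary_carrier[OF U]] by simp
  have v1: "cvec_norm ?v = 1" using unitary_norm[OF U] cvec_norm_unit[OF assms(4)] by simp
  let ?A = "a x - complex_of_real (D i) \<cdot>\<^sub>m 1\<^sub>m n"
  have A: "?A \<in> carrier_mat n n" using a by auto
  have "?A *\<^sub>v ?v = a x *\<^sub>v ?v - complex_of_real (D i) \<cdot>\<^sub>v ?v"
    using a v scaled_one_vec[OF v] by (subst minus_mult_distrib_mat_vec[of _ n n]) auto
  also have "\<dots> = 0\<^sub>v n" unfolding eigenvector_of_diagonalized[OF assms(3,4)] using v by auto
  finally have Av: "?A *\<^sub>v ?v = 0\<^sub>v n" .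
  have "complex_of_real (D i) \<in> matC_spectrum X n a"
    unfolding matC_spectrum_def
  proof (intro CollectI notI, elim bexE)
    fix c assume c: "c \<in> matC X n" "\<forall>x\<in>X. c x * (a x - complex_of_real (D i) \<cdot>\<^sub>m 1\<^sub>m n) = 1\<^sub>m n \<and>
        (a x - complex_of_real (D i) \<cdot>\<^sub>m 1\<^sub>m n) * c x = 1\<^sub>m n"
    have cx: "c x \<in> carrier_mat n n" "c x * ?A = 1\<^sub>m n" using c assms(2) by (auto dest: matC_D)
    have "?v = (c x * ?A) *\<^sub>v ?v" unfolding cx(2) using v by simp
    also have "\<dots> = c x *\<^sub>v 0\<^sub>v n" using assoc_mult_mat_vec[OF cx(1) A v] Av by simp
    also have "\<dots> = 0\<^sub>v n" using cx(1) by (intro eq_vecI) auto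
    finally show False using v1 by simp
  qed
  hence "complex_of_real (D i) \<in> \<real>\<^sub>\<ge>\<^sub>0" using assms unfolding matC_positive_def by auto
  thus False using neg by simp
qed

section \<open>Cuntz subequivalence from domination of quadratic forms\<close>

lemma mat_opnorm_le:
  assumes "M \<in> carrier_mat n n" "e \<ge> 0" "\<And>v. v \<in> carrier_vec n \<Longrightarrow> cvec_norm (M *\<^sub>v v) \<le> e * cvec_norm v"
  shows "mat_opnorm M \<le> e" "mat_opnorm M \<ge> 0"
proof -
  let ?S = "{cvec_norm (M *\<^sub>v v) |v. v \<in> carrier_vec (dim_col M) \<and> cvec_norm v \<le> 1}"
  have le: "s \<le> e" if s: "s \<in> ?S" for s
  proof -
    obtain v where v: "v \<in> carrier_vec n" "cvec_norm v \<le> 1" "s = cvec_norm (M *\<^sub>v v)"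
      using s assms(1) by auto
    have "s \<le> e * cvec_norm v" using assms(3) v by auto
    also have "\<dots> \<le> e * 1" using v assms(2) by (intro mult_left_mono) auto
    finally show ?thesis by simp
  qed
  have 0: "cvec_norm (M *\<^sub>v 0\<^sub>v n) \<in> ?S" using assms(1) by (intro CollectI exI[of _ "0\<^sub>v n"]) auto
  hence ne: "?S \<noteq> {}" by blast
  show "mat_opnorm M \<le> e" unfolding mat_opnorm_def using ne le by (intro cSup_least) auto
  have "bdd_above ?S" using le by (rule bdd_aboveI)
  hence "cvec_norm (M *\<^sub>v 0\<^sub>v n) \<le> mat_opnorm M" unfolding mat_opnorm_def using 0 by (intro cSup_upper) auto
  thus "mat_opnorm M \<ge> 0" using cvec_norm_nonneg order_trans by blast
qed

lemma corner_id: "M \<in> carrier_mat n n \<Longrightarrow> corner n M = M"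
  unfolding corner_def by (rule eq_matI) auto

text \<open>All approximating elements can be taken of the same size \<open>n\<close>, where the corner embedding is the
  identity.\<close>

lemma cuntz_subeqI:
  assumes a: "a \<in> matC X n" and b: "b \<in> matC X n"
    and ap: "\<And>e. e > 0 \<Longrightarrow> \<exists>v\<in>matC X n. \<forall>x\<in>X. \<forall>\<xi>\<in>carrier_vec n.
      cvec_norm ((v x * b x * mat_adjoint (v x) - a x) *\<^sub>v \<xi>) \<le> e * cvec_norm \<xi>"
  shows "cuntz_subeq X n a b"
proof -
  have "\<exists>v. \<forall>k::nat. v k \<in> matC X n \<and> (\<forall>x\<in>X. \<forall>\<xi>\<in>carrier_vec n.
      cvec_norm ((v k x * b x * mat_adjoint (v k x) - a x) *\<^sub>v \<xi>) \<le> inverse (Suc k) * cvec_norm \<xi>)"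
    using ap[of "inverse (Suc _)"] by (intro choice allI) (auto simp: Bex_def)
  then obtain v where v: "\<And>k::nat. v k \<in> matC X n"
    and vb: "\<And>k x \<xi>. x \<in> X \<Longrightarrow> \<xi> \<in> carrier_vec n \<Longrightarrow>
      cvec_norm ((v k x * b x * mat_adjoint (v k x) - a x) *\<^sub>v \<xi>) \<le> inverse (Suc k) * cvec_norm \<xi>"
    by blast
  let ?N = "\<lambda>k. matC_norm X (\<lambda>x. v k x * corner n (b x) * mat_adjoint (v k x) - corner n (a x))"
  have N: "0 \<le> ?N k \<and> ?N k \<le> inverse (Suc k)" for k
  proof -
    have op: "mat_opnorm (v k x * corner n (b x) * mat_adjoint (v k x) - corner n (a x)) \<in> {0..inverse (Suc k)}"
      if x: "x \<in> X" for x
    proof -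
      have c: "v k x \<in> carrier_mat n n" "a x \<in> carrier_mat n n" "b x \<in> carrier_mat n n"
        using matC_D(1)[OF v x] matC_D(1)[OF a x] matC_D(1)[OF b x] by auto
      have "v k x * b x * mat_adjoint (v k x) - a x \<in> carrier_mat n n"
        using c by (intro minus_carrier_mat) auto
      from mat_opnorm_le[OF this _ vb[OF x]] show ?thesis
        using c by (auto simp: corner_id)
    qed
    show ?thesis unfolding matC_norm_def using op
      by (auto intro!: cSup_least cSup_upper bdd_aboveI[of _ "inverse (Suc k)"])
  qed
  have "?N \<longlonglongrightarrow> 0"
  proof (rule tendsto_sandwich[of "\<lambda>_. 0" _ _ "\<lambda>k. inverse (Suc k)"])
    show "(\<lambda>k. inverse (real (Suc k))) \<longlonglongrightarrow> 0" by (rule LIMSEQ_inverse_real_of_nat)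
  qed (use N in auto)
  thus ?thesis unfolding cuntz_subeq_def using v
    by (intro exI[of _ "\<lambda>_. n"] exI[of _ v]) auto
qed

text \<open>A contraction has a contractive adjoint:
  \<open>\<parallel>T v\<parallel>\<^sup>2 = \<langle>v, T\<^sup>* T v\<rangle> \<le> \<parallel>v\<parallel> \<parallel>T v\<parallel>\<close>.\<close>

lemma norm_le_of_norm_adjoint_le:
  assumes "T \<in> carrier_mat n n" "v \<in> carrier_vec n"
    "\<And>w. w \<in> carrier_vec n \<Longrightarrow> cvec_norm (mat_adjoint T *\<^sub>v w) \<le> cvec_norm w"
  shows "cvec_norm (T *\<^sub>v v) \<le> cvec_norm v"
proof -
  have Tv: "T *\<^sub>v v \<in> carrier_vec n" using assms by auto
  have "(cvec_norm (T *\<^sub>v v))\<^sup>2 = cmod ((T *\<^sub>v v) \<bullet>c (T *\<^sub>v v))" unfolding cscalar_self by (simp add: norm_power)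
  also have "\<dots> = cmod (v \<bullet>c (mat_adjoint T *\<^sub>v (T *\<^sub>v v)))"
    using cscalar_adjoint[OF assms(1,2) Tv] by simp
  also have "\<dots> \<le> cvec_norm v * cvec_norm (mat_adjoint T *\<^sub>v (T *\<^sub>v v))"
    using assms Tv by (intro cscalar_CS[of _ n]) (auto intro: adjoint_vec_carrier)
  also have "\<dots> \<le> cvec_norm v * cvec_norm (T *\<^sub>v v)"
    using assms(3)[OF Tv] by (intro mult_left_mono) auto
  finally show ?thesis
    by (metis cvec_norm_nonneg mult_right_le_imp_le order.strict_iff_order power2_eq_square)
qed

text \<open>Here \<open>F = A\<^sup>1\<^sup>/\<^sup>2\<close> and \<open>G = (Y + e)\<^sup>-\<^sup>1\<^sup>/\<^sup>2\<close>. Since \<open>G Y G = 1 - e G\<^sup>2\<close>, the difference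
  \<open>F G Y G F - A\<close> equals \<open>- e (F G)(G F)\<close>. Domination of \<open>A\<close> by \<open>Y + e\<close> says that \<open>F G\<close> is a contraction,
  because \<open>\<parallel>F G w\<parallel>\<^sup>2\<close> is the form of \<open>A\<close> at \<open>G w\<close> and the form of \<open>Y + e\<close> at \<open>G w\<close> is \<open>\<parallel>w\<parallel>\<^sup>2\<close>; its
  adjoint \<open>G F\<close> is then a contraction as well.\<close>

lemma form_domination_contraction:
  assumes A: "diagonalizes n U D A" "\<And>i. i < n \<Longrightarrow> D i \<ge> 0"
    and Y: "diagonalizes n V E Y" "\<And>i. i < n \<Longrightarrow> E i \<ge> 0"
    and e: "e > 0"
    and dom: "\<And>\<xi>. \<xi> \<in> carrier_vec n \<Longrightarrow> qform A \<xi> \<le> e * (cvec_norm \<xi>)\<^sup>2 + qform Y \<xi>"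
    and F: "F = spectral_mat n U (\<lambda>i. sqrt (D i))"
    and G: "G = spectral_mat n V (\<lambda>i. inverse (sqrt (E i + e)))"
    and v: "v \<in> carrier_vec n"
  shows "cvec_norm ((F * G * Y * (G * F) - A) *\<^sub>v v) \<le> e * cvec_norm v"
proof -
  have U: "unitary_mat n U" and A': "A = spectral_mat n U D" using A unfolding diagonalizes_spectral_mat by auto
  have V: "unitary_mat n V" and Y': "Y = spectral_mat n V E" using Y unfolding diagonalizes_spectral_mat by auto
  have c: "F \<in> carrier_mat n n" "G \<in> carrier_mat n n" "A \<in> carrier_mat n n" "Y \<in> carrier_mat n n"
    using U V unfolding F G A' Y' by auto
  have h: "mat_adjoint F = F" "mat_adjoint G = G" using U V unfolding F G by auto
  have FF: "F * F = A" unfolding F A' spectral_mat_mult[OF U]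
    using A(2) by (intro spectral_mat_cong) auto
  have cc: "F * G \<in> carrier_mat n n" "G * F \<in> carrier_mat n n" using c by (auto intro: mult_carrier_mat)
  have h2: "mat_adjoint (F * G) = G * F" "mat_adjoint (G * F) = F * G"
    using adjoint_mult[OF c(1,2)] adjoint_mult[OF c(2,1)] h by auto
  have GYG: "G * Y * G = 1\<^sub>m n - complex_of_real e \<cdot>\<^sub>m (G * G)"
  proof -
    have "G * Y * G = spectral_mat n V (\<lambda>i. inverse (sqrt (E i + e)) * E i * inverse (sqrt (E i + e)))"
      unfolding G Y' by (simp add: spectral_mat_mult[OF V])
    also have "\<dots> = spectral_mat n V (\<lambda>i. 1 + (- e) * (inverse (sqrt (E i + e)) * inverse (sqrt (E i + e))))"
    proof (rule spectral_mat_cong)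
      fix i assume "i < n"
      hence E: "E i \<ge> 0" using Y by auto
      have "inverse (sqrt (E i + e)) * inverse (sqrt (E i + e)) = inverse (E i + e)"
        using E e by (simp add: inverse_mult_distrib[symmetric] del: inverse_mult_distrib)
      moreover have "E i * inverse (E i + e) = 1 + (- e) * inverse (E i + e)"
        using E e by (simp add: field_simps)
      ultimately show "inverse (sqrt (E i + e)) * E i * inverse (sqrt (E i + e))
        = 1 + (- e) * (inverse (sqrt (E i + e)) * inverse (sqrt (E i + e)))"
        by (metis mult.assoc mult.commute)
    qed
    also have "\<dots> = 1\<^sub>m n + complex_of_real (- e) \<cdot>\<^sub>m (G * G)"
      unfolding spectral_mat_add[OF V] spectral_mat_smult[OF V] spectral_mat_const[OF V] G spectral_mat_mult[OF V]
      by (auto intro!: arg_cong2[where f = "(+)"])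
    also have "\<dots> = 1\<^sub>m n - complex_of_real e \<cdot>\<^sub>m (G * G)"
      using c mult_carrier_mat[OF c(2,2)] by (intro eq_matI) auto
    finally show ?thesis .
  qed
  have FG: "cvec_norm ((F * G) *\<^sub>v w) \<le> cvec_norm w" if w: "w \<in> carrier_vec n" for w
  proof -
    let ?g = "G *\<^sub>v w"
    have g: "?g \<in> carrier_vec n" using c w by auto
    have ng: "(cvec_norm ?g)\<^sup>2 = qform (G * G) w"
      unfolding G spectral_mat_norm_sq[OF V w] spectral_mat_mult[OF V] qform_spectral_mat[OF V w]
      by (simp add: power2_eq_square)
    have "(cvec_norm ((F * G) *\<^sub>v w))\<^sup>2 = (cvec_norm (F *\<^sub>v ?g))\<^sup>2"
      using c w by (simp add: assoc_mult_mat_vec[of _ n n _ n])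
    also have "\<dots> = qform (F * F) ?g"
      unfolding F spectral_mat_norm_sq[OF U g] spectral_mat_mult[OF U] qform_spectral_mat[OF U g]
      by (simp only: power2_eq_square)
    also have "\<dots> \<le> e * (cvec_norm ?g)\<^sup>2 + qform Y ?g" unfolding FF by (rule dom[OF g])
    also have "qform Y ?g = qform (G * Y * G) w"
      using qform_congruence[OF c(4,2) w] h by simp
    also have "\<dots> = (cvec_norm w)\<^sup>2 - e * (cvec_norm ?g)\<^sup>2"
    proof -
      have "qform (complex_of_real e \<cdot>\<^sub>m (G * G)) w = e * qform (G * G) w"
        unfolding G spectral_mat_mult[OF V] spectral_mat_smult[OF V, symmetric] qform_spectral_mat[OF V w]
        by (simp add: sum_distrib_left mult.assoc)
      thus ?thesis unfolding GYG ng using c w mult_carrier_mat[OF c(2,2)]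
        by (subst qform_minus[of _ n]) (auto simp: qform_one)
    qed
    finally show ?thesis by (simp add: power2_le_iff_abs_le)
  qed
  have GF: "cvec_norm ((G * F) *\<^sub>v w) \<le> cvec_norm w" if w: "w \<in> carrier_vec n" for w
    using FG by (intro norm_le_of_norm_adjoint_le[OF cc(2) w]) (simp add: h2)
  have "F * G * Y * (G * F) = F * (G * Y * G) * F"
    using c by (simp add: assoc_mult_mat[of _ n n _ n _ n] mult_carrier_mat[of _ n n _ n])
  also have "\<dots> = (F * 1\<^sub>m n - F * (complex_of_real e \<cdot>\<^sub>m (G * G))) * F"
    unfolding GYG using c mult_carrier_mat[OF c(2,2)]
    by (subst mult_minus_distrib_mat[of _ n n _ n]) auto
  also have "\<dots> = F * F - complex_of_real e \<cdot>\<^sub>m (F * G * (G * F))"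
    using c mult_carrier_mat[OF c(2,2)] mult_carrier_mat[OF c(1) mult_carrier_mat[OF c(2,2)]]
    by (subst minus_mult_distrib_mat[of _ n n _ _ n])
       (auto simp: mult_smult_distrib[of _ n n _ n] mult_smult_assoc_mat[of _ n n _ n]
          assoc_mult_mat[of _ n n _ n _ n] mult_carrier_mat[of _ n n _ n])
  finally have eq: "F * G * Y * (G * F) - A = - (complex_of_real e \<cdot>\<^sub>m (F * G * (G * F)))"
    unfolding FF using c mult_carrier_mat[OF cc] by (intro eq_matI) auto
  have m: "(- (complex_of_real e \<cdot>\<^sub>m (F * G * (G * F)))) *\<^sub>v v = complex_of_real (- e) \<cdot>\<^sub>v ((F * G) *\<^sub>v ((G * F) *\<^sub>v v))"
  proof -
    have "(F * G) *\<^sub>v ((G * F) *\<^sub>v v) = (F * G * (G * F)) *\<^sub>v v"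
      using cc v by (simp add: assoc_mult_mat_vec[of _ n n _ n])
    moreover have "- (complex_of_real e \<cdot>\<^sub>m (F * G * (G * F))) = complex_of_real (- e) \<cdot>\<^sub>m (F * G * (G * F))"
      using mult_carrier_mat[OF cc] by (intro eq_matI) auto
    ultimately show ?thesis using scaled_mat_vec[OF mult_carrier_mat[OF cc] v] by simp
  qed
  have GFv: "(G * F) *\<^sub>v v \<in> carrier_vec n" using cc v by auto
  have "cvec_norm ((F * G * Y * (G * F) - A) *\<^sub>v v) = e * cvec_norm ((F * G) *\<^sub>v ((G * F) *\<^sub>v v))"
    unfolding eq m cvec_norm_smult using e by simp
  also have "\<dots> \<le> e * cvec_norm v"
    using FG[OF GFv] GF[OF v] e by (intro mult_left_mono) auto
  finally show ?thesis .
qed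

text \<open>With \<open>y = C w\<^sup>* b w\<close> the hypothesis reads \<open>a \<le> e + y\<close>. The field
  \<open>v = a\<^sup>1\<^sup>/\<^sup>2 (y + e)\<^sup>-\<^sup>1\<^sup>/\<^sup>2 u\<^sup>*\<close>, where \<open>u = C\<^sup>1\<^sup>/\<^sup>2 w\<close>, is continuous by the functional calculus, and
  \<open>v b v\<^sup>*\<close> is the product estimated in the preceding lemma.\<close>

theorem cuntz_subeq_if_dominated:
  assumes X: "compact X" and a: "matC_positive X n a" and b: "matC_positive X n b"
    and dom: "\<And>e. e > 0 \<Longrightarrow> \<exists>w\<in>matC X n. \<exists>C\<ge>0. \<forall>x\<in>X. \<forall>\<xi>\<in>carrier_vec n.
      qform (a x) \<xi> \<le> e * (cvec_norm \<xi>)\<^sup>2 + C * qform (b x) (w x *\<^sub>v \<xi>)"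
  shows "cuntz_subeq X n a b"
proof (rule cuntz_subeqI)
  show ac: "a \<in> matC X n" and bc: "b \<in> matC X n" using a b unfolding matC_positive_def by auto
  fix e :: real assume e: "e > 0"
  obtain w C where w: "w \<in> matC X n" and C: "C \<ge> 0"
    and wd: "\<And>x \<xi>. x \<in> X \<Longrightarrow> \<xi> \<in> carrier_vec n \<Longrightarrow>
      qform (a x) \<xi> \<le> e * (cvec_norm \<xi>)\<^sup>2 + C * qform (b x) (w x *\<^sub>v \<xi>)"
    using dom[OF e] by blast
  define u where "u = (\<lambda>x. complex_of_real (sqrt C) \<cdot>\<^sub>m w x)"
  define y where "y = (\<lambda>x. mat_adjoint (u x) * b x * u x)"
  have u: "u \<in> matC X n" unfolding u_def by (intro matC_scale w) auto
  have y: "y \<in> matC X n" unfolding y_def by (intro matC_mult matC_adjoint u bc)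
  have bh: "mat_adjoint (b x) = b x" and ah: "mat_adjoint (a x) = a x" if "x \<in> X" for x
    using a b that unfolding matC_positive_def by auto
  have yh: "mat_adjoint (y x) = y x" if "x \<in> X" for x
    unfolding y_def by (rule adjoint_congruence[OF matC_D(1)[OF bc that] bh[OF that] matC_D(1)[OF u that]])
  have "\<exists>U D. \<forall>x\<in>X. diagonalizes n (U x) (D x) (a x)"
    using hermitian_diagonalizable[OF matC_D(1)[OF ac] ah] by metis
  then obtain U D where UD: "\<And>x. x \<in> X \<Longrightarrow> diagonalizes n (U x) (D x) (a x)" by blast
  have "\<exists>V E. \<forall>x\<in>X. diagonalizes n (V x) (E x) (y x)"
    using hermitian_diagonalizable[OF matC_D(1)[OF y] yh] by metis
  then obtain V E where VE: "\<And>x. x \<in> X \<Longrightarrow> diagonalizes n (V x) (E x) (y x)" by blast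
  have D0: "D x i \<ge> 0" if "x \<in> X" "i < n" for x i
    using matC_positive_eigenvalues[OF a that(1) UD[OF that(1)] that(2)] .
  have qy: "qform (y x) \<xi> = C * qform (b x) (w x *\<^sub>v \<xi>)" if x: "x \<in> X" and xi: "\<xi> \<in> carrier_vec n" for x \<xi>
  proof -
    have wx: "w x \<in> carrier_mat n n" and bx: "b x \<in> carrier_mat n n" using matC_D(1)[OF w x] matC_D(1)[OF bc x] by auto
    have "u x *\<^sub>v \<xi> = complex_of_real (sqrt C) \<cdot>\<^sub>v (w x *\<^sub>v \<xi>)"
      unfolding u_def using wx xi by (intro eq_vecI) (auto simp: scalar_prod_def sum_distrib_left mult.assoc)
    moreover have "b x *\<^sub>v (complex_of_real (sqrt C) \<cdot>\<^sub>v (w x *\<^sub>v \<xi>)) = complex_of_real (sqrt C) \<cdot>\<^sub>v (b x *\<^sub>v (w x *\<^sub>v \<xi>))"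
      using wx bx xi by (intro mult_mat_vec) auto
    moreover have "conjugate (complex_of_real (sqrt C) \<cdot>\<^sub>v (w x *\<^sub>v \<xi>)) = complex_of_real (sqrt C) \<cdot>\<^sub>v conjugate (w x *\<^sub>v \<xi>)"
      by (simp add: conjugate_smult_vec)
    ultimately have "qform (y x) \<xi> = Re (complex_of_real (sqrt C) * (complex_of_real (sqrt C) * ((b x *\<^sub>v (w x *\<^sub>v \<xi>)) \<bullet>c (w x *\<^sub>v \<xi>))))"
      unfolding y_def using qform_congruence[OF bx matC_D(1)[OF u x] xi] wx bx xi
      unfolding qform_def by (simp add: scalar_prod_smult_distrib[of _ n] smult_scalar_prod_distrib[of _ n] del: index_mult_mat_vec)
    also have "\<dots> = Re (complex_of_real (sqrt C * sqrt C) * ((b x *\<^sub>v (w x *\<^sub>v \<xi>)) \<bullet>c (w x *\<^sub>v \<xi>)))"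
      by (simp only: mult.assoc of_real_mult)
    also have "\<dots> = C * qform (b x) (w x *\<^sub>v \<xi>)" unfolding qform_def using C by simp
    finally show ?thesis .
  qed
  have qb: "qform (b x) \<xi> \<ge> 0" if x: "x \<in> X" and xi: "\<xi> \<in> carrier_vec n" for x \<xi>
  proof -
    obtain V F where VF: "diagonalizes n V F (b x)"
      using hermitian_diagonalizable[OF matC_D(1)[OF bc x] bh[OF x]] by blast
    have V: "unitary_mat n V" and bx: "b x = spectral_mat n V F" using VF unfolding diagonalizes_spectral_mat by auto
    have "F i \<ge> 0" if "i < n" for i using matC_positive_eigenvalues[OF b x VF that] .
    thus ?thesis unfolding bx qform_spectral_mat[OF V xi] by (intro sum_nonneg) auto
  qed
  have E0: "E x i \<ge> 0" if x: "x \<in> X" and i: "i < n" for x i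
  proof -
    have Vx: "unitary_mat n (V x)" using VE[OF x] unfolding diagonalizes_def by auto
    have v: "V x *\<^sub>v unit_vec n i \<in> carrier_vec n"
      using mult_mat_vec_carrier[OF unitary_carrier[OF Vx]] by simp
    have "w x *\<^sub>v (V x *\<^sub>v unit_vec n i) \<in> carrier_vec n" using matC_D(1)[OF w x] v by (rule mult_mat_vec_carrier)
    from qb[OF x this] C show ?thesis
      unfolding qform_eigenvalue[OF VE[OF x] i, symmetric] qy[OF x v] by (rule mult_nonneg_nonneg[rotated])
  qed
  define F where "F = (\<lambda>x. spectral_mat n (U x) (\<lambda>i. sqrt (D x i)))"
  define G where "G = (\<lambda>x. spectral_mat n (V x) (\<lambda>i. inverse (sqrt (max 0 (E x i) + e))))"
  have F: "F \<in> matC X n" unfolding F_def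
    by (rule functional_calculus_continuous[OF X ac _ UD]) (auto intro!: continuous_intros)
  have G: "G \<in> matC X n" unfolding G_def
  proof (rule functional_calculus_continuous[OF X y _ VE])
    have "sqrt (max 0 t + e) \<noteq> 0" for t using e by (auto simp: max_def)
    thus "continuous_on UNIV (\<lambda>t. inverse (sqrt (max 0 t + e)))" by (intro continuous_intros) auto
  qed
  have Gh: "mat_adjoint (G x) = G x" and Fh: "mat_adjoint (F x) = F x" if "x \<in> X" for x
    using UD[OF that] VE[OF that] unfolding G_def F_def diagonalizes_def by auto
  define v where "v = (\<lambda>x. F x * G x * mat_adjoint (u x))"
  have v: "v \<in> matC X n" unfolding v_def by (intro matC_mult matC_adjoint F G u)
  moreover have "cvec_norm ((v x * b x * mat_adjoint (v x) - a x) *\<^sub>v \<xi>) \<le> e * cvec_norm \<xi>"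
    if x: "x \<in> X" and xi: "\<xi> \<in> carrier_vec n" for x \<xi>
  proof -
    have c: "F x \<in> carrier_mat n n" "G x \<in> carrier_mat n n" "u x \<in> carrier_mat n n" "b x \<in> carrier_mat n n"
      using matC_D(1)[OF F x] matC_D(1)[OF G x] matC_D(1)[OF u x] matC_D(1)[OF bc x] by auto
    have "mat_adjoint (v x) = u x * (G x * F x)"
      unfolding v_def using c Fh[OF x] Gh[OF x] mult_carrier_mat[OF c(1,2)]
      by (simp add: adjoint_mult[of _ n n _ n])
    hence "v x * b x * mat_adjoint (v x) = F x * G x * y x * (G x * F x)"
      unfolding v_def y_def using c by (simp add: assoc_mult_mat[of _ n n _ n _ n] mult_carrier_mat[of _ n n _ n])
    moreover have "G x = spectral_mat n (V x) (\<lambda>i. inverse (sqrt (E x i + e)))"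
      unfolding G_def by (rule spectral_mat_cong) (use E0[OF x] in auto)
    moreover have "qform (a x) \<xi> \<le> e * (cvec_norm \<xi>)\<^sup>2 + qform (y x) \<xi>" if "\<xi> \<in> carrier_vec n" for \<xi>
      using wd[OF x that] qy[OF x that] by simp
    ultimately show ?thesis
      using form_domination_contraction[OF UD[OF x] D0[OF x] VE[OF x] E0[OF x] e _ _ _ xi] F_def by simp
  qed
  ultimately show "\<exists>v\<in>matC X n. \<forall>x\<in>X. \<forall>\<xi>\<in>carrier_vec n.
      cvec_norm ((v x * b x * mat_adjoint (v x) - a x) *\<^sub>v \<xi>) \<le> e * cvec_norm \<xi>" by blast
qed

section \<open>Rank, large eigenvalues and eigenvector overlaps\<close>

text \<open>More unknowns than equations: Gaussian elimination of one unknown against one equation at a time.\<close>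

lemma homogeneous_system:
  fixes m :: "'j \<Rightarrow> 'i \<Rightarrow> 'a::field"
  assumes "finite J" "finite I" "card J < card I"
  shows "\<exists>c. (\<exists>i\<in>I. c i \<noteq> 0) \<and> (\<forall>j\<in>J. (\<Sum>i\<in>I. m j i * c i) = 0)"
  using assms
proof (induction J arbitrary: I m rule: finite_induct)
  case empty
  then obtain i where "i \<in> I" by fastforce
  thus ?case by (intro exI[of _ "\<lambda>_. 1"]) auto
next
  case (insert j J)
  show ?case
  proof (cases "\<forall>i\<in>I. m j i = 0")
    case True
    have "card J < card I" using insert by simp
    from insert.IH[OF insert.prems(1) this] obtain c where
      "\<exists>i\<in>I. c i \<noteq> 0" "\<forall>k\<in>J. (\<Sum>i\<in>I. m k i * c i) = 0" by blast
    thus ?thesis using True by (intro exI[of _ c]) auto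
  next
    case False
    then obtain p where p: "p \<in> I" "m j p \<noteq> 0" by blast
    define I' where "I' = I - {p}"
    have fin: "finite I'" and cI: "card J < card I'"
      using insert p unfolding I'_def by (auto simp: card_Diff_singleton)
    define m' where "m' = (\<lambda>k i. m k i - m k p * m j i / m j p)"
    from insert.IH[OF fin cI, of m'] obtain c where
      c: "\<exists>i\<in>I'. c i \<noteq> 0" "\<forall>k\<in>J. (\<Sum>i\<in>I'. m' k i * c i) = 0" by blast
    define S where "S = (\<Sum>i\<in>I'. m j i * c i)"
    define d where "d = c(p := - S / m j p)"
    have split: "(\<Sum>i\<in>I. m k i * d i) = m k p * d p + (\<Sum>i\<in>I'. m k i * c i)" for k
    proof -
      have "(\<Sum>i\<in>I. m k i * d i) = m k p * d p + (\<Sum>i\<in>I'. m k i * d i)"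
        unfolding I'_def using insert.prems(1) p(1) by (rule sum.remove)
      also have "(\<Sum>i\<in>I'. m k i * d i) = (\<Sum>i\<in>I'. m k i * c i)"
        unfolding d_def I'_def by (intro sum.cong) auto
      finally show ?thesis .
    qed
    have "(\<Sum>i\<in>I. m k i * d i) = 0" if k: "k \<in> insert j J" for k
    proof (cases "k = j")
      case True
      thus ?thesis unfolding split True S_def[symmetric] using p by (simp add: d_def)
    next
      case False
      hence "(\<Sum>i\<in>I'. m' k i * c i) = 0" using c k by auto
      also have "(\<Sum>i\<in>I'. m' k i * c i) = (\<Sum>i\<in>I'. m k i * c i) - m k p / m j p * S"
        unfolding m'_def S_def sum_distrib_left by (simp add: sum_subtractf[symmetric] algebra_simps)
      finally show ?thesis unfolding split by (simp add: d_def)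
    qed
    moreover have "\<exists>i\<in>I. d i \<noteq> 0" using c(1) unfolding d_def I'_def by auto
    ultimately show ?thesis by blast
  qed
qed

text \<open>A maximal independent set of columns, given by the set \<open>J\<close> of their indices. This is the only form
  in which the rank enters the eigenvalue counts below: as a number of equations that force a vector
  into the kernel, and as a number of independent vectors in the range.\<close>

lemma rank_column_basis:
  fixes M :: "complex mat"
  assumes M: "M \<in> carrier_mat n nc"
  obtains J \<beta> where "J \<subseteq> {..<nc}" "card J = vec_space.rank n M"
    "\<forall>c. (\<forall>i<n. (\<Sum>k\<in>J. c k * M $$ (i, k)) = 0) \<longrightarrow> (\<forall>k\<in>J. c k = 0)"
    "\<forall>i<n. \<forall>j<nc. M $$ (i, j) = (\<Sum>k\<in>J. \<beta> j k * M $$ (i, k))"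
proof -
  interpret vec_space "TYPE(complex)" n .
  have cM: "set (cols M) \<subseteq> carrier_vec n" using cols_dim[of M] M by auto
  have li0: "lin_indpt {}" by (simp add: lin_dep_def)
  obtain I where I: "maximal I (\<lambda>T. T \<subseteq> set (cols M) \<and> lin_indpt T)"
    using maximal_exists_superset[of "set (cols M)" "\<lambda>T. T \<subseteq> set (cols M) \<and> lin_indpt T" "{}"] li0 by auto
  hence IM: "I \<subseteq> set (cols M)" and li: "lin_indpt I" unfolding maximal_def by auto
  have fin: "finite I" using IM finite_subset by blast
  have Ic: "I \<subseteq> carrier_vec n" using IM cM by auto
  have "\<forall>v\<in>I. \<exists>j<nc. v = col M j" using IM M by (force simp: cols_def)
  then obtain f where f: "\<And>v. v \<in> I \<Longrightarrow> f v < nc" "\<And>v. v \<in> I \<Longrightarrow> col M (f v) = v" by metis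
  have inj: "inj_on f I" using f(2) by (metis inj_onI)
  define J where "J = f ` I"
  have J: "J \<subseteq> {..<nc}" using f unfolding J_def by auto
  have cJ: "card J = rank M" using rank_card_indpt[OF M I] card_image[OF inj] unfolding J_def by simp
  have sumJ: "(\<Sum>v\<in>I. a v * v $ i) = (\<Sum>k\<in>J. a (col M k) * M $$ (i, k))" if "i < n" for a i
    unfolding J_def sum.reindex[OF inj] using f M that by (auto intro!: sum.cong) (metis carrier_matD(1) carrier_matD(2) index_col)
  have indep: "\<forall>k\<in>J. c k = 0" if c: "\<And>i. i < n \<Longrightarrow> (\<Sum>k\<in>J. c k * M $$ (i, k)) = 0" for c
  proof (rule ccontr)
    assume "\<not> ?thesis"
    then obtain v where v: "v \<in> I" "c (f v) \<noteq> 0" unfolding J_def by auto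
    have "lincomb (\<lambda>v. c (f v)) I = 0\<^sub>v n"
    proof (rule eq_vecI)
      fix i assume "i < dim_vec (0\<^sub>v n :: complex vec)"
      hence i: "i < n" by simp
      have "lincomb (\<lambda>v. c (f v)) I $ i = (\<Sum>v\<in>I. c (f v) * v $ i)" by (rule lincomb_index[OF i Ic])
      also have "\<dots> = (\<Sum>k\<in>J. c k * M $$ (i, k))"
        unfolding J_def sum.reindex[OF inj] using f M i by (auto intro!: sum.cong) (metis carrier_matD(1) carrier_matD(2) index_col)
      finally show "lincomb (\<lambda>v. c (f v)) I $ i = 0\<^sub>v n $ i" using c[OF i] i by simp
    qed (use lincomb_dim[OF fin Ic] in auto)
    hence "lin_dep I" using v fin by (intro lin_dep_crit[where A = I and S = I and a = "\<lambda>v. c (f v)" and v = v]) auto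
    thus False using li by blast
  qed
  have "\<exists>\<beta>. \<forall>i<n. M $$ (i, j) = (\<Sum>k\<in>J. \<beta> k * M $$ (i, k))" if j: "j < nc" for j
  proof -
    let ?v = "col M j"
    have vM: "?v \<in> set (cols M)" using j M by (auto simp: cols_def)
    have v: "?v \<in> carrier_vec n" using vM cM by auto
    have "?v \<in> span I"
    proof (cases "?v \<in> I")
      case True
      thus ?thesis using span_mem[OF Ic] by auto
    next
      case False
      have "lin_dep (I \<union> {?v})"
      proof (rule ccontr)
        assume "\<not> ?thesis"
        hence "I \<union> {?v} = I" using I IM vM unfolding maximal_def by auto
        thus False using False by auto
      qed
      thus ?thesis using lin_dep_iff_in_span[of I ?v] Ic li v False by auto
    qed
    then obtain a where a: "lincomb a I = ?v" using finite_in_span[OF fin] Ic by auto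
    have "M $$ (i, j) = (\<Sum>k\<in>J. a (col M k) * M $$ (i, k))" if i: "i < n" for i
      using lincomb_index[OF i Ic, of a] sumJ[OF i, of a] a M i j by simp
    thus ?thesis by (intro exI[of _ "\<lambda>k. a (col M k)"]) auto
  qed
  then obtain \<beta> where "\<And>i j. i < n \<Longrightarrow> j < nc \<Longrightarrow> M $$ (i, j) = (\<Sum>k\<in>J. \<beta> j k * M $$ (i, k))" by metis
  with indep show ?thesis by (intro that[OF J cJ]) auto
qed

text \<open>If \<open>A\<close> had more eigenvalues \<open>\<ge> t\<close> than the rank of \<open>M\<close>, then by counting equations the span of
  their eigenvectors would contain a nonzero vector of the kernel of \<open>M\<close>, where the form of \<open>A\<close> is
  supposed to be smaller than \<open>t\<close>.\<close>

lemma few_large_eigenvalues: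
  assumes M: "M \<in> carrier_mat n n" and A: "diagonalizes n U D A"
    and small: "\<And>v. v \<in> carrier_vec n \<Longrightarrow> v \<noteq> 0\<^sub>v n \<Longrightarrow> M *\<^sub>v v = 0\<^sub>v n \<Longrightarrow> qform A v < t * (cvec_norm v)\<^sup>2"
  shows "card {i. i < n \<and> D i \<ge> t} \<le> vec_space.rank n M"
proof (rule ccontr)
  assume big: "\<not> ?thesis"
  let ?S = "{i. i < n \<and> D i \<ge> t}"
  have U: "unitary_mat n U" and Aeq: "A = spectral_mat n U D" using A unfolding diagonalizes_spectral_mat by auto
  have Uc: "U \<in> carrier_mat n n" using U by simp
  obtain J \<beta> where J: "J \<subseteq> {..<n}" "card J = vec_space.rank n M"
    and "\<forall>c. (\<forall>i<n. (\<Sum>k\<in>J. c k * M $$ (i, k)) = 0) \<longrightarrow> (\<forall>k\<in>J. c k = 0)"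
    and \<beta>0: "\<forall>i<n. \<forall>j<n. M $$ (i, j) = (\<Sum>k\<in>J. \<beta> j k * M $$ (i, k))"
    by (rule rank_column_basis[OF M])
  from \<beta>0 have \<beta>: "\<And>i j. i < n \<Longrightarrow> j < n \<Longrightarrow> M $$ (i, j) = (\<Sum>k\<in>J. \<beta> j k * M $$ (i, k))" by blast
  have fJ: "finite J" using J(1) finite_subset by blast
  have "card J < card ?S" using big J by simp
  hence "\<exists>c. (\<exists>i\<in>?S. c i \<noteq> 0) \<and> (\<forall>k\<in>J. (\<Sum>i\<in>?S. (\<Sum>j<n. \<beta> j k * U $$ (j, i)) * c i) = 0)"
    by (intro homogeneous_system fJ) simp
  then obtain c where c: "\<exists>i\<in>?S. c i \<noteq> 0"
    "\<And>k. k \<in> J \<Longrightarrow> (\<Sum>i\<in>?S. (\<Sum>j<n. \<beta> j k * U $$ (j, i)) * c i) = 0" by blast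
  define w where "w = vec n (\<lambda>i. if i \<in> ?S then c i else 0)"
  have w: "w \<in> carrier_vec n" unfolding w_def by simp
  have w0: "w \<noteq> 0\<^sub>v n"
  proof
    assume 0: "w = 0\<^sub>v n"
    obtain i where i: "i \<in> ?S" "c i \<noteq> 0" using c(1) by blast
    hence "w $ i = c i" unfolding w_def by simp
    thus False using 0 i by simp
  qed
  let ?v = "U *\<^sub>v w"
  have v: "?v \<in> carrier_vec n" using Uc w by auto
  have Uv: "mat_adjoint U *\<^sub>v ?v = w" using unitary_cancel[OF U w] by simp
  have v0: "?v \<noteq> 0\<^sub>v n"
  proof
    assume "?v = 0\<^sub>v n"
    hence "cvec_norm w = 0" using unitary_norm[OF U w] by simp
    thus False using w w0 cvec_norm_eq_0 by blast
  qed
  have vj: "?v $ j = (\<Sum>i\<in>?S. U $$ (j, i) * c i)" if "j < n" for j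
  proof -
    have "?v $ j = (\<Sum>i<n. U $$ (j, i) * (if i \<in> ?S then c i else 0))"
      using Uc that unfolding w_def by (auto simp: scalar_prod_def atLeast0LessThan)
    also have "\<dots> = (\<Sum>i\<in>?S. U $$ (j, i) * (if i \<in> ?S then c i else 0))"
      by (rule sum.mono_neutral_right) auto
    finally show ?thesis by simp
  qed
  have "M *\<^sub>v ?v = 0\<^sub>v n"
  proof (rule eq_vecI)
    fix i assume "i < dim_vec (0\<^sub>v n :: complex vec)"
    hence i: "i < n" by simp
    have "(M *\<^sub>v ?v) $ i = (\<Sum>j<n. M $$ (i, j) * ?v $ j)"
      by (rule mat_vec_index[OF M v i])
    also have "\<dots> = (\<Sum>j<n. (\<Sum>k\<in>J. \<beta> j k * M $$ (i, k)) * (\<Sum>l\<in>?S. U $$ (j, l) * c l))"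
      using \<beta>[OF i] vj by (intro sum.cong) auto
    also have "\<dots> = (\<Sum>j<n. \<Sum>k\<in>J. \<Sum>l\<in>?S. M $$ (i, k) * (\<beta> j k * U $$ (j, l) * c l))"
      by (simp add: sum_product mult_ac)
    also have "\<dots> = (\<Sum>k\<in>J. \<Sum>j<n. \<Sum>l\<in>?S. M $$ (i, k) * (\<beta> j k * U $$ (j, l) * c l))"
      by (rule sum.swap)
    also have "\<dots> = (\<Sum>k\<in>J. \<Sum>l\<in>?S. \<Sum>j<n. M $$ (i, k) * (\<beta> j k * U $$ (j, l) * c l))"
      by (intro sum.cong refl sum.swap)
    also have "\<dots> = (\<Sum>k\<in>J. M $$ (i, k) * (\<Sum>l\<in>?S. (\<Sum>j<n. \<beta> j k * U $$ (j, l)) * c l))"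
      by (simp add: sum_distrib_left sum_distrib_right)
    also have "\<dots> = 0" using c(2) by simp
    finally show "(M *\<^sub>v ?v) $ i = 0\<^sub>v n $ i" using i by simp
  qed (use M in auto)
  from small[OF v v0 this] have "qform A ?v < t * (cvec_norm ?v)\<^sup>2" .
  also have "t * (cvec_norm ?v)\<^sup>2 = (\<Sum>i<n. t * (cmod (w $ i))\<^sup>2)"
    unfolding norm_sq_coordinates[OF U v] Uv by (simp add: sum_distrib_left)
  also have "\<dots> \<le> (\<Sum>i<n. D i * (cmod (w $ i))\<^sup>2)"
    by (intro sum_mono) (auto simp: w_def intro: mult_right_mono)
  also have "\<dots> = qform A ?v" unfolding Aeq qform_spectral_mat[OF U v] Uv ..
  finally show False by simp
qed

text \<open>If \<open>B\<close> had fewer eigenvalues \<open>\<ge> t\<close> than the rank of \<open>M\<close>, then the range of \<open>M\<close> would contain a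
  nonzero vector orthogonal to all their eigenvectors, and the form of \<open>B\<close> would be at most \<open>t\<close>
  there.\<close>

lemma many_large_eigenvalues:
  assumes M: "M \<in> carrier_mat n n" and B: "diagonalizes n V E B"
    and large: "\<And>u. u \<in> carrier_vec n \<Longrightarrow> M *\<^sub>v u \<noteq> 0\<^sub>v n \<Longrightarrow> qform B (M *\<^sub>v u) > t * (cvec_norm (M *\<^sub>v u))\<^sup>2"
  shows "vec_space.rank n M \<le> card {i. i < n \<and> E i \<ge> t}"
proof (rule ccontr)
  assume big: "\<not> ?thesis"
  let ?S = "{i. i < n \<and> E i \<ge> t}"
  have V: "unitary_mat n V" and Beq: "B = spectral_mat n V E" using B unfolding diagonalizes_spectral_mat by auto
  have Vc: "V \<in> carrier_mat n n" using V by simp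
  obtain J \<beta> where J: "J \<subseteq> {..<n}" "card J = vec_space.rank n M"
    and indep: "\<forall>c. (\<forall>i<n. (\<Sum>k\<in>J. c k * M $$ (i, k)) = 0) \<longrightarrow> (\<forall>k\<in>J. c k = 0)"
    and "\<forall>i<n. \<forall>j<n. M $$ (i, j) = (\<Sum>k\<in>J. \<beta> j k * M $$ (i, k))"
    by (rule rank_column_basis[OF M])
  have fJ: "finite J" using J(1) finite_subset by blast
  obtain c where c: "\<exists>k\<in>J. c k \<noteq> 0" "\<And>i. i \<in> ?S \<Longrightarrow> (\<Sum>k\<in>J. (mat_adjoint V * M) $$ (i, k) * c k) = 0"
    using homogeneous_system[of ?S J "\<lambda>i k. (mat_adjoint V * M) $$ (i, k)"] fJ big J by auto
  define u where "u = vec n (\<lambda>k. if k \<in> J then c k else 0)"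
  have u: "u \<in> carrier_vec n" unfolding u_def by simp
  have Nu: "(N *\<^sub>v u) $ i = (\<Sum>k\<in>J. N $$ (i, k) * c k)" if "N \<in> carrier_mat n n" "i < n" for N i
  proof -
    have "(N *\<^sub>v u) $ i = (\<Sum>k<n. N $$ (i, k) * (if k \<in> J then c k else 0))"
      using that unfolding u_def by (auto simp: scalar_prod_def atLeast0LessThan)
    also have "\<dots> = (\<Sum>k\<in>J. N $$ (i, k) * (if k \<in> J then c k else 0))"
      using J(1) by (intro sum.mono_neutral_right) auto
    finally show ?thesis by simp
  qed
  let ?w = "M *\<^sub>v u"
  have w: "?w \<in> carrier_vec n" using M u by auto
  have "?w \<noteq> 0\<^sub>v n"
  proof
    assume 0: "?w = 0\<^sub>v n"
    have "(\<Sum>k\<in>J. c k * M $$ (i, k)) = 0" if i: "i < n" for i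
      using Nu[OF M i] 0 i by (simp add: mult.commute)
    thus False using indep c(1) by blast
  qed
  from large[OF u this] have "t * (cvec_norm ?w)\<^sup>2 < qform B ?w" .
  also have "qform B ?w = (\<Sum>i<n. E i * (cmod ((mat_adjoint V *\<^sub>v ?w) $ i))\<^sup>2)"
    unfolding Beq by (rule qform_spectral_mat[OF V w])
  also have "\<dots> \<le> (\<Sum>i<n. t * (cmod ((mat_adjoint V *\<^sub>v ?w) $ i))\<^sup>2)"
  proof (rule sum_mono)
    fix i assume i: "i \<in> {..<n}"
    show "E i * (cmod ((mat_adjoint V *\<^sub>v ?w) $ i))\<^sup>2 \<le> t * (cmod ((mat_adjoint V *\<^sub>v ?w) $ i))\<^sup>2"
    proof (cases "i \<in> ?S")
      case True
      have "mat_adjoint V *\<^sub>v ?w = (mat_adjoint V * M) *\<^sub>v u"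
        using Vc M u by (simp add: assoc_mult_mat_vec[of _ n n _ n])
      hence "(mat_adjoint V *\<^sub>v ?w) $ i = 0"
        using Nu[of "mat_adjoint V * M" i] c(2)[OF True] mult_carrier_mat[of "mat_adjoint V" n n M n] Vc M i by auto
      thus ?thesis by (simp del: index_mult_mat_vec)
    next
      case False
      thus ?thesis using i by (intro mult_right_mono) auto
    qed
  qed
  also have "\<dots> = t * (cvec_norm ?w)\<^sup>2"
    unfolding norm_sq_coordinates[OF V w] by (simp add: sum_distrib_left)
  finally show False by simp
qed

text \<open>Evaluate \<open>A - B\<close> between an eigenvector of \<open>A\<close> and one of \<open>B\<close>: the result is the difference of the
  two eigenvalues times the overlap of the two vectors. This is an entrywise version of the
  \<open>sin \<theta>\<close> theorem: eigenvectors of nearby matrices whose eigenvalues are well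
  separated are almost orthogonal.\<close>

lemma eigenvector_overlap:
  assumes A: "diagonalizes n U D A" and B: "diagonalizes n V E B"
    and close: "\<And>v. v \<in> carrier_vec n \<Longrightarrow> cvec_norm ((A - B) *\<^sub>v v) \<le> e * cvec_norm v"
    and ij: "i < n" "j < n"
  shows "\<bar>D j - E i\<bar> * cmod ((mat_adjoint V * U) $$ (i, j)) \<le> e"
proof -
  have U: "unitary_mat n U" and Aeq: "A = spectral_mat n U D" using A unfolding diagonalizes_spectral_mat by auto
  have V: "unitary_mat n V" and Beq: "B = spectral_mat n V E" using B unfolding diagonalizes_spectral_mat by auto
  let ?u = "U *\<^sub>v unit_vec n j" and ?v = "V *\<^sub>v unit_vec n i"
  have c: "U \<in> carrier_mat n n" "V \<in> carrier_mat n n" "A \<in> carrier_mat n n" "B \<in> carrier_mat n n"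
    using U V Aeq Beq by auto
  have u: "?u \<in> carrier_vec n" and v: "?v \<in> carrier_vec n"
    using mult_mat_vec_carrier[OF c(1)] mult_mat_vec_carrier[OF c(2)] by auto
  have nu: "cvec_norm ?u = 1" "cvec_norm ?v = 1" using unitary_norm[OF U] unitary_norm[OF V] cvec_norm_unit ij by auto
  have uv: "?u \<bullet>c ?v = (mat_adjoint V * U) $$ (i, j)"
  proof -
    have "?u \<bullet>c ?v = (\<Sum>k<n. U $$ (k, j) * cnj (V $$ (k, i)))"
      using c ij by (auto simp: scalar_prod_def[of "U *\<^sub>v unit_vec n j"] atLeast0LessThan)
    thus ?thesis using c ij by (auto simp: scalar_prod_def atLeast0LessThan mult.commute)
  qed
  have "(A *\<^sub>v ?u) \<bullet>c ?v = complex_of_real (D j) * (?u \<bullet>c ?v)"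
    unfolding eigenvector_of_diagonalized[OF A ij(2)] using u v by (subst smult_scalar_prod_distrib[of _ n]) auto
  moreover have "(B *\<^sub>v ?u) \<bullet>c ?v = complex_of_real (E i) * (?u \<bullet>c ?v)"
  proof -
    have "mat_adjoint B = B" unfolding Beq using V by simp
    hence "(B *\<^sub>v ?u) \<bullet>c ?v = ?u \<bullet>c (complex_of_real (E i) \<cdot>\<^sub>v ?v)"
      using cscalar_adjoint[OF c(4) u v] eigenvector_of_diagonalized[OF B ij(1)] by simp
    thus ?thesis using u v by (simp add: conjugate_smult_vec scalar_prod_smult_distrib[of _ n] del: index_mult_mat_vec)
  qed
  moreover have "((A - B) *\<^sub>v ?u) \<bullet>c ?v = (A *\<^sub>v ?u) \<bullet>c ?v - (B *\<^sub>v ?u) \<bullet>c ?v"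
    using c u v by (simp add: minus_mult_distrib_mat_vec[of _ n n] minus_scalar_prod_distrib[of _ n] del: index_mult_mat_vec)
  ultimately have "((A - B) *\<^sub>v ?u) \<bullet>c ?v = complex_of_real (D j - E i) * (mat_adjoint V * U) $$ (i, j)"
    unfolding uv by (simp add: algebra_simps)
  moreover have "cmod (((A - B) *\<^sub>v ?u) \<bullet>c ?v) \<le> cvec_norm ((A - B) *\<^sub>v ?u) * cvec_norm ?v"
    using mult_mat_vec_carrier[OF minus_carrier_mat[OF c(4)] u, of A] v by (rule cscalar_CS)
  ultimately show ?thesis using close[OF u] nu by (simp add: norm_mult del: of_real_diff)
qed

section \<open>Lattice points near a subspace\<close>

text \<open>Codes for the \<open>n \<times> n\<close> matrices whose entries are Gaussian integers with real and imaginary parts in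
  \<open>{0..<N}\<close>; the Boolean selects the imaginary part. Extensional functions make the set finite.\<close>

definition grid :: "nat \<Rightarrow> nat \<Rightarrow> (nat \<times> nat \<times> bool \<Rightarrow> nat) set" where
  "grid n N = ({..<n} \<times> {..<n} \<times> UNIV) \<rightarrow>\<^sub>E {..<N}"

definition grid_entry :: "(nat \<times> nat \<times> bool \<Rightarrow> nat) \<Rightarrow> nat \<Rightarrow> nat \<Rightarrow> complex" where
  "grid_entry g i j = Complex (real (g (i, j, False))) (real (g (i, j, True)))"

definition grid_mat :: "nat \<Rightarrow> nat \<Rightarrow> (nat \<times> nat \<times> bool \<Rightarrow> nat) \<Rightarrow> complex mat" where
  "grid_mat n N g = mat n n (\<lambda>(i, j). grid_entry g i j / of_nat N)"

lemma grid_mat_carrier [simp]: "grid_mat n N g \<in> carrier_mat n n"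
  unfolding grid_mat_def by simp

lemma finite_grid: "finite (grid n N)"
  unfolding grid_def by (intro finite_PiE) auto

lemma card_grid: "card (grid n N) = N ^ (2 * n * n)"
  unfolding grid_def by (simp add: card_PiE card_cartesian_product mult_ac)

lemma grid_less: "g \<in> grid n N \<Longrightarrow> i < n \<Longrightarrow> j < n \<Longrightarrow> g (i, j, b) < N"
  unfolding grid_def PiE_def Pi_def by auto

lemma grid_entry_norm:
  assumes "g \<in> grid n N" "i < n" "j < n"
  shows "cmod (grid_entry g i j) \<le> 2 * N"
proof -
  have "cmod (grid_entry g i j) \<le> real (g (i, j, False)) + real (g (i, j, True))"
    unfolding grid_entry_def using cmod_le[of "Complex (real (g (i, j, False))) (real (g (i, j, True)))"] by simp
  thus ?thesis using grid_less[OF assms, of False] grid_less[OF assms, of True] by linarith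
qed

lemma grid_mat_norm:
  assumes "g \<in> grid n N" "i < n" "j < n"
  shows "cmod (grid_mat n N g $$ (i, j)) \<le> 2"
  using grid_entry_norm[OF assms] assms unfolding grid_mat_def
  by (cases "N = 0") (auto simp: norm_divide field_simps)

lemma card_sym_int_square: "card ({- int B..int B} \<times> {- int B..int B}) = (2 * B + 1)\<^sup>2"
  by (simp add: card_cartesian_product power2_eq_square nat_add_distrib nat_mult_distrib)

lemma floor_eq_imp_close:
  fixes h x y :: real
  assumes "\<lfloor>h * x\<rfloor> = \<lfloor>h * y\<rfloor>" "h > 0"
  shows "\<bar>x - y\<bar> < 1 / h"
proof -
  have "\<bar>h * x - h * y\<bar> < 1" using assms(1) by linarith
  hence "h * \<bar>x - y\<bar> < 1" using assms(2) by (simp add: right_diff_distrib[symmetric] abs_mult)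
  thus ?thesis using assms(2) by (simp add: field_simps)
qed

lemma nat_eq_if_close: "\<bar>real a - real b\<bar> < 1 \<Longrightarrow> a = b"
  by linarith

text \<open>Fix a vector \<open>\<xi>\<close> with a coordinate \<open>\<xi> $ l\<close> that is not small, and count the grid matrices \<open>g\<close> for
  which \<open>g \<xi>\<close> nearly vanishes in the coordinates \<open>S'\<close> of the basis \<open>V\<close>. All columns except column \<open>l\<close>
  are free, which accounts for \<open>2n(n - 1)\<close> real parameters. Column \<open>l\<close> is determined in the
  coordinates \<open>S'\<close> up to a small error; once its other coordinates are known up to a small error too,
  at most one Gaussian integer vector fits, because \<open>V\<close> preserves the norm and distinct integer
  vectors have distance at least one. So \<open>g \<mapsto>\<close> (other columns, rounded coordinates outside \<open>S'\<close>) is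
  injective.\<close>

lemma card_grid_near_subspace:
  fixes n N H :: nat and K :: real and \<xi> :: "complex vec"
  assumes V: "unitary_mat n V" and S': "S' \<subseteq> {..<n}" and xi: "\<xi> \<in> carrier_vec n"
    and l: "l < n" "cmod (\<xi> $ l) \<ge> 1 / n" and N: "N > 0" and H: "H > 0" "4 * n * (n + 1) * K \<le> H"
  shows "card {g \<in> grid n N. \<forall>j\<in>S'. cmod ((mat_adjoint V *\<^sub>v (grid_mat n N g *\<^sub>v \<xi>)) $ j) \<le> K / (H * N)}
    \<le> N ^ (2 * n * (n - 1)) * (16 * n * (n + 1) * N + 1) ^ (2 * (n - card S'))"
proof -
  let ?G = "{g \<in> grid n N. \<forall>j\<in>S'. cmod ((mat_adjoint V *\<^sub>v (grid_mat n N g *\<^sub>v \<xi>)) $ j) \<le> K / (H * N)}"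
  define h where "h = 4 * real (n + 1)"
  define B where "B = 8 * n * (n + 1) * N"
  have h: "h > 0" unfolding h_def by simp
  have Vc: "V \<in> carrier_mat n n" using V by simp
  define z where "z = (\<lambda>g j. \<Sum>k<n. cnj (V $$ (k, j)) * grid_entry g k l)"
  define \<phi> where "\<phi> = (\<lambda>g. (restrict g ({..<n} \<times> ({..<n} - {l}) \<times> (UNIV :: bool set)),
     restrict (\<lambda>j. (\<lfloor>h * Re (z g j)\<rfloor>, \<lfloor>h * Im (z g j)\<rfloor>)) ({..<n} - S')))"
  let ?P = "({..<n} \<times> ({..<n} - {l}) \<times> (UNIV :: bool set)) \<rightarrow>\<^sub>E {..<N}"
  let ?Q = "({..<n} - S') \<rightarrow>\<^sub>E ({- int B..int B} \<times> {- int B..int B})"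
  have zb: "cmod (z g j) \<le> 2 * n * N" if g: "g \<in> grid n N" and j: "j < n" for g j
  proof -
    have "cmod (z g j) \<le> (\<Sum>k<n. 1 * (2 * real N))" unfolding z_def
    proof (intro sum_norm_le)
      fix k assume "k \<in> {..<n}"
      hence k: "k < n" by simp
      show "cmod (cnj (V $$ (k, j)) * grid_entry g k l) \<le> 1 * (2 * real N)"
        unfolding norm_mult using unitary_component[OF V k j] grid_entry_norm[OF g k l(1)]
        by (intro mult_mono) auto
    qed
    thus ?thesis by simp
  qed
  have fl: "\<lfloor>h * t\<rfloor> \<in> {- int B..int B}" if "\<bar>t\<bar> \<le> 2 * n * N" for t :: real
  proof -
    have "\<bar>h * t\<bar> \<le> h * (2 * n * N)" using that h by (simp add: abs_mult)
    also have "\<dots> = real B" unfolding h_def B_def by (simp add: algebra_simps)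
    finally have "- real B \<le> h * t" "h * t \<le> real B" by auto
    thus ?thesis by (simp add: le_floor_iff floor_le_iff)
  qed
  have sub: "\<phi> ` ?G \<subseteq> ?P \<times> ?Q"
  proof (intro image_subsetI)
    fix g assume "g \<in> ?G"
    hence g: "g \<in> grid n N" by simp
    have "restrict g ({..<n} \<times> ({..<n} - {l}) \<times> (UNIV :: bool set)) \<in> ?P"
      using grid_less[OF g] by (auto simp: restrict_PiE_iff)
    moreover have "restrict (\<lambda>j. (\<lfloor>h * Re (z g j)\<rfloor>, \<lfloor>h * Im (z g j)\<rfloor>)) ({..<n} - S') \<in> ?Q"
    proof (unfold restrict_PiE_iff, intro ballI)
      fix j assume "j \<in> {..<n} - S'"
      hence "cmod (z g j) \<le> 2 * n * N" using zb[OF g] by auto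
      hence "\<bar>Re (z g j)\<bar> \<le> 2 * n * N" "\<bar>Im (z g j)\<bar> \<le> 2 * n * N"
        using abs_Re_le_cmod[of "z g j"] abs_Im_le_cmod[of "z g j"] by linarith+
      thus "(\<lfloor>h * Re (z g j)\<rfloor>, \<lfloor>h * Im (z g j)\<rfloor>) \<in> {- int B..int B} \<times> {- int B..int B}"
        using fl by auto
    qed
    ultimately show "\<phi> g \<in> ?P \<times> ?Q" unfolding \<phi>_def by auto
  qed
  have inj: "inj_on \<phi> ?G"
  proof (rule inj_onI)
    fix g g' assume gG: "g \<in> ?G" "g' \<in> ?G" and eq: "\<phi> g = \<phi> g'"
    have g: "g \<in> grid n N" "g' \<in> grid n N" using gG by auto
    have off: "g (k, j, b) = g' (k, j, b)" if "k < n" "j < n" "j \<noteq> l" for k j b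
    proof -
      have "restrict g ({..<n} \<times> ({..<n} - {l}) \<times> (UNIV :: bool set)) (k, j, b)
        = restrict g' ({..<n} \<times> ({..<n} - {l}) \<times> (UNIV :: bool set)) (k, j, b)"
        using eq unfolding \<phi>_def by simp
      thus ?thesis using that by simp
    qed
    define \<delta> where "\<delta> = vec n (\<lambda>k. grid_entry g k l - grid_entry g' k l)"
    have d: "\<delta> \<in> carrier_vec n" unfolding \<delta>_def by simp
    have Vd: "(mat_adjoint V *\<^sub>v \<delta>) $ j = z g j - z g' j" if "j < n" for j
      using Vc that unfolding \<delta>_def z_def
      by (auto simp: scalar_prod_def atLeast0LessThan sum_subtractf[symmetric] right_diff_distrib)
    have small: "cmod ((mat_adjoint V *\<^sub>v \<delta>) $ j) \<le> 1 / (2 * real (n + 1))" if j: "j < n" for j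
    proof (cases "j \<in> S'")
      case False
      have "restrict (\<lambda>j. (\<lfloor>h * Re (z g j)\<rfloor>, \<lfloor>h * Im (z g j)\<rfloor>)) ({..<n} - S') j
        = restrict (\<lambda>j. (\<lfloor>h * Re (z g' j)\<rfloor>, \<lfloor>h * Im (z g' j)\<rfloor>)) ({..<n} - S') j"
        using eq unfolding \<phi>_def by simp
      hence "\<lfloor>h * Re (z g j)\<rfloor> = \<lfloor>h * Re (z g' j)\<rfloor>" "\<lfloor>h * Im (z g j)\<rfloor> = \<lfloor>h * Im (z g' j)\<rfloor>"
        using False j by auto
      from this[THEN floor_eq_imp_close, OF h]
      have "\<bar>Re (z g j - z g' j)\<bar> < 1 / h" "\<bar>Im (z g j - z g' j)\<bar> < 1 / h" by simp_all
      hence "cmod (z g j - z g' j) \<le> 1 / h + 1 / h" using cmod_le[of "z g j - z g' j"] by linarith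
      thus ?thesis unfolding Vd[OF j] h_def by (simp add: field_simps)
    next
      case True
      let ?T = "grid_mat n N g" and ?T' = "grid_mat n N g'"
      have "?T *\<^sub>v \<xi> - ?T' *\<^sub>v \<xi> = (\<xi> $ l / of_nat N) \<cdot>\<^sub>v \<delta>"
      proof (rule eq_vecI)
        fix i assume "i < dim_vec ((\<xi> $ l / of_nat N) \<cdot>\<^sub>v \<delta>)"
        hence i: "i < n" using d by simp
        have "(?T *\<^sub>v \<xi> - ?T' *\<^sub>v \<xi>) $ i = (\<Sum>k<n. (grid_entry g i k - grid_entry g' i k) * \<xi> $ k / of_nat N)"
          using i xi unfolding grid_mat_def
          by (auto simp: scalar_prod_def atLeast0LessThan sum_subtractf[symmetric] left_diff_distrib diff_divide_distrib)
        also have "\<dots> = (\<Sum>k<n. if k = l then (grid_entry g i l - grid_entry g' i l) * \<xi> $ l / of_nat N else 0)"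
          using off i by (intro sum.cong) (auto simp: grid_entry_def)
        also have "\<dots> = ((\<xi> $ l / of_nat N) \<cdot>\<^sub>v \<delta>) $ i" using l i unfolding \<delta>_def by simp
        finally show "(?T *\<^sub>v \<xi> - ?T' *\<^sub>v \<xi>) $ i = ((\<xi> $ l / of_nat N) \<cdot>\<^sub>v \<delta>) $ i" .
      qed (use d in \<open>auto simp: grid_mat_def\<close>)
      hence "(\<xi> $ l / of_nat N) \<cdot>\<^sub>v (mat_adjoint V *\<^sub>v \<delta>) = mat_adjoint V *\<^sub>v (?T *\<^sub>v \<xi> - ?T' *\<^sub>v \<xi>)"
        using mult_mat_vec[OF adjoint_carrier[OF Vc] d] by simp
      also have "\<dots> = mat_adjoint V *\<^sub>v (?T *\<^sub>v \<xi>) - mat_adjoint V *\<^sub>v (?T' *\<^sub>v \<xi>)"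
        by (rule mult_minus_distrib_mat_vec[of _ n n]) (use Vc xi in \<open>auto intro!: mult_mat_vec_carrier[of _ n n]\<close>)
      finally have "((\<xi> $ l / of_nat N) \<cdot>\<^sub>v (mat_adjoint V *\<^sub>v \<delta>)) $ j
         = (mat_adjoint V *\<^sub>v (?T *\<^sub>v \<xi>)) $ j - (mat_adjoint V *\<^sub>v (?T' *\<^sub>v \<xi>)) $ j"
        using j Vc by simp
      hence "(\<xi> $ l / of_nat N) * (mat_adjoint V *\<^sub>v \<delta>) $ j
         = (mat_adjoint V *\<^sub>v (?T *\<^sub>v \<xi>)) $ j - (mat_adjoint V *\<^sub>v (?T' *\<^sub>v \<xi>)) $ j"
        using j Vc by simp
      hence "cmod (\<xi> $ l / of_nat N) * cmod ((mat_adjoint V *\<^sub>v \<delta>) $ j)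
         \<le> cmod ((mat_adjoint V *\<^sub>v (?T *\<^sub>v \<xi>)) $ j) + cmod ((mat_adjoint V *\<^sub>v (?T' *\<^sub>v \<xi>)) $ j)"
        by (metis norm_mult norm_triangle_ineq4)
      also have "\<dots> \<le> K / (H * N) + K / (H * N)" using gG True by (intro add_mono) auto
      finally have "cmod (\<xi> $ l) * cmod ((mat_adjoint V *\<^sub>v \<delta>) $ j) \<le> 2 * K / H"
        using N by (simp add: norm_divide field_simps)
      moreover have "1 / n * cmod ((mat_adjoint V *\<^sub>v \<delta>) $ j) \<le> cmod (\<xi> $ l) * cmod ((mat_adjoint V *\<^sub>v \<delta>) $ j)"
        using l by (intro mult_right_mono) auto
      ultimately have "1 / n * cmod ((mat_adjoint V *\<^sub>v \<delta>) $ j) \<le> 2 * K / H" by linarith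
      hence "cmod ((mat_adjoint V *\<^sub>v \<delta>) $ j) \<le> 2 * n * K / H" using l by (simp add: field_simps)
      also have "\<dots> \<le> 1 / (2 * real (n + 1))" using H by (simp add: field_simps)
      finally show ?thesis .
    qed
    have "cvec_norm \<delta> = cvec_norm (mat_adjoint V *\<^sub>v \<delta>)"
      using unitary_norm[OF unitary_adjoint[OF V] d] by simp
    also have "\<dots> \<le> n * (1 / (2 * real (n + 1)))"
      using small by (intro cvec_norm_le_bound) (use Vc d in \<open>auto intro: adjoint_vec_carrier\<close>)
    also have "\<dots> < 1" by (simp add: field_simps)
    finally have d1: "cvec_norm \<delta> < 1" .
    have on: "g (k, l, b) = g' (k, l, b)" if k: "k < n" for k b
    proof -
      have "cmod (grid_entry g k l - grid_entry g' k l) < 1"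
        using cvec_norm_component[of k \<delta>] d1 k unfolding \<delta>_def by simp
      hence "\<bar>real (g (k, l, False)) - real (g' (k, l, False))\<bar> < 1" "\<bar>real (g (k, l, True)) - real (g' (k, l, True))\<bar> < 1"
        using abs_Re_le_cmod[of "grid_entry g k l - grid_entry g' k l"] abs_Im_le_cmod[of "grid_entry g k l - grid_entry g' k l"]
        unfolding grid_entry_def by (auto intro: le_less_trans)
      thus ?thesis using nat_eq_if_close by (cases b) auto
    qed
    have "g (k, j, b) = g' (k, j, b)" if "k < n" "j < n" for k j b
      using on[OF that(1)] off[OF that] by (cases "j = l") auto
    thus "g = g'" using g unfolding grid_def by (intro PiE_ext[OF g[unfolded grid_def]]) auto
  qed
  have fin: "finite (?P \<times> ?Q)" by (intro finite_cartesian_product finite_PiE) auto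
  have "card ?G \<le> card (?P \<times> ?Q)" by (rule card_inj_on_le[OF inj sub fin])
  also have "card (?P \<times> ?Q) = N ^ (2 * n * (n - 1)) * (2 * B + 1) ^ (2 * (n - card S'))"
  proof -
    have "card ?P = N ^ (2 * n * (n - 1))"
      using l by (simp add: card_PiE card_cartesian_product mult_ac)
    moreover have "card ({..<n} - S') = n - card S'"
      using S' by (simp add: card_Diff_subset finite_subset)
    hence "card ?Q = ((2 * B + 1)\<^sup>2) ^ (n - card S')"
      by (simp add: card_PiE card_sym_int_square del: card_cartesian_product)
    ultimately show ?thesis by (simp add: card_cartesian_product power_mult)
  qed
  also have "2 * B + 1 = 16 * n * (n + 1) * N + 1" unfolding B_def by simp
  finally show ?thesis .
qed

section \<open>Matrices in general position\<close>

text \<open>The normalization fixes one coefficient to be exactly \<open>1\<close>, so it removes the phase as well as the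
  length. The vectors in question then have \<open>2(r - 1)\<close> real parameters, where \<open>r = card S\<close>, and it is this
  saving over \<open>2r\<close> that makes the count of \<open>general_position\<close> work also for \<open>d = 0\<close> and equal
  ranks.\<close>

definition normalized_on :: "nat \<Rightarrow> nat set \<Rightarrow> complex vec \<Rightarrow> bool" where
  "normalized_on n S c \<longleftrightarrow> c \<in> carrier_vec n \<and> (\<forall>i<n. i \<notin> S \<longrightarrow> c $ i = 0) \<and>
     (\<forall>i<n. cmod (c $ i) \<le> 1) \<and> (\<exists>i<n. c $ i = 1)"

text \<open>The vector supported on \<open>S\<close> with coefficient \<open>1\<close> at \<open>p\<close> and the Gaussian rationals with numerators
  \<open>r i\<close> and denominator \<open>m\<close> elsewhere.\<close>

definition rounding :: "nat \<Rightarrow> nat \<Rightarrow> nat set \<Rightarrow> nat \<Rightarrow> (nat \<Rightarrow> int \<times> int) \<Rightarrow> complex vec" where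
  "rounding n m S p r = vec n (\<lambda>i. if i = p then 1 else if i \<in> S
     then Complex (real_of_int (fst (r i)) / m) (real_of_int (snd (r i)) / m) else 0)"

lemma exists_rounding:
  assumes c: "normalized_on n S c" and S: "S \<subseteq> {..<n}" and m: "m > 0"
  obtains p r where "p \<in> S" "c $ p = 1" "r \<in> (S - {p}) \<rightarrow>\<^sub>E ({- int m..int m} \<times> {- int m..int m})"
    "\<And>i. i < n \<Longrightarrow> cmod (c $ i - rounding n m S p r $ i) \<le> 2 / m"
proof -
  obtain p where p: "p < n" "c $ p = 1" using c unfolding normalized_on_def by blast
  have pS: "p \<in> S" using c p unfolding normalized_on_def by (metis zero_neq_one)
  define r where "r = restrict (\<lambda>i. (\<lfloor>m * Re (c $ i)\<rfloor>, \<lfloor>m * Im (c $ i)\<rfloor>)) (S - {p})"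
  have fl: "\<lfloor>m * t\<rfloor> \<in> {- int m..int m}" if "\<bar>t\<bar> \<le> 1" for t :: real
  proof -
    have "\<bar>m * t\<bar> \<le> m" using mult_left_mono[OF that, of m] by (simp add: abs_mult)
    hence "- real m \<le> m * t" "m * t \<le> real m" by auto
    thus ?thesis by (simp add: le_floor_iff floor_le_iff)
  qed
  have "r \<in> (S - {p}) \<rightarrow>\<^sub>E ({- int m..int m} \<times> {- int m..int m})"
    unfolding r_def restrict_PiE_iff
  proof
    fix i assume "i \<in> S - {p}"
    hence "cmod (c $ i) \<le> 1" using c S unfolding normalized_on_def by auto
    hence "\<bar>Re (c $ i)\<bar> \<le> 1" "\<bar>Im (c $ i)\<bar> \<le> 1"
      using abs_Re_le_cmod[of "c $ i"] abs_Im_le_cmod[of "c $ i"] by linarith+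
    thus "(\<lfloor>m * Re (c $ i)\<rfloor>, \<lfloor>m * Im (c $ i)\<rfloor>) \<in> {- int m..int m} \<times> {- int m..int m}"
      using fl by auto
  qed
  moreover have "cmod (c $ i - rounding n m S p r $ i) \<le> 2 / m" if i: "i < n" for i
  proof (cases "i \<in> S - {p}")
    case True
    have close: "\<bar>t - real_of_int \<lfloor>m * t\<rfloor> / m\<bar> \<le> 1 / m" for t :: real
    proof -
      have "\<bar>m * t - real_of_int \<lfloor>m * t\<rfloor>\<bar> \<le> 1" by linarith
      hence "\<bar>m * t - real_of_int \<lfloor>m * t\<rfloor>\<bar> / m \<le> 1 / m" by (intro divide_right_mono) auto
      moreover have "t - real_of_int \<lfloor>m * t\<rfloor> / m = (m * t - real_of_int \<lfloor>m * t\<rfloor>) / m"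
        using m by (simp add: field_simps)
      ultimately show ?thesis by (simp add: abs_divide)
    qed
    let ?z = "c $ i - rounding n m S p r $ i"
    have "Re ?z = Re (c $ i) - real_of_int \<lfloor>m * Re (c $ i)\<rfloor> / m" "Im ?z = Im (c $ i) - real_of_int \<lfloor>m * Im (c $ i)\<rfloor> / m"
      using True i unfolding rounding_def r_def by auto
    hence "\<bar>Re ?z\<bar> \<le> 1 / m" "\<bar>Im ?z\<bar> \<le> 1 / m" using close by auto
    thus ?thesis using cmod_le[of ?z] by simp
  next
    case False
    hence "c $ i = rounding n m S p r $ i"
      using c p i unfolding normalized_on_def rounding_def by auto
    thus ?thesis by simp
  qed
  ultimately show ?thesis using that pS p by blast
qed

text \<open>Injectivity of \<open>T\<close>, with margin \<open>\<epsilon>\<close>, on the span of the columns \<open>S\<close> of \<open>U\<close> modulo the span of the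
  columns of \<open>V\<close> outside \<open>S'\<close>. Orthonormal frames with index sets stand for the two subspaces, so that
  coordinates are at hand.\<close>

definition transversal :: "nat \<Rightarrow> real \<Rightarrow> complex mat \<Rightarrow> complex mat \<times> nat set \<times> complex mat \<times> nat set \<Rightarrow> bool" where
  "transversal n \<epsilon> T = (\<lambda>(U, S, V, S'). \<forall>c. normalized_on n S c \<longrightarrow>
     (\<exists>j\<in>S'. cmod ((mat_adjoint V *\<^sub>v (T *\<^sub>v (U *\<^sub>v c))) $ j) \<ge> \<epsilon>))"

definition frame_pair :: "nat \<Rightarrow> nat \<Rightarrow> complex mat \<times> nat set \<times> complex mat \<times> nat set \<Rightarrow> bool" where
  "frame_pair n d = (\<lambda>(U, S, V, S'). unitary_mat n U \<and> unitary_mat n V \<and>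
     S \<subseteq> {..<n} \<and> S' \<subseteq> {..<n} \<and> 2 * card S + d \<le> 2 * card S')"

definition bad_grid :: "nat \<Rightarrow> nat \<Rightarrow> real \<Rightarrow> complex mat \<times> nat set \<times> complex mat \<times> nat set \<Rightarrow> (nat \<times> nat \<times> bool \<Rightarrow> nat) set" where
  "bad_grid n N \<epsilon> f = {g \<in> grid n N. \<not> transversal n \<epsilon> (grid_mat n N g) f}"

text \<open>Rounding the coefficients of an offending vector \<open>c\<close> to multiples of \<open>1 / (H N)\<close> moves
  \<open>T U c\<close> by a multiple of \<open>1 / (H N)\<close>. So it suffices to let \<open>c\<close> run through the rounded vectors and to
  apply the preceding count to \<open>\<xi> = U c\<close> with a slightly larger margin. Such a \<open>\<xi>\<close> has norm at least \<open>1\<close>,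
  so one of its coordinates is at least \<open>1 / n\<close>.\<close>

lemma card_bad_grid:
  fixes n N H :: nat and L :: real
  assumes U: "unitary_mat n U" and V: "unitary_mat n V" and S: "S \<subseteq> {..<n}" and S': "S' \<subseteq> {..<n}"
    and N: "N > 0" and H: "H > 0" "4 * n * (n + 1) * (L + 4 * n ^ 3) \<le> H"
  shows "card (bad_grid n N (L / (H * N)) (U, S, V, S'))
    \<le> card S * (2 * (H * N) + 1) ^ (2 * (card S - 1)) * (N ^ (2 * n * (n - 1)) * (16 * n * (n + 1) * N + 1) ^ (2 * (n - card S')))"
proof -
  let ?m = "H * N"
  let ?R = "\<lambda>p. (S - {p}) \<rightarrow>\<^sub>E ({- int ?m..int ?m} \<times> {- int ?m..int ?m})"
  let ?c = "\<lambda>p r. rounding n ?m S p r"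
  let ?K = "L + 4 * n ^ 3"
  let ?G = "\<lambda>\<xi>. {g \<in> grid n N. \<forall>j\<in>S'. cmod ((mat_adjoint V *\<^sub>v (grid_mat n N g *\<^sub>v \<xi>)) $ j) \<le> ?K / (H * N)}"
  let ?X = "N ^ (2 * n * (n - 1)) * (16 * n * (n + 1) * N + 1) ^ (2 * (n - card S'))"
  have m: "?m > 0" using N H by simp
  have Uc: "U \<in> carrier_mat n n" and Vc: "V \<in> carrier_mat n n" using U V by auto
  have fS: "finite S" using S finite_subset by blast
  have cc: "?c p r \<in> carrier_vec n" for p r unfolding rounding_def by simp
  have sub: "bad_grid n N (L / (H * N)) (U, S, V, S') \<subseteq> (\<Union>p\<in>S. \<Union>r\<in>?R p. ?G (U *\<^sub>v ?c p r))"
  proof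
    fix g assume "g \<in> bad_grid n N (L / (H * N)) (U, S, V, S')"
    then obtain c where g: "g \<in> grid n N" and c: "normalized_on n S c"
      and small: "\<And>j. j \<in> S' \<Longrightarrow> cmod ((mat_adjoint V *\<^sub>v (grid_mat n N g *\<^sub>v (U *\<^sub>v c))) $ j) < L / (H * N)"
      unfolding bad_grid_def transversal_def by (auto simp: not_le)
    have cn: "c \<in> carrier_vec n" using c unfolding normalized_on_def by simp
    obtain p r where p: "p \<in> S" and r: "r \<in> ?R p" and close: "\<And>i. i < n \<Longrightarrow> cmod (c $ i - ?c p r $ i) \<le> 2 / ?m"
      using exists_rounding[OF c S m] by metis
    let ?d = "?c p r - c"
    have d: "?d \<in> carrier_vec n" using cc cn by simp
    have dn: "cvec_norm ?d \<le> n * (2 / ?m)"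
      using close cc[of p r] cn by (intro cvec_norm_le_bound[OF d]) (auto simp: norm_minus_commute)
    let ?T = "grid_mat n N g"
    have Ud: "U *\<^sub>v ?d \<in> carrier_vec n" using Uc d by auto
    have TUd: "?T *\<^sub>v (U *\<^sub>v ?d) \<in> carrier_vec n" using Ud by (auto intro: mult_mat_vec_carrier[of _ n n])
    have bd: "cvec_norm (mat_adjoint V *\<^sub>v (?T *\<^sub>v (U *\<^sub>v ?d))) \<le> 4 * n ^ 3 / ?m"
    proof -
      have "cvec_norm (mat_adjoint V *\<^sub>v (?T *\<^sub>v (U *\<^sub>v ?d))) = cvec_norm (?T *\<^sub>v (U *\<^sub>v ?d))"
        using unitary_norm[OF unitary_adjoint[OF V] TUd] .
      also have "\<dots> \<le> real n * real n * 2 * cvec_norm (U *\<^sub>v ?d)"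
        using grid_mat_norm[OF g] by (intro mat_vec_bound[OF _ Ud]) auto
      also have "\<dots> \<le> real n * real n * 2 * (n * (2 / ?m))"
        using dn unfolding unitary_norm[OF U d] by (intro mult_left_mono) auto
      also have "\<dots> = 4 * n ^ 3 / ?m" by (simp add: power3_eq_cube)
      finally show ?thesis .
    qed
    have "g \<in> ?G (U *\<^sub>v ?c p r)"
    proof (intro CollectI conjI ballI g)
      fix j assume j: "j \<in> S'"
      hence jn: "j < n" using S' by auto
      have "?c p r = c + ?d" using cc[of p r] cn by auto
      hence "mat_adjoint V *\<^sub>v (?T *\<^sub>v (U *\<^sub>v ?c p r)) = mat_adjoint V *\<^sub>v (?T *\<^sub>v (U *\<^sub>v (c + ?d)))" by simp
      also have "\<dots> = mat_adjoint V *\<^sub>v (?T *\<^sub>v (U *\<^sub>v c)) + mat_adjoint V *\<^sub>v (?T *\<^sub>v (U *\<^sub>v ?d))"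
        using Uc Vc cn d
        by (simp add: mult_add_distrib_mat_vec[of _ n n] mult_mat_vec_carrier[of _ n n] del: index_mult_mat_vec)
      finally have "(mat_adjoint V *\<^sub>v (?T *\<^sub>v (U *\<^sub>v ?c p r))) $ j
         = (mat_adjoint V *\<^sub>v (?T *\<^sub>v (U *\<^sub>v c))) $ j + (mat_adjoint V *\<^sub>v (?T *\<^sub>v (U *\<^sub>v ?d))) $ j"
        using jn Vc by simp
      hence "cmod ((mat_adjoint V *\<^sub>v (?T *\<^sub>v (U *\<^sub>v ?c p r))) $ j)
        \<le> cmod ((mat_adjoint V *\<^sub>v (?T *\<^sub>v (U *\<^sub>v c))) $ j) + cmod ((mat_adjoint V *\<^sub>v (?T *\<^sub>v (U *\<^sub>v ?d))) $ j)"
        by (metis norm_triangle_ineq)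
      also have "cmod ((mat_adjoint V *\<^sub>v (?T *\<^sub>v (U *\<^sub>v ?d))) $ j) \<le> 4 * n ^ 3 / ?m"
        using cvec_norm_component[of j "mat_adjoint V *\<^sub>v (?T *\<^sub>v (U *\<^sub>v ?d))"] bd jn Vc by simp
      also have "cmod ((mat_adjoint V *\<^sub>v (?T *\<^sub>v (U *\<^sub>v c))) $ j) \<le> L / (H * N)" using small[OF j] by simp
      finally show "cmod ((mat_adjoint V *\<^sub>v (?T *\<^sub>v (U *\<^sub>v ?c p r))) $ j) \<le> ?K / (H * N)"
        by (simp add: add_divide_distrib)
    qed
    thus "g \<in> (\<Union>p\<in>S. \<Union>r\<in>?R p. ?G (U *\<^sub>v ?c p r))" using p r by blast
  qed
  have G: "card (?G (U *\<^sub>v ?c p r)) \<le> ?X" if p: "p \<in> S" for p r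
  proof -
    let ?\<xi> = "U *\<^sub>v ?c p r"
    have pn: "p < n" using p S by auto
    have xi: "?\<xi> \<in> carrier_vec n" using Uc cc by auto
    have "1 \<le> cvec_norm (?c p r)" using cvec_norm_component[of p "?c p r"] pn unfolding rounding_def by simp
    hence 1: "1 \<le> cvec_norm ?\<xi>" using unitary_norm[OF U cc] by simp
    have "\<exists>l<n. cmod (?\<xi> $ l) \<ge> 1 / n"
    proof (rule ccontr)
      assume "\<not> ?thesis"
      hence *: "\<And>l. l < n \<Longrightarrow> cmod (?\<xi> $ l) < 1 / n" by auto
      have "(\<Sum>l<n. cmod (?\<xi> $ l)) < (\<Sum>l<n. 1 / n)" using * pn by (intro sum_strict_mono) (auto simp del: index_mult_mat_vec)
      hence "cvec_norm ?\<xi> < 1" using cvec_norm_le_sum[of ?\<xi>] xi pn Uc by (simp del: index_mult_mat_vec)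
      thus False using 1 by simp
    qed
    then obtain l where "l < n" "cmod (?\<xi> $ l) \<ge> 1 / n" by blast
    from card_grid_near_subspace[OF V S' xi this N H(1), of ?K] H(2) show ?thesis by simp
  qed
  have fin: "finite (?G \<xi>)" for \<xi> using finite_grid by simp
  have fR: "finite (?R p)" for p using fS by (intro finite_PiE) auto
  have cR: "card (?R p) = (2 * ?m + 1) ^ (2 * (card S - 1))" if "p \<in> S" for p
  proof -
    have "card (?R p) = ((2 * ?m + 1)\<^sup>2) ^ card (S - {p})"
      using fS by (simp add: card_PiE card_sym_int_square del: card_cartesian_product of_nat_mult)
    thus ?thesis using that fS by (simp add: power_mult[symmetric] card_Diff_singleton)
  qed
  have "card (bad_grid n N (L / (H * N)) (U, S, V, S')) \<le> card (\<Union>p\<in>S. \<Union>r\<in>?R p. ?G (U *\<^sub>v ?c p r))"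
    using sub fin fR fS by (intro card_mono) auto
  also have "\<dots> \<le> (\<Sum>p\<in>S. card (\<Union>r\<in>?R p. ?G (U *\<^sub>v ?c p r)))" using fS by (rule card_UN_le)
  also have "\<dots> \<le> (\<Sum>p\<in>S. \<Sum>r\<in>?R p. card (?G (U *\<^sub>v ?c p r)))"
    using fR by (intro sum_mono card_UN_le)
  also have "\<dots> \<le> (\<Sum>p\<in>S. \<Sum>r\<in>?R p. ?X)" using G by (intro sum_mono) auto
  also have "\<dots> = (\<Sum>p\<in>S. (2 * ?m + 1) ^ (2 * (card S - 1)) * ?X)"
    using cR by (intro sum.cong) (auto simp del: of_nat_mult)
  also have "\<dots> = card S * (2 * ?m + 1) ^ (2 * (card S - 1)) * ?X" by simp
  finally show ?thesis .
qed

text \<open>The dimension count. Among \<open>N\<^sup>k\<close> grid matrices, with \<open>k = 2n\<^sup>2\<close>, each member of the family excludes at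
  most a multiple of \<open>N\<close> to the power
  \<open>2(card S - 1) + 2n(n - 1) + 2(n - card S') \<le> 2n\<^sup>2 - d - 2\<close>. The family has at most a
  multiple of \<open>N\<^sup>d\<^sup>+\<^sup>1\<close> members, so for large \<open>N\<close> some grid matrix survives. The scale is
  \<open>m = H N\<close> with \<open>H\<close> fixed before \<open>N\<close>: it has to be finer than the spacing \<open>1 / N\<close> of the grid by a factor
  that depends on \<open>L\<close>.\<close>

theorem general_position:
  fixes n d M m1 :: nat and L :: real
  assumes L: "L > 0"
  shows "\<exists>m\<ge>m1. m > 0 \<and> (\<forall>\<F>. finite \<F> \<and> card \<F> \<le> M * (m + 1) ^ (d + 1) \<and> (\<forall>f\<in>\<F>. frame_pair n d f)
     \<longrightarrow> (\<exists>T\<in>carrier_mat n n. (\<forall>i<n. \<forall>j<n. cmod (T $$ (i, j)) \<le> 2) \<and> (\<forall>f\<in>\<F>. transversal n (L / m) T f)))"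
proof -
  obtain H0 :: nat where H0: "4 * n * (n + 1) * (L + 4 * n ^ 3) \<le> H0" using real_arch_simple by blast
  \<comment> \<open>The constant \<open>4 n\<^sup>3\<close> is the effect of rounding the coefficients in \<open>card_bad_grid\<close>.\<close>
  define H where "H = Suc H0"
  have H: "H > 0" "4 * n * (n + 1) * (L + 4 * n ^ 3) \<le> H" using H0 unfolding H_def by auto
  define C where "C = n * (3 * H) ^ (2 * n) * (16 * n * (n + 1) + 1) ^ (2 * n)"
  define N where "N = Suc (m1 + M * (2 * H) ^ (d + 1) * C)"
  define m where "m = H * N"
  have N: "N > 0" "N > M * (2 * H) ^ (d + 1) * C" unfolding N_def by auto
  have "1 * N \<le> H * N" using H by (intro mult_right_mono) auto
  hence m: "m \<ge> m1" "m > 0" unfolding m_def N_def by auto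
  have m1: "m + 1 \<le> 2 * H * N" "2 * (H * N) + 1 \<le> 3 * H * N" using m(2) unfolding m_def by auto
  have main: "\<exists>T\<in>carrier_mat n n. (\<forall>i<n. \<forall>j<n. cmod (T $$ (i, j)) \<le> 2) \<and> (\<forall>f\<in>\<F>. transversal n (L / m) T f)"
    if fin: "finite \<F>" and card: "card \<F> \<le> M * (m + 1) ^ (d + 1)" and fam: "\<forall>f\<in>\<F>. frame_pair n d f" for \<F>
  proof -
    let ?B = "\<lambda>f. bad_grid n N (L / (H * N)) f"
    have each: "card (?B f) * N ^ (d + 2) \<le> C * N ^ (2 * n * n)" if f: "f \<in> \<F>" for f
    proof -
      obtain U S V S' where feq: "f = (U, S, V, S')" by (cases f) auto
      have U: "unitary_mat n U" and V: "unitary_mat n V" and S: "S \<subseteq> {..<n}" and S': "S' \<subseteq> {..<n}"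
        and rank: "2 * card S + d \<le> 2 * card S'" using bspec[OF fam f] unfolding feq frame_pair_def by auto
      have cS: "card S \<le> n" "card S' \<le> n" using card_mono[OF _ S] card_mono[OF _ S'] by auto
      show ?thesis
      proof (cases "card S = 0")
        case True
        hence "card (?B f) = 0" unfolding feq using card_bad_grid[OF U V S S' N(1) H] by simp
        thus ?thesis by simp
      next
        case False
        let ?e1 = "2 * (card S - 1)" and ?e2 = "2 * n * (n - 1)" and ?e3 = "2 * (n - card S')"
        have n: "n > 0" using False cS by auto
        have "card (?B f) \<le> card S * (2 * (H * N) + 1) ^ ?e1 * (N ^ ?e2 * (16 * n * (n + 1) * N + 1) ^ ?e3)"
          unfolding feq by (rule card_bad_grid[OF U V S S' N(1) H])
        also have "\<dots> \<le> n * ((3 * H) * N) ^ ?e1 * (N ^ ?e2 * ((16 * n * (n + 1) + 1) * N) ^ ?e3)"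
          using cS m1 Suc_leI[OF N(1)] by (intro mult_mono power_mono) (auto simp: algebra_simps)
        also have "\<dots> = n * (3 * H) ^ ?e1 * (16 * n * (n + 1) + 1) ^ ?e3 * N ^ (?e1 + ?e2 + ?e3)"
          by (simp only: power_mult_distrib power_add mult_ac)
        also have "\<dots> \<le> n * (3 * H) ^ (2 * n) * (16 * n * (n + 1) + 1) ^ (2 * n) * N ^ (?e1 + ?e2 + ?e3)"
          using cS H N by (intro mult_mono power_increasing) auto
        finally have "card (?B f) * N ^ (d + 2) \<le> C * N ^ (?e1 + ?e2 + ?e3) * N ^ (d + 2)"
          unfolding C_def by (rule mult_right_mono) simp
        also have "\<dots> = C * N ^ (?e1 + ?e2 + ?e3 + (d + 2))" by (simp add: power_add)
        also have "\<dots> \<le> C * N ^ (2 * n * n)"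
        proof -
          have "2 * n * n = ?e2 + 2 * n" using n by (cases n) auto
          hence "?e1 + ?e2 + ?e3 + (d + 2) \<le> 2 * n * n" using rank False cS by simp
          thus ?thesis using N by (intro mult_left_mono power_increasing) auto
        qed
        finally show ?thesis .
      qed
    qed
    have finB: "finite (?B f)" for f
    proof -
      have "?B f \<subseteq> grid n N" unfolding bad_grid_def by auto
      thus ?thesis using finite_grid finite_subset by blast
    qed
    have "card (\<Union>f\<in>\<F>. ?B f) * N ^ (d + 2) \<le> (\<Sum>f\<in>\<F>. card (?B f)) * N ^ (d + 2)"
      using card_UN_le[OF fin] by (intro mult_right_mono) auto
    also have "\<dots> \<le> (\<Sum>f\<in>\<F>. C * N ^ (2 * n * n))"
      unfolding sum_distrib_right using each by (intro sum_mono) auto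
    also have "\<dots> = card \<F> * (C * N ^ (2 * n * n))" by simp
    also have "\<dots> \<le> (M * (2 * H * N) ^ (d + 1)) * (C * N ^ (2 * n * n))"
      using card m1 by (intro mult_right_mono order_trans[OF card] mult_left_mono power_mono) auto
    also have "\<dots> = (M * (2 * H) ^ (d + 1) * C) * (N ^ (d + 1) * N ^ (2 * n * n))"
      by (simp only: power_mult_distrib mult_ac)
    also have "\<dots> < N * (N ^ (d + 1) * N ^ (2 * n * n))"
      using N by (intro mult_strict_right_mono) auto
    also have "\<dots> = card (grid n N) * N ^ (d + 2)" unfolding card_grid by simp
    finally have "card (\<Union>f\<in>\<F>. ?B f) < card (grid n N)" using N by simp
    then obtain g where g: "g \<in> grid n N" "g \<notin> (\<Union>f\<in>\<F>. ?B f)"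
      using card_mono[of "\<Union>f\<in>\<F>. ?B f" "grid n N"] fin finB by (meson finite_UN_I leD subsetI)
    show ?thesis
    proof (intro bexI[of _ "grid_mat n N g"] conjI)
      show "\<forall>i<n. \<forall>j<n. cmod (grid_mat n N g $$ (i, j)) \<le> 2" using grid_mat_norm[OF g(1)] by blast
      show "\<forall>f\<in>\<F>. transversal n (L / m) (grid_mat n N g) f"
        using g unfolding bad_grid_def m_def by auto
    qed simp
  qed
  show ?thesis using m main by blast
qed

section \<open>Stability of spectral subspaces\<close>

definition op_close :: "nat \<Rightarrow> real \<Rightarrow> complex mat \<Rightarrow> complex mat \<Rightarrow> bool" where
  "op_close n e M N \<longleftrightarrow> (\<forall>v\<in>carrier_vec n. cvec_norm ((M - N) *\<^sub>v v) \<le> e * cvec_norm v)"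

lemma op_closeI_entries:
  fixes M N :: "complex mat"
  assumes "M \<in> carrier_mat n n" "N \<in> carrier_mat n n"
    "\<And>i j. i < n \<Longrightarrow> j < n \<Longrightarrow> cmod (M $$ (i, j) - N $$ (i, j)) \<le> e" "real n * real n * e \<le> e'"
  shows "op_close n e' M N"
  unfolding op_close_def
proof
  fix v :: "complex vec" assume v: "v \<in> carrier_vec n"
  have "cvec_norm ((M - N) *\<^sub>v v) \<le> real n * real n * e * cvec_norm v"
    using assms(1-3) by (intro mat_vec_bound[OF _ v]) auto
  also have "\<dots> \<le> e' * cvec_norm v" using assms(4) by (intro mult_right_mono) auto
  finally show "cvec_norm ((M - N) *\<^sub>v v) \<le> e' * cvec_norm v" .
qed

text \<open>The factor \<open>n\<^sup>2\<close> is the price for passing from entries to the operator norm in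
  \<open>op_closeI_entries\<close>. The summand \<open>1\<close> keeps the divisor positive for \<open>n = 0\<close>.\<close>

lemma entry_tolerance:
  assumes "e \<ge> 0"
  shows "real n * real n * (e / (real n * real n + 1)) \<le> e"
proof -
  have "real n * real n * e \<le> (real n * real n + 1) * e" using assms by (intro mult_right_mono) auto
  moreover have "real n * real n + 1 > 0" by (auto intro: add_nonneg_pos)
  ultimately show ?thesis by (simp add: pos_divide_le_eq mult.commute)
qed

lemma op_close_qform:
  assumes "op_close n e M N" "M \<in> carrier_mat n n" "N \<in> carrier_mat n n" "v \<in> carrier_vec n"
  shows "\<bar>qform M v - qform N v\<bar> \<le> e * (cvec_norm v)\<^sup>2"
  using qform_bound[of "M - N" n v e] assms unfolding op_close_def
  by (simp add: qform_minus minus_carrier_mat)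

lemma op_close_sym:
  assumes "op_close n e M N" "M \<in> carrier_mat n n" "N \<in> carrier_mat n n"
  shows "op_close n e N M"
  unfolding op_close_def
proof
  fix v :: "complex vec" assume v: "v \<in> carrier_vec n"
  have "(N - M) *\<^sub>v v = (- 1) \<cdot>\<^sub>v ((M - N) *\<^sub>v v)"
    using assms v by (simp add: minus_mult_distrib_mat_vec[of _ n n])
      (intro eq_vecI, auto)
  thus "cvec_norm ((N - M) *\<^sub>v v) \<le> e * cvec_norm v"
    using assms(1) v unfolding op_close_def by (simp add: cvec_norm_smult)
qed

lemma op_close_trans:
  assumes "op_close n e M N" "op_close n e' N P"
    and c: "M \<in> carrier_mat n n" "N \<in> carrier_mat n n" "P \<in> carrier_mat n n"
  shows "op_close n (e + e') M P"
  unfolding op_close_def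
proof
  fix v :: "complex vec" assume v: "v \<in> carrier_vec n"
  have "(M - P) *\<^sub>v v = (M - N) *\<^sub>v v + (N - P) *\<^sub>v v"
    using c v by (simp add: minus_mult_distrib_mat_vec[of _ n n])
      (intro eq_vecI, auto)
  hence "cvec_norm ((M - P) *\<^sub>v v) \<le> cvec_norm ((M - N) *\<^sub>v v) + cvec_norm ((N - P) *\<^sub>v v)"
    using cvec_norm_triangle[of "(M - N) *\<^sub>v v" n "(N - P) *\<^sub>v v"] c v
    by (simp add: mult_mat_vec_carrier[of _ n n] minus_carrier_mat)
  also have "\<dots> \<le> e * cvec_norm v + e' * cvec_norm v"
    using assms(1,2) v unfolding op_close_def by (intro add_mono) auto
  finally show "cvec_norm ((M - P) *\<^sub>v v) \<le> (e + e') * cvec_norm v" by (simp add: algebra_simps)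
qed

lemma op_close_mono: "op_close n e M N \<Longrightarrow> e \<le> e' \<Longrightarrow> op_close n e' M N"
  unfolding op_close_def by (meson cvec_norm_nonneg mult_right_mono order_trans)

lemma cvec_norm_pos: "v \<in> carrier_vec n \<Longrightarrow> v \<noteq> 0\<^sub>v n \<Longrightarrow> cvec_norm v > 0"
  using cvec_norm_eq_0[of v n] cvec_norm_nonneg[of v] by linarith

lemma few_large_eigenvalues_near:
  assumes M: "M \<in> carrier_mat n n" and A: "diagonalizes n U D A" and c: "op_close n e A M" "e < t"
  shows "card {i. i < n \<and> D i \<ge> t} \<le> vec_space.rank n M"
proof (rule few_large_eigenvalues[OF M A])
  fix v assume v: "v \<in> carrier_vec n" "v \<noteq> 0\<^sub>v n" and 0: "M *\<^sub>v v = 0\<^sub>v n"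
  have Ac: "A \<in> carrier_mat n n" using A unfolding diagonalizes_spectral_mat by auto
  have "qform M v = 0" unfolding qform_def 0 using v by simp
  hence "qform A v \<le> e * (cvec_norm v)\<^sup>2" using op_close_qform[OF c(1) Ac M v(1)] by linarith
  also have "\<dots> < t * (cvec_norm v)\<^sup>2"
    using c(2) cvec_norm_pos[OF v] by (intro mult_strict_right_mono) auto
  finally show "qform A v < t * (cvec_norm v)\<^sup>2" .
qed

lemma many_large_eigenvalues_near:
  assumes M: "M \<in> carrier_mat n n" and B: "diagonalizes n V E B" and c: "op_close n e B M" "s < \<sigma> - e"
    and gap: "\<And>u. u \<in> carrier_vec n \<Longrightarrow> qform M (M *\<^sub>v u) \<ge> \<sigma> * (cvec_norm (M *\<^sub>v u))\<^sup>2"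
  shows "vec_space.rank n M \<le> card {i. i < n \<and> E i \<ge> s}"
proof (rule many_large_eigenvalues[OF M B])
  fix u assume u: "u \<in> carrier_vec n" and n0: "M *\<^sub>v u \<noteq> 0\<^sub>v n"
  have Bc: "B \<in> carrier_mat n n" using B unfolding diagonalizes_spectral_mat by auto
  let ?w = "M *\<^sub>v u"
  have w: "?w \<in> carrier_vec n" using M u by auto
  have "s * (cvec_norm ?w)\<^sup>2 < (\<sigma> - e) * (cvec_norm ?w)\<^sup>2"
    using c(2) cvec_norm_pos[OF w n0] by (intro mult_strict_right_mono) auto
  also have "\<dots> \<le> qform B ?w"
    using gap[OF u] op_close_qform[OF c(1) Bc M w] by (simp add: algebra_simps)
  finally show "qform B ?w > s * (cvec_norm ?w)\<^sup>2" .
qed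

text \<open>On the range of \<open>M\<close> the form is at least the smallest positive eigenvalue. The minimum is taken
  together with \<open>1\<close> so that it exists for \<open>M = 0\<close>.\<close>

lemma positive_spectral_gap:
  assumes M: "diagonalizes n U D M" and D: "\<And>i. i < n \<Longrightarrow> D i \<ge> 0"
  obtains \<sigma> where "\<sigma> > 0" "\<forall>u\<in>carrier_vec n. qform M (M *\<^sub>v u) \<ge> \<sigma> * (cvec_norm (M *\<^sub>v u))\<^sup>2"
proof -
  have U: "unitary_mat n U" and Meq: "M = spectral_mat n U D" using M unfolding diagonalizes_spectral_mat by auto
  have Mc: "M \<in> carrier_mat n n" using U Meq by simp
  define \<sigma> where "\<sigma> = Min (insert 1 (D ` {i. i < n \<and> D i > 0}))"
  have fin: "finite (insert 1 (D ` {i. i < n \<and> D i > 0}))" by simp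
  have "\<sigma> > 0" unfolding \<sigma>_def by (subst Min_gr_iff) auto
  moreover have "\<sigma> * (cvec_norm (M *\<^sub>v u))\<^sup>2 \<le> qform M (M *\<^sub>v u)" if u: "u \<in> carrier_vec n" for u
  proof -
    let ?c = "\<lambda>i. (cmod ((mat_adjoint U *\<^sub>v u) $ i))\<^sup>2"
    have D\<sigma>: "\<sigma> \<le> D i" if "i < n" "D i \<noteq> 0" for i
      unfolding \<sigma>_def using that D[of i] by (intro Min_le fin) auto
    have "M *\<^sub>v (M *\<^sub>v u) = spectral_mat n U (\<lambda>i. D i * D i) *\<^sub>v u"
      using Mc u unfolding spectral_mat_mult[OF U, symmetric] Meq[symmetric] by (simp add: assoc_mult_mat_vec[of _ n n _ n])
    have q: "qform M (M *\<^sub>v u) = (\<Sum>i<n. D i * (D i)\<^sup>2 * ?c i)"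
    proof -
      have "qform M (M *\<^sub>v u) = qform (mat_adjoint M * M * M) u"
        by (rule qform_congruence[OF Mc Mc u, symmetric])
      also have "mat_adjoint M * M * M = spectral_mat n U (\<lambda>i. D i * (D i)\<^sup>2)"
        unfolding Meq using U by (simp add: spectral_mat_mult power2_eq_square mult.assoc)
      finally show ?thesis unfolding qform_spectral_mat[OF U u] .
    qed
    have "\<sigma> * (cvec_norm (M *\<^sub>v u))\<^sup>2 = (\<Sum>i<n. \<sigma> * ((D i)\<^sup>2 * ?c i))"
      unfolding Meq spectral_mat_norm_sq[OF U u] by (simp add: sum_distrib_left)
    also have "\<dots> \<le> (\<Sum>i<n. D i * (D i)\<^sup>2 * ?c i)"
    proof (rule sum_mono)
      fix i assume "i \<in> {..<n}"
      thus "\<sigma> * ((D i)\<^sup>2 * ?c i) \<le> D i * (D i)\<^sup>2 * ?c i"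
        using D\<sigma>[of i] by (cases "D i = 0") (auto simp: mult.assoc intro!: mult_right_mono)
    qed
    finally show ?thesis unfolding q .
  qed
  ultimately show ?thesis using that by blast
qed

lemma mat_vec_bound_entries_le_2:
  fixes T :: "complex mat"
  assumes "T \<in> carrier_mat n n" "v \<in> carrier_vec n" "\<forall>i<n. \<forall>j<n. cmod (T $$ (i, j)) \<le> 2"
  shows "cvec_norm (T *\<^sub>v v) \<le> 2 * real n ^ 2 * cvec_norm v"
  using mat_vec_bound[of T n n v 2] assms by (simp add: power2_eq_square mult_ac)

text \<open>Injectivity of \<open>T\<close> with margin \<open>\<theta>\<close> at the pair \<open>(A, B)\<close> carries over to a nearby pair \<open>(A', B')\<close>.
  Let \<open>\<eta>\<close> be a combination of eigenvectors of \<open>A'\<close> with eigenvalues at least \<open>t + \<tau>\<close>. Its components along the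
  eigenvectors of \<open>A\<close> with eigenvalues below \<open>t\<close> are of order \<open>q / \<tau>\<close> by the overlap bound, so up to this
  error \<open>\<eta>\<close> is one of the vectors to which the hypothesis applies, and \<open>T \<eta>\<close> has a component of size
  \<open>\<theta>\<close> along an eigenvector of \<open>B\<close> with eigenvalue at least \<open>s\<close>. By the overlap bound again, such a component
  can come only from eigenvectors of \<open>B'\<close> with eigenvalues above \<open>s - \<tau>\<close>, where the cut-off \<open>h\<close> is at least
  \<open>1\<close>, up to an error of order \<open>q / \<tau>\<close>. The bound on \<open>\<theta>\<close> collects both errors.\<close>

lemma transversality_estimate:
  assumes A': "diagonalizes n U1 D1 A'" and B': "diagonalizes n V1 E1 B'"
    and A: "diagonalizes n U D A" and B: "diagonalizes n V E B"
    and close: "op_close n q A' A" "op_close n q B' B" and q: "q \<ge> 0" and \<tau>: "\<tau> > 0"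
    and T: "T \<in> carrier_mat n n" "\<forall>i<n. \<forall>j<n. cmod (T $$ (i, j)) \<le> 2"
    and good: "transversal n \<theta> T (U, {i. i < n \<and> D i \<ge> t}, V, {i. i < n \<and> E i \<ge> s})"
    and \<theta>: "\<theta> \<ge> (2 * real n ^ 5 + 2 * real n ^ 4) * (q / \<tau>) + real n ^ 2 * \<kappa>" and \<kappa>: "\<kappa> \<ge> 0"
    and small: "real n ^ 2 * (q / \<tau>) < 1"
    and eta: "\<eta> \<in> carrier_vec n" "\<And>j. j < n \<Longrightarrow> D1 j < t + \<tau> \<Longrightarrow> (mat_adjoint U1 *\<^sub>v \<eta>) $ j = 0"
    and h: "\<And>i. i < n \<Longrightarrow> E1 i > s - \<tau> \<Longrightarrow> h i \<ge> 1"
  shows "\<kappa> * cvec_norm \<eta> \<le> cvec_norm (spectral_mat n V1 h *\<^sub>v (T *\<^sub>v \<eta>))"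
proof (cases "\<eta> = 0\<^sub>v n")
  case True
  thus ?thesis by simp
next
  case False
  let ?S = "{i. i < n \<and> D i \<ge> t}"
  have U1: "unitary_mat n U1" and V1: "unitary_mat n V1" and U: "unitary_mat n U" and V: "unitary_mat n V"
    using A' B' A B unfolding diagonalizes_def by auto
  have Uc: "U1 \<in> carrier_mat n n" "V1 \<in> carrier_mat n n" "U \<in> carrier_mat n n" "V \<in> carrier_mat n n"
    using U1 V1 U V by auto
  have pos: "cvec_norm \<eta> > 0" using cvec_norm_pos[OF eta(1) False] .
  define c where "c = mat_adjoint U *\<^sub>v \<eta>"
  define \<alpha> where "\<alpha> = mat_adjoint U1 *\<^sub>v \<eta>"
  have c: "c \<in> carrier_vec n" and al: "\<alpha> \<in> carrier_vec n" unfolding c_def \<alpha>_def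
    using Uc eta by (auto intro: adjoint_vec_carrier)
  have nc: "cvec_norm c = cvec_norm \<eta>" unfolding c_def using unitary_norm[OF unitary_adjoint[OF U] eta(1)] .
  have na: "cvec_norm \<alpha> = cvec_norm \<eta>" unfolding \<alpha>_def using unitary_norm[OF unitary_adjoint[OF U1] eta(1)] .
  have n: "n > 0" using False eta by (cases n) auto
  have "Max ((\<lambda>i. cmod (c $ i)) ` {..<n}) \<in> (\<lambda>i. cmod (c $ i)) ` {..<n}"
    using n by (intro Max_in) auto
  then obtain p where p: "p < n" and "cmod (c $ p) = Max ((\<lambda>i. cmod (c $ i)) ` {..<n})" by auto
  hence pmax: "cmod (c $ i) \<le> cmod (c $ p)" if "i < n" for i using that by simp
  define \<nu> where "\<nu> = cmod (c $ p)"
  have eta_nu: "cvec_norm \<eta> \<le> n * \<nu>" unfolding nc[symmetric] \<nu>_def using pmax by (intro cvec_norm_le_bound[OF c]) auto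
  have "0 < n * \<nu>" using eta_nu pos by linarith
  hence nu: "\<nu> > 0" using n by (simp add: zero_less_mult_iff)
  have off: "cmod (c $ i) \<le> real n ^ 2 * (q / \<tau>) * \<nu>" if i: "i < n" "i \<notin> ?S" for i
  proof -
    have "c = (mat_adjoint U * U1) *\<^sub>v \<alpha>"
      unfolding c_def \<alpha>_def using Uc eta U1
      by (simp add: assoc_mult_mat_vec[of _ n n _ n] adjoint_vec_carrier[of U1 n n])
    hence "c $ i = (\<Sum>j<n. (mat_adjoint U * U1) $$ (i, j) * \<alpha> $ j)"
      using mat_vec_index[of "mat_adjoint U * U1" n n \<alpha> i] Uc al i by (simp add: mult_carrier_mat[of _ n n _ n])
    also have "cmod \<dots> \<le> (\<Sum>j<n. (q / \<tau>) * cvec_norm \<eta>)"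
    proof (intro sum_norm_le)
      fix j assume "j \<in> {..<n}"
      hence j: "j < n" by simp
      show "cmod ((mat_adjoint U * U1) $$ (i, j) * \<alpha> $ j) \<le> (q / \<tau>) * cvec_norm \<eta>"
      proof (cases "D1 j < t + \<tau>")
        case True
        thus ?thesis using eta(2)[OF j] q \<tau> unfolding \<alpha>_def by simp
      next
        case False
        have "\<bar>D1 j - D i\<bar> * cmod ((mat_adjoint U * U1) $$ (i, j)) \<le> q"
          using eigenvector_overlap[OF A' A _ i(1) j] close(1) unfolding op_close_def by auto
        moreover have "\<tau> \<le> \<bar>D1 j - D i\<bar>" using False i by auto
        hence "\<tau> * cmod ((mat_adjoint U * U1) $$ (i, j)) \<le> \<bar>D1 j - D i\<bar> * cmod ((mat_adjoint U * U1) $$ (i, j))"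
          by (intro mult_right_mono) auto
        ultimately have "cmod ((mat_adjoint U * U1) $$ (i, j)) \<le> q / \<tau>" using \<tau> by (simp add: field_simps)
        moreover have "cmod (\<alpha> $ j) \<le> cvec_norm \<eta>" using cvec_norm_component[of j \<alpha>] al j na by auto
        ultimately show ?thesis unfolding norm_mult using q \<tau> by (intro mult_mono) auto
      qed
    qed
    also have "\<dots> = n * (q / \<tau>) * cvec_norm \<eta>" by simp
    also have "\<dots> \<le> n * (q / \<tau>) * (n * \<nu>)" using eta_nu q \<tau> by (intro mult_left_mono) auto
    finally show ?thesis by (simp add: power2_eq_square mult_ac)
  qed
  \<comment> \<open>The largest coefficient sits in \<open>S\<close>, so division by it normalizes the part of \<open>c\<close> on \<open>S\<close>.\<close>
  have pS: "p \<in> ?S"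
  proof (rule ccontr)
    assume "p \<notin> ?S"
    hence "\<nu> \<le> real n ^ 2 * (q / \<tau>) * \<nu>" using off[OF p] unfolding \<nu>_def by simp
    also have "\<dots> < 1 * \<nu>" using small nu by (intro mult_strict_right_mono) auto
    finally show False by simp
  qed
  define b where "b = vec n (\<lambda>i. if i \<in> ?S then c $ i / c $ p else 0)"
  define r where "r = vec n (\<lambda>i. if i \<in> ?S then 0 else c $ i)"
  have b: "b \<in> carrier_vec n" and r: "r \<in> carrier_vec n" unfolding b_def r_def by auto
  have cp: "c $ p \<noteq> 0" using nu unfolding \<nu>_def by auto
  have "normalized_on n ?S b" unfolding normalized_on_def
    using p pS cp pmax b unfolding b_def by (auto simp: norm_divide divide_le_eq intro!: exI[of _ p])
  hence "\<exists>j\<in>{i. i < n \<and> E i \<ge> s}. cmod ((mat_adjoint V *\<^sub>v (T *\<^sub>v (U *\<^sub>v b))) $ j) \<ge> \<theta>"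
    using good unfolding transversal_def by simp
  then obtain j where j: "j < n" "E j \<ge> s" and bj: "cmod ((mat_adjoint V *\<^sub>v (T *\<^sub>v (U *\<^sub>v b))) $ j) \<ge> \<theta>"
    by blast
  have cbr: "c = c $ p \<cdot>\<^sub>v b + r" using c cp unfolding b_def r_def by (intro eq_vecI) auto
  have nr: "cvec_norm r \<le> n * (real n ^ 2 * (q / \<tau>) * \<nu>)"
    using off q \<tau> nu by (intro cvec_norm_le_bound[OF r]) (auto simp: r_def)
  define \<zeta> where "\<zeta> = T *\<^sub>v \<eta>"
  define cutoff where "cutoff = cvec_norm (spectral_mat n V1 h *\<^sub>v \<zeta>)"
  have ze: "\<zeta> \<in> carrier_vec n" unfolding \<zeta>_def using T eta by auto
  have "\<eta> = U *\<^sub>v c" unfolding c_def using U eta by simp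
  also have "\<dots> = c $ p \<cdot>\<^sub>v (U *\<^sub>v b) + U *\<^sub>v r"
    using Uc b r by (subst cbr) (simp add: mult_add_distrib_mat_vec[of _ n n] mult_mat_vec[of _ n n])
  finally have eta_eq: "\<eta> = c $ p \<cdot>\<^sub>v (U *\<^sub>v b) + U *\<^sub>v r" .
  have Ub: "U *\<^sub>v b \<in> carrier_vec n" and Ur: "U *\<^sub>v r \<in> carrier_vec n" using Uc b r by auto
  have TUb: "T *\<^sub>v (U *\<^sub>v b) \<in> carrier_vec n" and TUr: "T *\<^sub>v (U *\<^sub>v r) \<in> carrier_vec n" using T Ub Ur by auto
  have "mat_adjoint V *\<^sub>v \<zeta> = c $ p \<cdot>\<^sub>v (mat_adjoint V *\<^sub>v (T *\<^sub>v (U *\<^sub>v b))) + mat_adjoint V *\<^sub>v (T *\<^sub>v (U *\<^sub>v r))"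
    unfolding \<zeta>_def using T Ub Ur TUb TUr Uc
    by (subst eta_eq) (simp add: mult_add_distrib_mat_vec[of _ n n] mult_mat_vec[of _ n n] del: index_mult_mat_vec)
  hence "(mat_adjoint V *\<^sub>v \<zeta>) $ j = c $ p * (mat_adjoint V *\<^sub>v (T *\<^sub>v (U *\<^sub>v b))) $ j + (mat_adjoint V *\<^sub>v (T *\<^sub>v (U *\<^sub>v r))) $ j"
    using j Uc by (simp del: index_mult_mat_vec)
  hence "c $ p * (mat_adjoint V *\<^sub>v (T *\<^sub>v (U *\<^sub>v b))) $ j = (mat_adjoint V *\<^sub>v \<zeta>) $ j - (mat_adjoint V *\<^sub>v (T *\<^sub>v (U *\<^sub>v r))) $ j"
    by (simp del: index_mult_mat_vec)
  hence "cmod (c $ p) * cmod ((mat_adjoint V *\<^sub>v (T *\<^sub>v (U *\<^sub>v b))) $ j)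
      \<le> cmod ((mat_adjoint V *\<^sub>v \<zeta>) $ j) + cmod ((mat_adjoint V *\<^sub>v (T *\<^sub>v (U *\<^sub>v r))) $ j)"
    by (metis norm_mult norm_triangle_ineq4)
  moreover have "\<nu> * \<theta> \<le> cmod (c $ p) * cmod ((mat_adjoint V *\<^sub>v (T *\<^sub>v (U *\<^sub>v b))) $ j)"
    unfolding \<nu>_def using bj by (intro mult_left_mono) auto
  moreover have "cmod ((mat_adjoint V *\<^sub>v (T *\<^sub>v (U *\<^sub>v r))) $ j) \<le> 2 * real n ^ 5 * (q / \<tau>) * \<nu>"
  proof -
    have "cmod ((mat_adjoint V *\<^sub>v (T *\<^sub>v (U *\<^sub>v r))) $ j) \<le> cvec_norm (mat_adjoint V *\<^sub>v (T *\<^sub>v (U *\<^sub>v r)))"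
      using cvec_norm_component[of j "mat_adjoint V *\<^sub>v (T *\<^sub>v (U *\<^sub>v r))"] j Uc by simp
    also have "\<dots> = cvec_norm (T *\<^sub>v (U *\<^sub>v r))" using unitary_norm[OF unitary_adjoint[OF V] TUr] .
    also have "\<dots> \<le> 2 * real n ^ 2 * cvec_norm r"
      using mat_vec_bound_entries_le_2[OF T(1) Ur T(2)] unitary_norm[OF U r] by simp
    also have "\<dots> \<le> 2 * real n ^ 2 * (n * (real n ^ 2 * (q / \<tau>) * \<nu>))" using nr by (intro mult_left_mono) auto
    also have "\<dots> = 2 * real n ^ 5 * (q / \<tau>) * \<nu>" by (simp add: eval_nat_numeral)
    finally show ?thesis .
  qed
  moreover have "cmod ((mat_adjoint V *\<^sub>v \<zeta>) $ j) \<le> n * ((q / \<tau>) * cvec_norm \<zeta> + cutoff)"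
  proof -
    define \<beta> where "\<beta> = mat_adjoint V1 *\<^sub>v \<zeta>"
    have be: "\<beta> \<in> carrier_vec n" unfolding \<beta>_def using Uc ze by (auto intro: adjoint_vec_carrier)
    have nb: "cvec_norm \<beta> = cvec_norm \<zeta>" unfolding \<beta>_def using unitary_norm[OF unitary_adjoint[OF V1] ze] .
    have "mat_adjoint V *\<^sub>v \<zeta> = (mat_adjoint V * V1) *\<^sub>v \<beta>"
      unfolding \<beta>_def using Uc ze V1
      by (simp add: assoc_mult_mat_vec[of _ n n _ n] adjoint_vec_carrier[of V1 n n])
    hence "(mat_adjoint V *\<^sub>v \<zeta>) $ j = (\<Sum>i<n. (mat_adjoint V * V1) $$ (j, i) * \<beta> $ i)"
      using mat_vec_index[of "mat_adjoint V * V1" n n \<beta> j] Uc be j by (simp add: mult_carrier_mat[of _ n n _ n])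
    also have "cmod \<dots> \<le> (\<Sum>i<n. (q / \<tau>) * cvec_norm \<zeta> + cutoff)"
    proof (intro sum_norm_le)
      fix i assume "i \<in> {..<n}"
      hence i: "i < n" by simp
      show "cmod ((mat_adjoint V * V1) $$ (j, i) * \<beta> $ i) \<le> (q / \<tau>) * cvec_norm \<zeta> + cutoff"
      proof (cases "E1 i > s - \<tau>")
        case True
        have "cmod ((mat_adjoint V * V1) $$ (j, i)) \<le> 1"
          using unitary_component[OF unitary_mult[OF unitary_adjoint[OF V] V1] j(1) i] .
        moreover have "cmod (\<beta> $ i) \<le> cutoff"
        proof -
          have hv: "vec n (\<lambda>i. complex_of_real (h i) * \<beta> $ i) \<in> carrier_vec n" by simp
          have "cmod (\<beta> $ i) \<le> h i * cmod (\<beta> $ i)" using mult_right_mono[OF h[OF i True], of "cmod (\<beta> $ i)"] by simp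
          also have "\<dots> = cmod (vec n (\<lambda>i. complex_of_real (h i) * \<beta> $ i) $ i)" using i h[OF i True] by (simp add: norm_mult)
          also have "\<dots> \<le> cvec_norm (vec n (\<lambda>i. complex_of_real (h i) * \<beta> $ i))" using i by (intro cvec_norm_component) auto
          also have "\<dots> = cutoff"
            unfolding cutoff_def spectral_mat_vec[OF V1 ze] \<beta>_def[symmetric] unitary_norm[OF V1 hv] ..
          finally show ?thesis .
        qed
        ultimately have "cmod ((mat_adjoint V * V1) $$ (j, i) * \<beta> $ i) \<le> 1 * cutoff"
          unfolding norm_mult by (intro mult_mono) auto
        moreover have "0 \<le> (q / \<tau>) * cvec_norm \<zeta>" using q \<tau> by simp
        ultimately show ?thesis by linarith
      next
        case False
        have "\<bar>E1 i - E j\<bar> * cmod ((mat_adjoint V * V1) $$ (j, i)) \<le> q"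
          using eigenvector_overlap[OF B' B _ j(1) i] close(2) unfolding op_close_def by auto
        moreover have "\<tau> \<le> \<bar>E1 i - E j\<bar>" using False j by auto
        hence "\<tau> * cmod ((mat_adjoint V * V1) $$ (j, i)) \<le> \<bar>E1 i - E j\<bar> * cmod ((mat_adjoint V * V1) $$ (j, i))"
          by (intro mult_right_mono) auto
        ultimately have "cmod ((mat_adjoint V * V1) $$ (j, i)) \<le> q / \<tau>" using \<tau> by (simp add: field_simps)
        moreover have "cmod (\<beta> $ i) \<le> cvec_norm \<zeta>" using cvec_norm_component[of i \<beta>] be i nb by auto
        ultimately have "cmod ((mat_adjoint V * V1) $$ (j, i) * \<beta> $ i) \<le> (q / \<tau>) * cvec_norm \<zeta>"
          unfolding norm_mult using q \<tau> by (intro mult_mono) auto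
        thus ?thesis unfolding cutoff_def using cvec_norm_nonneg[of "spectral_mat n V1 h *\<^sub>v \<zeta>"] by linarith
      qed
    qed
    finally show ?thesis by simp
  qed
  moreover have "n * ((q / \<tau>) * cvec_norm \<zeta>) \<le> 2 * real n ^ 4 * (q / \<tau>) * \<nu>"
  proof -
    have "cvec_norm \<zeta> \<le> 2 * real n ^ 2 * cvec_norm \<eta>" unfolding \<zeta>_def by (rule mat_vec_bound_entries_le_2[OF T(1) eta(1) T(2)])
    also have "\<dots> \<le> 2 * real n ^ 2 * (n * \<nu>)" using eta_nu by (intro mult_left_mono) auto
    finally have "n * ((q / \<tau>) * cvec_norm \<zeta>) \<le> n * ((q / \<tau>) * (2 * real n ^ 2 * (n * \<nu>)))"
      using q \<tau> by (intro mult_left_mono) auto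
    thus ?thesis by (simp add: eval_nat_numeral mult_ac)
  qed
  moreover have "((2 * real n ^ 5 + 2 * real n ^ 4) * (q / \<tau>) + real n ^ 2 * \<kappa>) * \<nu> \<le> \<theta> * \<nu>"
    using \<theta> nu by (intro mult_right_mono) auto
  ultimately have "real n ^ 2 * \<kappa> * \<nu> \<le> n * cutoff"
    by (simp add: algebra_simps)
  hence "n * (\<kappa> * (n * \<nu>)) \<le> n * cutoff"
    by (simp add: power2_eq_square mult_ac)
  hence "\<kappa> * (n * \<nu>) \<le> cutoff" using n by simp
  moreover have "\<kappa> * cvec_norm \<eta> \<le> \<kappa> * (n * \<nu>)" using eta_nu \<kappa> by (intro mult_left_mono) auto
  ultimately show ?thesis unfolding cutoff_def \<zeta>_def by linarith
qed

section \<open>Interpolation over the nerve of a cover\<close>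

lemma matC_neighbourhood:
  fixes X :: "'a::metric_space set"
  assumes a: "a \<in> matC X n" and z: "z \<in> X" and t: "t > 0"
  shows "\<exists>\<delta>>0. \<forall>y\<in>X \<inter> ball z \<delta>. \<forall>i<n. \<forall>j<n. cmod (a y $$ (i, j) - a z $$ (i, j)) \<le> t"
proof -
  have "\<exists>\<delta>>0. \<forall>y\<in>X. dist y z < \<delta> \<longrightarrow> dist (a y $$ (i, j)) (a z $$ (i, j)) < t" if "i < n" "j < n" for i j
    using matC_D(2)[OF a that] z t unfolding continuous_on_iff by blast
  then obtain \<delta> where \<delta>: "\<And>i j. i < n \<Longrightarrow> j < n \<Longrightarrow> \<delta> i j > 0"
    "\<And>i j y. i < n \<Longrightarrow> j < n \<Longrightarrow> y \<in> X \<Longrightarrow> dist y z < \<delta> i j \<Longrightarrow> dist (a y $$ (i, j)) (a z $$ (i, j)) < t"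
    by metis
  define \<mu> where "\<mu> = Min (insert 1 ((\<lambda>(i, j). \<delta> i j) ` ({..<n} \<times> {..<n})))"
  have fin: "finite (insert 1 ((\<lambda>(i, j). \<delta> i j) ` ({..<n} \<times> {..<n})))" by simp
  have "\<mu> > 0" unfolding \<mu>_def using \<delta>(1) by (subst Min_gr_iff) auto
  moreover have "cmod (a y $$ (i, j) - a z $$ (i, j)) \<le> t" if "y \<in> X \<inter> ball z \<mu>" "i < n" "j < n" for y i j
  proof -
    have "\<mu> \<le> \<delta> i j" unfolding \<mu>_def using that by (intro Min_le fin) auto
    hence "dist y z < \<delta> i j" using that by (auto simp: dist_commute)
    thus ?thesis using \<delta>(2)[OF that(2,3)] that(1) unfolding dist_norm[symmetric] by (simp add: less_imp_le)
  qed
  ultimately show ?thesis by blast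
qed

lemma matC_neighbourhood_op:
  fixes X :: "'a::metric_space set"
  assumes a: "a \<in> matC X n" and z: "z \<in> X" and e: "e > 0"
  shows "\<exists>\<delta>>0. \<forall>y\<in>X \<inter> ball z \<delta>. op_close n e (a y) (a z)"
proof -
  have "e / (real n * real n + 1) > 0" using e by (auto intro!: divide_pos_pos add_nonneg_pos)
  from matC_neighbourhood[OF a z this] obtain \<delta> where \<delta>: "\<delta> > 0"
    "\<forall>y\<in>X \<inter> ball z \<delta>. \<forall>i<n. \<forall>j<n. cmod (a y $$ (i, j) - a z $$ (i, j)) \<le> e / (real n * real n + 1)"
    by blast
  have "op_close n e (a y) (a z)" if y: "y \<in> X \<inter> ball z \<delta>" for y
    using \<delta>(2) y e matC_D(1)[OF a] z by (intro op_closeI_entries[OF _ _ _ entry_tolerance]) auto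
  thus ?thesis using \<delta>(1) by blast
qed

text \<open>A partition of unity subordinate to a refinement of multiplicity at most \<open>d + 1\<close>. The index set
  consists of subsets of \<open>X\<close>, whereas the library works with open sets of the ambient space, so
  each \<open>V\<close> is represented by an ambient open set \<open>G V\<close> with \<open>V = X \<inter> G V\<close>.\<close>

lemma partition_of_unity_multiplicity:
  fixes X :: "'a::metric_space set"
  assumes X: "compact X" and dim: "covering_dim_le X d" and W: "\<And>x. x \<in> X \<Longrightarrow> open (W x) \<and> x \<in> W x"
  obtains \<V> and f :: "'a set \<Rightarrow> 'a \<Rightarrow> real" where "finite \<V>" "\<And>V. V \<in> \<V> \<Longrightarrow> continuous_on X (f V)" "\<And>V. V \<in> \<V> \<Longrightarrow> V \<subseteq> X"
    "\<And>V x. V \<in> \<V> \<Longrightarrow> x \<in> X \<Longrightarrow> 0 \<le> f V x" "\<And>x. x \<in> X \<Longrightarrow> (\<Sum>V\<in>\<V>. f V x) = 1"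
    "\<And>V x. V \<in> \<V> \<Longrightarrow> x \<in> X \<Longrightarrow> f V x \<noteq> 0 \<Longrightarrow> x \<in> V"
    "\<And>x. x \<in> X \<Longrightarrow> card {V \<in> \<V>. f V x \<noteq> 0} \<le> d + 1"
    "\<And>V. V \<in> \<V> \<Longrightarrow> \<exists>y\<in>X. V \<subseteq> W y"
proof -
  have "X \<subseteq> (\<Union>x\<in>X. W x)" using W by blast
  then obtain F where F: "F \<subseteq> X" "finite F" "X \<subseteq> (\<Union>x\<in>F. W x)"
    using compactE_image[OF X, of X W] W by metis
  define \<U> where "\<U> = (\<lambda>y. X \<inter> W y) ` F"
  have "finite \<U> \<and> (\<forall>U\<in>\<U>. openin (top_of_set X) U) \<and> \<Union>\<U> = X"
    using F W unfolding \<U>_def by (auto intro: openin_open_Int)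
  from dim[unfolded covering_dim_le_def, THEN spec, THEN mp, OF this]
  obtain \<V> where \<V>: "finite \<V>" "\<forall>V\<in>\<V>. openin (top_of_set X) V" "\<Union>\<V> = X"
    "\<forall>V\<in>\<V>. \<exists>U\<in>\<U>. V \<subseteq> U" "\<forall>x\<in>X. card {V\<in>\<V>. x \<in> V} \<le> d + 1"
    by (elim exE conjE) (rule that)
  have "\<forall>V\<in>\<V>. \<exists>G. open G \<and> V = X \<inter> G" using \<V>(2) unfolding openin_open by blast
  then obtain G where G: "\<And>V. V \<in> \<V> \<Longrightarrow> open (G V)" "\<And>V. V \<in> \<V> \<Longrightarrow> V = X \<inter> G V" by metis
  have inj: "inj_on G \<V>" using G(2) by (metis inj_onI)
  have fG: "finite (G ` \<V>)" using \<V>(1) by simp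
  have cov: "X \<subseteq> \<Union>(G ` \<V>)" using \<V>(3) G(2) by fastforce
  obtain \<Phi> :: "'a set \<Rightarrow> 'a \<Rightarrow> real" where \<Phi>:
    "\<And>U. U \<in> G ` \<V> \<Longrightarrow> continuous_on X (\<Phi> U) \<and> (\<forall>x\<in>X. 0 \<le> \<Phi> U x)"
    "\<And>x U. \<lbrakk>U \<in> G ` \<V>; x \<in> X; x \<notin> U\<rbrakk> \<Longrightarrow> \<Phi> U x = 0"
    "\<And>x. x \<in> X \<Longrightarrow> supp_sum (\<lambda>W. \<Phi> W x) (G ` \<V>) = 1"
  proof (rule subordinate_partition_of_unity[OF cov])
    show "\<And>T. T \<in> G ` \<V> \<Longrightarrow> open T" using G by blast
    show "\<exists>V. open V \<and> x \<in> V \<and> finite {U \<in> G ` \<V>. U \<inter> V \<noteq> {}}" for x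
      using fG by (intro exI[of _ UNIV]) auto
  qed blast
  define f where "f = (\<lambda>V. \<Phi> (G V))"
  have sup: "x \<in> V" if "V \<in> \<V>" "x \<in> X" "f V x \<noteq> 0" for V x
    using \<Phi>(2)[of "G V" x] G(2)[OF that(1)] that unfolding f_def by blast
  show ?thesis
  proof (rule that[of \<V> f])
    show "(\<Sum>V\<in>\<V>. f V x) = 1" if "x \<in> X" for x
    proof -
      have "supp_sum (\<lambda>W. \<Phi> W x) (G ` \<V>) = (\<Sum>W\<in>G ` \<V>. \<Phi> W x)"
        unfolding supp_sum_def support_on_def using fG by (intro sum.mono_neutral_left) auto
      also have "\<dots> = (\<Sum>V\<in>\<V>. f V x)" unfolding f_def using inj by (simp add: sum.reindex)
      finally show ?thesis using \<Phi>(3)[OF that] by simp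
    qed
    show "card {V \<in> \<V>. f V x \<noteq> 0} \<le> d + 1" if x: "x \<in> X" for x
    proof -
      have "card {V \<in> \<V>. f V x \<noteq> 0} \<le> card {V\<in>\<V>. x \<in> V}"
        using \<V>(1) sup x by (intro card_mono) auto
      thus ?thesis using \<V>(5) x by force
    qed
    show "\<exists>y\<in>X. V \<subseteq> W y" if V: "V \<in> \<V>" for V
    proof -
      obtain y where "y \<in> F" "V \<subseteq> X \<inter> W y" using bspec[OF \<V>(4) V] unfolding \<U>_def by auto
      thus ?thesis using F(1) by (intro bexI[of _ y]) auto
    qed
    show "finite \<V>" by (rule \<V>(1))
    show "continuous_on X (f V)" if "V \<in> \<V>" for V
      using \<Phi>(1)[OF imageI[OF that]] unfolding f_def by simp
    show "0 \<le> f V x" if "V \<in> \<V>" "x \<in> X" for V x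
      using \<Phi>(1)[OF imageI[OF that(1)]] that(2) unfolding f_def by simp
    show "V \<subseteq> X" if "V \<in> \<V>" for V using \<V>(3) that by blast
    show "x \<in> V" if "V \<in> \<V>" "x \<in> X" "f V x \<noteq> 0" for V x using that by (rule sup)
  qed
qed

text \<open>For weights of sum one this is the value at the point of the nerve with barycentric coordinates
  \<open>c\<close> of the affine interpolation of the vertex values \<open>A\<close>. Rounded weights need not have sum one.\<close>

definition weighted_sum :: "nat \<Rightarrow> 'v set \<Rightarrow> ('v \<Rightarrow> real) \<Rightarrow> ('v \<Rightarrow> complex mat) \<Rightarrow> complex mat" where
  "weighted_sum n \<V> c A = mat n n (\<lambda>(i, j). \<Sum>V\<in>\<V>. complex_of_real (c V) * A V $$ (i, j))"

lemma weighted_sum_carrier [simp]: "weighted_sum n \<V> c A \<in> carrier_mat n n"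
  unfolding weighted_sum_def by simp

lemma weighted_sum_hermitian:
  assumes "\<And>V. V \<in> \<V> \<Longrightarrow> c V \<noteq> 0 \<Longrightarrow> A V \<in> carrier_mat n n \<and> mat_adjoint (A V) = A V"
  shows "mat_adjoint (weighted_sum n \<V> c A) = weighted_sum n \<V> c A"
proof (rule eq_matI)
  fix i j assume "i < dim_row (weighted_sum n \<V> c A)" "j < dim_col (weighted_sum n \<V> c A)"
  hence ij: "i < n" "j < n" unfolding weighted_sum_def by auto
  have eq: "complex_of_real (c V) * cnj (A V $$ (j, i)) = complex_of_real (c V) * A V $$ (i, j)" if V: "V \<in> \<V>" for V
  proof (cases "c V = 0")
    case False
    hence A: "A V \<in> carrier_mat n n" "mat_adjoint (A V) = A V" using assms V by auto
    have "mat_adjoint (A V) $$ (i, j) = cnj (A V $$ (j, i))" using A(1) ij by (intro adjoint_index) auto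
    thus ?thesis unfolding A(2) by simp
  qed simp
  have "mat_adjoint (weighted_sum n \<V> c A) $$ (i, j) = (\<Sum>V\<in>\<V>. complex_of_real (c V) * cnj (A V $$ (j, i)))"
    using ij by (simp add: weighted_sum_def)
  also have "\<dots> = (\<Sum>V\<in>\<V>. complex_of_real (c V) * A V $$ (i, j))" by (rule sum.cong[OF refl eq])
  finally show "mat_adjoint (weighted_sum n \<V> c A) $$ (i, j) = weighted_sum n \<V> c A $$ (i, j)"
    using ij by (simp add: weighted_sum_def)
qed (auto simp: weighted_sum_def)

lemma weighted_sum_matC:
  assumes "\<And>V. V \<in> \<V> \<Longrightarrow> continuous_on X (f V)"
  shows "(\<lambda>x. weighted_sum n \<V> (\<lambda>V. f V x) A) \<in> matC X n"
proof -
  have "continuous_on X (\<lambda>x. weighted_sum n \<V> (\<lambda>V. f V x) A $$ (i, j))" if "i < n" "j < n" for i j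
  proof -
    have "continuous_on X (\<lambda>x. \<Sum>V\<in>\<V>. complex_of_real (f V x) * A V $$ (i, j))"
      using assms by (intro continuous_intros) auto
    thus ?thesis using that unfolding weighted_sum_def by simp
  qed
  thus ?thesis unfolding matC_def by simp
qed

lemma weighted_sum_close_point:
  fixes e e' :: real
  assumes "finite \<V>" "(\<Sum>V\<in>\<V>. c V) = 1" "\<And>V. V \<in> \<V> \<Longrightarrow> c V \<ge> 0" "M \<in> carrier_mat n n"
    "\<And>V i j. V \<in> \<V> \<Longrightarrow> c V \<noteq> 0 \<Longrightarrow> i < n \<Longrightarrow> j < n \<Longrightarrow> cmod (A V $$ (i, j) - M $$ (i, j)) \<le> e"
    and e: "real n * real n * e \<le> e'"
  shows "op_close n e' (weighted_sum n \<V> c A) M"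
proof (rule op_closeI_entries[OF _ assms(4) _ e])
  fix i j assume ij: "i < n" "j < n"
  have "(\<Sum>V\<in>\<V>. complex_of_real (c V) * M $$ (i, j)) = M $$ (i, j)"
    unfolding sum_distrib_right[symmetric] of_real_sum[symmetric] assms(2) by simp
  hence "weighted_sum n \<V> c A $$ (i, j) - M $$ (i, j) = (\<Sum>V\<in>\<V>. complex_of_real (c V) * (A V $$ (i, j) - M $$ (i, j)))"
    using ij unfolding weighted_sum_def by (simp add: right_diff_distrib sum_subtractf)
  also have "cmod \<dots> \<le> (\<Sum>V\<in>\<V>. c V * e)"
  proof (rule sum_norm_le)
    fix V assume V: "V \<in> \<V>"
    show "cmod (complex_of_real (c V) * (A V $$ (i, j) - M $$ (i, j))) \<le> c V * e"
      using assms(3)[OF V] assms(5)[OF V _ ij] unfolding norm_mult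
      by (cases "c V = 0") (auto intro: mult_left_mono)
  qed
  also have "\<dots> = e" unfolding sum_distrib_right[symmetric] assms(2) by simp
  finally show "cmod (weighted_sum n \<V> c A $$ (i, j) - M $$ (i, j)) \<le> e" .
qed simp

lemma weighted_sum_close_weights:
  fixes t R e' :: real
  assumes "finite \<V>" "\<And>V. V \<in> \<V> \<Longrightarrow> \<bar>c V - c' V\<bar> \<le> t" "\<And>V. V \<in> \<V> \<Longrightarrow> c V = 0 \<Longrightarrow> c' V = 0" and R: "R \<ge> 0"
    "\<And>V i j. V \<in> \<V> \<Longrightarrow> c V \<noteq> 0 \<Longrightarrow> i < n \<Longrightarrow> j < n \<Longrightarrow> cmod (A V $$ (i, j)) \<le> R"
    and e: "real n * real n * (card \<V> * (t * R)) \<le> e'"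
  shows "op_close n e' (weighted_sum n \<V> c A) (weighted_sum n \<V> c' A)"
proof (rule op_closeI_entries[OF _ _ _ e])
  fix i j assume ij: "i < n" "j < n"
  have "weighted_sum n \<V> c A $$ (i, j) - weighted_sum n \<V> c' A $$ (i, j)
    = (\<Sum>V\<in>\<V>. complex_of_real (c V - c' V) * A V $$ (i, j))"
    using ij unfolding weighted_sum_def by (simp add: left_diff_distrib sum_subtractf)
  also have "cmod \<dots> \<le> (\<Sum>V\<in>\<V>. t * R)"
  proof (rule sum_norm_le)
    fix V assume V: "V \<in> \<V>"
    have t: "t \<ge> 0" using assms(2)[OF V] by linarith
    show "cmod (complex_of_real (c V - c' V) * A V $$ (i, j)) \<le> t * R"
    proof (cases "c V = 0")
      case True
      thus ?thesis using assms(3)[OF V] t R by simp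
    next
      case False
      have "\<bar>c V - c' V\<bar> * cmod (A V $$ (i, j)) \<le> t * R"
        using assms(2)[OF V] R(2)[OF V False ij] t by (intro mult_mono) auto
      thus ?thesis by (simp add: norm_mult del: of_real_diff)
    qed
  qed
  finally show "cmod (weighted_sum n \<V> c A $$ (i, j) - weighted_sum n \<V> c' A $$ (i, j)) \<le> card \<V> * (t * R)" by simp
qed simp_all

text \<open>The grid points of the nerve: every possible support contributes a cube with at most
  \<open>(m + 1)\<^sup>d\<^sup>+\<^sup>1\<close> points.\<close>

lemma card_sparse_functions:
  assumes fin: "finite \<V>"
  shows "finite {k \<in> \<V> \<rightarrow>\<^sub>E {..m::nat}. card {V \<in> \<V>. k V \<noteq> 0} \<le> d + 1}" (is "finite ?K")
    and "card {k \<in> \<V> \<rightarrow>\<^sub>E {..m}. card {V \<in> \<V>. k V \<noteq> 0} \<le> d + 1} \<le> 2 ^ card \<V> * (m + 1) ^ (d + 1)"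
proof -
  have fE: "finite (\<V> \<rightarrow>\<^sub>E {..m})" using fin by (intro finite_PiE) auto
  show "finite ?K" by (rule finite_subset[OF _ fE]) auto
  let ?J = "{J. J \<subseteq> \<V> \<and> card J \<le> d + 1}"
  let ?P = "\<lambda>J. PiE \<V> (\<lambda>V. if V \<in> J then {..m} else {0})"
  have fJ: "finite ?J" "card ?J \<le> 2 ^ card \<V>"
    using card_mono[of "Pow \<V>" ?J] fin by (auto simp: card_Pow)
  have P: "finite (?P J)" "card (?P J) \<le> (m + 1) ^ (d + 1)" if J: "J \<in> ?J" for J
  proof -
    show "finite (?P J)" using fin by (intro finite_PiE) auto
    have "card (?P J) = (\<Prod>V\<in>\<V>. if V \<in> J then m + 1 else 1)"
      unfolding card_PiE[OF fin] by (intro prod.cong) auto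
    also have "\<dots> = (\<Prod>V\<in>J. m + 1)"
      using J fin by (subst prod.inter_restrict[symmetric]) (auto intro!: prod.cong simp: Int_absorb1 simp del: prod_constant)
    also have "\<dots> = (m + 1) ^ card J" by simp
    also have "\<dots> \<le> (m + 1) ^ (d + 1)" using J by (intro power_increasing) auto
    finally show "card (?P J) \<le> (m + 1) ^ (d + 1)" .
  qed
  have "?K \<subseteq> (\<Union>J\<in>?J. ?P J)"
  proof
    fix k assume k: "k \<in> ?K"
    hence "{V \<in> \<V>. k V \<noteq> 0} \<in> ?J" by auto
    moreover have "k \<in> ?P {V \<in> \<V>. k V \<noteq> 0}" using k by (auto simp: PiE_def Pi_def)
    ultimately show "k \<in> (\<Union>J\<in>?J. ?P J)" by blast
  qed
  hence "card ?K \<le> card (\<Union>J\<in>?J. ?P J)" using fJ P by (intro card_mono) auto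
  also have "\<dots> \<le> (\<Sum>J\<in>?J. card (?P J))" using fJ by (intro card_UN_le)
  also have "\<dots> \<le> (\<Sum>J\<in>?J. (m + 1) ^ (d + 1))" using P by (intro sum_mono)
  also have "\<dots> = card ?J * (m + 1) ^ (d + 1)" by simp
  also have "\<dots> \<le> 2 ^ card \<V> * (m + 1) ^ (d + 1)" using fJ by (intro mult_right_mono) auto
  finally show "card ?K \<le> 2 ^ card \<V> * (m + 1) ^ (d + 1)" .
qed

section \<open>Comparison of positive elements\<close>

lemma hermitian_field_diagonalization:
  assumes "a \<in> matC X n" "\<And>x. x \<in> X \<Longrightarrow> mat_adjoint (a x) = a x"
  obtains U D where "\<And>x. x \<in> X \<Longrightarrow> diagonalizes n (U x) (D x) (a x)"
proof -
  have "\<exists>U D. \<forall>x\<in>X. diagonalizes n (U x) (D x) (a x)"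
    using hermitian_diagonalizable[OF matC_D(1)[OF assms(1)] assms(2)] by metis
  thus ?thesis using that by blast
qed

text \<open>Every \<open>z\<close> has a gap \<open>s\<close> of its own and a neighbourhood on which \<open>b\<close> varies by at most \<open>s / 8\<close>; finitely
  many of these neighbourhoods cover \<open>X\<close>, and \<open>\<sigma>\<close> is the smallest of their gaps.\<close>

lemma uniform_spectral_gap:
  fixes X :: "'a::metric_space set"
  assumes X: "compact X" and a: "a \<in> matC X n" and b: "matC_positive X n b" and e: "e > 0"
  obtains \<sigma> where "\<sigma> > 0" "\<And>x. x \<in> X \<Longrightarrow> \<exists>z\<in>X. \<exists>s\<ge>\<sigma>. op_close n e (a x) (a z) \<and> op_close n (s / 8) (b x) (b z)
    \<and> (\<forall>u\<in>carrier_vec n. qform (b z) (b z *\<^sub>v u) \<ge> s * (cvec_norm (b z *\<^sub>v u))\<^sup>2)"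
proof -
  have bc: "b \<in> matC X n" and bh: "\<And>x. x \<in> X \<Longrightarrow> mat_adjoint (b x) = b x"
    using b unfolding matC_positive_def by auto
  obtain V E where VE: "\<And>x. x \<in> X \<Longrightarrow> diagonalizes n (V x) (E x) (b x)"
    using hermitian_field_diagonalization[OF bc bh] by blast
  have "\<exists>s>0. \<forall>u\<in>carrier_vec n. qform (b z) (b z *\<^sub>v u) \<ge> s * (cvec_norm (b z *\<^sub>v u))\<^sup>2" if z: "z \<in> X" for z
    using positive_spectral_gap[OF VE[OF z] matC_positive_eigenvalues[OF b z VE[OF z]]] by metis
  then obtain s where s: "\<And>z. z \<in> X \<Longrightarrow> s z > 0"
    "\<And>z. z \<in> X \<Longrightarrow> \<forall>u\<in>carrier_vec n. qform (b z) (b z *\<^sub>v u) \<ge> s z * (cvec_norm (b z *\<^sub>v u))\<^sup>2" by metis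
  have "\<exists>\<delta>>0. \<forall>y\<in>X \<inter> ball z \<delta>. op_close n e (a y) (a z) \<and> op_close n (s z / 8) (b y) (b z)" if z: "z \<in> X" for z
  proof -
    obtain \<delta>1 where "\<delta>1 > 0" "\<forall>y\<in>X \<inter> ball z \<delta>1. op_close n e (a y) (a z)"
      using matC_neighbourhood_op[OF a z e] by blast
    moreover have "s z / 8 > 0" using s(1)[OF z] by simp
    then obtain \<delta>2 where "\<delta>2 > 0" "\<forall>y\<in>X \<inter> ball z \<delta>2. op_close n (s z / 8) (b y) (b z)"
      using matC_neighbourhood_op[OF bc z] by blast
    ultimately show ?thesis by (intro exI[of _ "min \<delta>1 \<delta>2"]) auto
  qed
  then obtain \<delta> where \<delta>: "\<And>z. z \<in> X \<Longrightarrow> \<delta> z > 0"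
    "\<And>z y. z \<in> X \<Longrightarrow> y \<in> X \<inter> ball z (\<delta> z) \<Longrightarrow> op_close n e (a y) (a z) \<and> op_close n (s z / 8) (b y) (b z)"
    by metis
  have "X \<subseteq> (\<Union>z\<in>X. ball z (\<delta> z))" using \<delta>(1) by force
  then obtain Z where Z: "Z \<subseteq> X" "finite Z" "X \<subseteq> (\<Union>z\<in>Z. ball z (\<delta> z))"
    using compactE_image[OF X, of X "\<lambda>z. ball z (\<delta> z)"] by auto
  define \<sigma> where "\<sigma> = Min (insert 1 (s ` Z))"
  have fin: "finite (insert 1 (s ` Z))" using Z by simp
  have "\<sigma> > 0" unfolding \<sigma>_def using s(1) Z by (subst Min_gr_iff) auto
  moreover have "\<exists>z\<in>X. \<exists>t\<ge>\<sigma>. op_close n e (a x) (a z) \<and> op_close n (t / 8) (b x) (b z)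
    \<and> (\<forall>u\<in>carrier_vec n. qform (b z) (b z *\<^sub>v u) \<ge> t * (cvec_norm (b z *\<^sub>v u))\<^sup>2)" if x: "x \<in> X" for x
  proof -
    obtain z where z: "z \<in> Z" "x \<in> ball z (\<delta> z)" using Z(3) x by blast
    hence zX: "z \<in> X" using Z(1) by auto
    have "\<sigma> \<le> s z" unfolding \<sigma>_def using z by (intro Min_le fin) auto
    thus ?thesis using \<delta>(2)[OF zX] z x s(2)[OF zX] zX by blast
  qed
  ultimately show ?thesis using that by blast
qed

text \<open>The constants are chosen in the order \<open>e1\<close>, \<open>\<sigma>\<close>, \<open>\<tau>\<close>, then the cover and its partition of unity, then
  the margin \<open>\<Lambda>\<close>, then the scale \<open>m\<close> and the matrix \<open>T\<close>. The levels are spaced by \<open>\<tau>\<close> so that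
  \<open>transversality_estimate\<close> applies: the subspace for \<open>a\<close> is cut at \<open>4 e1\<close> and \<open>\<phi>\<close> vanishes up to
  \<open>5 e1\<close>; the subspace for \<open>b\<close> is cut at \<open>\<sigma> / 2\<close>, while \<open>\<psi>\<close> is \<open>1\<close> from \<open>3 \<sigma> / 8\<close> on and vanishes up to
  \<open>\<sigma> / 4\<close>, which exceeds the distance \<open>\<sigma> / 8\<close> between \<open>b\<close> and \<open>b'\<close>.\<close>

theorem dominated_if_rank_gap:
  fixes X :: "'a::metric_space set"
  assumes X: "compact X" and dim: "covering_dim_le X d"
    and a: "matC_positive X n a" and b: "matC_positive X n b"
    and rank: "\<And>x. x \<in> X \<Longrightarrow> 2 * vec_space.rank n (a x) + d \<le> 2 * vec_space.rank n (b x)"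
    and e: "e > 0"
  shows "\<exists>w\<in>matC X n. \<exists>C\<ge>0. \<forall>x\<in>X. \<forall>\<xi>\<in>carrier_vec n.
      qform (a x) \<xi> \<le> e * (cvec_norm \<xi>)\<^sup>2 + C * qform (b x) (w x *\<^sub>v \<xi>)"
proof -
  have ac: "a \<in> matC X n" and ah: "\<And>x. x \<in> X \<Longrightarrow> mat_adjoint (a x) = a x"
    and bc: "b \<in> matC X n" and bh: "\<And>x. x \<in> X \<Longrightarrow> mat_adjoint (b x) = b x"
    using a b unfolding matC_positive_def by auto
  note aC = matC_D(1)[OF ac] and bC = matC_D(1)[OF bc]
  define e1 where "e1 = e / 6"
  have e1: "e1 > 0" unfolding e1_def using e by simp
  obtain \<sigma> where \<sigma>: "\<sigma> > 0" and base: "\<And>x. x \<in> X \<Longrightarrow> \<exists>z\<in>X. \<exists>s\<ge>\<sigma>. op_close n e1 (a x) (a z) \<and> op_close n (s / 8) (b x) (b z)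
    \<and> (\<forall>u\<in>carrier_vec n. qform (b z) (b z *\<^sub>v u) \<ge> s * (cvec_norm (b z *\<^sub>v u))\<^sup>2)"
    using uniform_spectral_gap[OF X ac b e1] by metis
  define \<tau> where "\<tau> = min e1 (\<sigma> / 8)"
  have \<tau>: "\<tau> > 0" "\<tau> \<le> e1" "\<tau> \<le> \<sigma> / 8" unfolding \<tau>_def using e1 \<sigma> by auto
  define N1 where "N1 = real n * real n + 1"
  have N1: "N1 > 0" unfolding N1_def by (auto intro: add_nonneg_pos)
  have N1\<tau>: "real n * real n * (\<tau> / N1) \<le> \<tau>" unfolding N1_def using \<tau> by (intro entry_tolerance) simp
  have "\<exists>\<delta>>0. \<forall>y\<in>X \<inter> ball z \<delta>. \<forall>i<n. \<forall>j<n. cmod (a y $$ (i, j) - a z $$ (i, j)) \<le> \<tau> / N1 / 2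
      \<and> cmod (b y $$ (i, j) - b z $$ (i, j)) \<le> \<tau> / N1 / 2" if z: "z \<in> X" for z
  proof -
    obtain \<delta>1 where d1: "\<delta>1 > 0" "\<forall>y\<in>X \<inter> ball z \<delta>1. \<forall>i<n. \<forall>j<n. cmod (a y $$ (i, j) - a z $$ (i, j)) \<le> \<tau> / N1 / 2"
      using matC_neighbourhood[OF ac z, of "\<tau> / N1 / 2"] \<tau> N1 by auto
    obtain \<delta>2 where d2: "\<delta>2 > 0" "\<forall>y\<in>X \<inter> ball z \<delta>2. \<forall>i<n. \<forall>j<n. cmod (b y $$ (i, j) - b z $$ (i, j)) \<le> \<tau> / N1 / 2"
      using matC_neighbourhood[OF bc z, of "\<tau> / N1 / 2"] \<tau> N1 by auto
    show ?thesis using d1 d2 by (intro exI[of _ "min \<delta>1 \<delta>2"]) auto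
  qed
  then obtain \<delta> where \<delta>: "\<And>z. z \<in> X \<Longrightarrow> \<delta> z > 0"
    "\<And>z. z \<in> X \<Longrightarrow> \<forall>y\<in>X \<inter> ball z (\<delta> z). \<forall>i<n. \<forall>j<n. cmod (a y $$ (i, j) - a z $$ (i, j)) \<le> \<tau> / N1 / 2
      \<and> cmod (b y $$ (i, j) - b z $$ (i, j)) \<le> \<tau> / N1 / 2"
    by metis
  obtain \<V> and f :: "'a set \<Rightarrow> 'a \<Rightarrow> real" where fin: "finite \<V>" and fcont: "\<And>V. V \<in> \<V> \<Longrightarrow> continuous_on X (f V)"
    and VX: "\<And>V. V \<in> \<V> \<Longrightarrow> V \<subseteq> X" and f0: "\<And>V x. V \<in> \<V> \<Longrightarrow> x \<in> X \<Longrightarrow> 0 \<le> f V x"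
    and f1: "\<And>x. x \<in> X \<Longrightarrow> (\<Sum>V\<in>\<V>. f V x) = 1"
    and fsupp: "\<And>V x. V \<in> \<V> \<Longrightarrow> x \<in> X \<Longrightarrow> f V x \<noteq> 0 \<Longrightarrow> x \<in> V"
    and fmult: "\<And>x. x \<in> X \<Longrightarrow> card {V \<in> \<V>. f V x \<noteq> 0} \<le> d + 1"
    and fsmall: "\<And>V. V \<in> \<V> \<Longrightarrow> \<exists>y\<in>X. V \<subseteq> ball y (\<delta> y)"
  proof (rule partition_of_unity_multiplicity[OF X dim, of "\<lambda>y. ball y (\<delta> y)"])
    show "open (ball x (\<delta> x)) \<and> x \<in> ball x (\<delta> x)" if "x \<in> X" for x using \<delta>(1)[OF that] by auto
  qed (rule that)
  \<comment> \<open>Empty members of the cover have weight zero everywhere, so the arbitrary value of \<open>pt\<close> there does no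
    harm.\<close>
  define pt where "pt = (\<lambda>V :: 'a set. SOME x. x \<in> V)"
  have pt: "pt V \<in> V" if "x \<in> V" for V x unfolding pt_def using that by (rule someI)
  have ptX: "pt V \<in> X" if "V \<in> \<V>" "x \<in> X" "f V x \<noteq> 0" for V x
    using pt[OF fsupp[OF that]] VX[OF that(1)] by auto
  have near: "cmod (a (pt V) $$ (i, j) - a x $$ (i, j)) \<le> \<tau> / N1" "cmod (b (pt V) $$ (i, j) - b x $$ (i, j)) \<le> \<tau> / N1"
    if V: "V \<in> \<V>" and x: "x \<in> X" "f V x \<noteq> 0" and ij: "i < n" "j < n" for V x i j
  proof -
    obtain y where y: "y \<in> X" "V \<subseteq> ball y (\<delta> y)" using fsmall[OF V] by blast
    have "x \<in> X \<inter> ball y (\<delta> y)" "pt V \<in> X \<inter> ball y (\<delta> y)"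
      using y x fsupp[OF V x] ptX[OF V x] pt[OF fsupp[OF V x]] by auto
    hence "cmod (a x $$ (i, j) - a y $$ (i, j)) \<le> \<tau> / N1 / 2" "cmod (b x $$ (i, j) - b y $$ (i, j)) \<le> \<tau> / N1 / 2"
      "cmod (a (pt V) $$ (i, j) - a y $$ (i, j)) \<le> \<tau> / N1 / 2" "cmod (b (pt V) $$ (i, j) - b y $$ (i, j)) \<le> \<tau> / N1 / 2"
      using \<delta>(2)[OF y(1)] ij by blast+
    thus "cmod (a (pt V) $$ (i, j) - a x $$ (i, j)) \<le> \<tau> / N1" "cmod (b (pt V) $$ (i, j) - b x $$ (i, j)) \<le> \<tau> / N1"
      using norm_triangle_ineq4[of "a (pt V) $$ (i, j) - a y $$ (i, j)" "a x $$ (i, j) - a y $$ (i, j)"]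
        norm_triangle_ineq4[of "b (pt V) $$ (i, j) - b y $$ (i, j)" "b x $$ (i, j) - b y $$ (i, j)"] by auto
  qed
  define A where "A = (\<lambda>c. weighted_sum n \<V> c (\<lambda>V. a (pt V)))"
  define B where "B = (\<lambda>c. weighted_sum n \<V> c (\<lambda>V. b (pt V)))"
  define a' where "a' = (\<lambda>x. A (\<lambda>V. f V x))"
  define b' where "b' = (\<lambda>x. B (\<lambda>V. f V x))"
  have AC: "A c \<in> carrier_mat n n" and BC: "B c \<in> carrier_mat n n" for c unfolding A_def B_def by auto
  have a'c: "a' \<in> matC X n" and b'c: "b' \<in> matC X n"
    unfolding a'_def b'_def A_def B_def using fcont by (auto intro!: weighted_sum_matC)
  have a'C: "a' x \<in> carrier_mat n n" and b'C: "b' x \<in> carrier_mat n n" for x unfolding a'_def b'_def by (auto simp: AC BC)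
  have herm: "mat_adjoint (A c) = A c" "mat_adjoint (B c) = B c"
    if x: "x \<in> X" and c: "\<And>V. V \<in> \<V> \<Longrightarrow> c V \<noteq> 0 \<Longrightarrow> f V x \<noteq> 0" for x c
    unfolding A_def B_def using ptX[OF _ x c] ah bh aC bC by (auto intro!: weighted_sum_hermitian)
  have a'h: "mat_adjoint (a' x) = a' x" and b'h: "mat_adjoint (b' x) = b' x" if "x \<in> X" for x
    unfolding a'_def b'_def using herm[OF that] by auto
  have a'a: "op_close n \<tau> (a' x) (a x)" and b'b: "op_close n \<tau> (b' x) (b x)" if x: "x \<in> X" for x
    unfolding a'_def b'_def A_def B_def
    using weighted_sum_close_point[OF fin f1[OF x] f0[OF _ x] aC[OF x] _ N1\<tau>, of "\<lambda>V. a (pt V)"]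
      weighted_sum_close_point[OF fin f1[OF x] f0[OF _ x] bC[OF x] _ N1\<tau>, of "\<lambda>V. b (pt V)"] near[OF _ x] by blast+
  obtain Ra where Ra: "Ra \<ge> 0" "\<And>x i j. x \<in> X \<Longrightarrow> i < n \<Longrightarrow> j < n \<Longrightarrow> cmod (a x $$ (i, j)) \<le> Ra"
    by (rule matC_bounded[OF X ac]) (rule that)
  obtain Rb where Rb: "Rb \<ge> 0" "\<And>x i j. x \<in> X \<Longrightarrow> i < n \<Longrightarrow> j < n \<Longrightarrow> cmod (b x $$ (i, j)) \<le> Rb"
    by (rule matC_bounded[OF X bc]) (rule that)
  define R where "R = max Ra Rb"
  have R: "R \<ge> 0" "\<And>x i j. x \<in> X \<Longrightarrow> i < n \<Longrightarrow> j < n \<Longrightarrow> cmod (a x $$ (i, j)) \<le> R"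
    "\<And>x i j. x \<in> X \<Longrightarrow> i < n \<Longrightarrow> j < n \<Longrightarrow> cmod (b x $$ (i, j)) \<le> R"
    unfolding R_def using Ra Rb by (auto simp: le_max_iff_disj)
  define L where "L = real n * real n * (card \<V> * R)"
  have L: "L \<ge> 0" unfolding L_def using R by simp
  define \<Lambda> where "\<Lambda> = (2 * real n ^ 5 + 2 * real n ^ 4) * (L / \<tau>) + real n ^ 2 + 1"
  have \<Lambda>: "\<Lambda> > 0" unfolding \<Lambda>_def using L \<tau> by (intro add_nonneg_pos add_nonneg_nonneg mult_nonneg_nonneg) auto
  obtain m1 :: nat where m1: "(real n ^ 2 + 1) * L / \<tau> < m1" using reals_Archimedean2 by blast
  from general_position[OF \<Lambda>, of m1 "2 ^ card \<V>" d n]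
  obtain m where m: "m \<ge> m1" "m > 0" and gen: "\<forall>\<F>. finite \<F> \<and> card \<F> \<le> 2 ^ card \<V> * (m + 1) ^ (d + 1) \<and> (\<forall>f\<in>\<F>. frame_pair n d f)
     \<longrightarrow> (\<exists>T\<in>carrier_mat n n. (\<forall>i<n. \<forall>j<n. cmod (T $$ (i, j)) \<le> 2) \<and> (\<forall>f\<in>\<F>. transversal n (\<Lambda> / m) T f))"
    by (elim exE conjE) (rule that)
  define q where "q = L / m"
  have q0: "q \<ge> 0" unfolding q_def using L by simp
  have q: "(real n ^ 2 + 1) * (q / \<tau>) < 1"
  proof -
    have "(real n ^ 2 + 1) * L / \<tau> < real m" using m1 m(1) by linarith
    hence "((real n ^ 2 + 1) * L / \<tau>) / m < 1" using m(2) by (subst divide_less_eq_1_pos) simp_all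
    thus ?thesis unfolding q_def by (simp add: field_simps)
  qed
  have "real n ^ 2 * (q / \<tau>) + q / \<tau> < 1" using q by (simp add: algebra_simps)
  moreover have "q / \<tau> \<ge> 0" "real n ^ 2 * (q / \<tau>) \<ge> 0" using q0 \<tau> by auto
  ultimately have q1: "real n ^ 2 * (q / \<tau>) < 1" and "q / \<tau> < 1" by linarith+
  hence q\<tau>: "q \<le> \<tau>" using \<tau> by simp
  define rnd where "rnd = (\<lambda>x. restrict (\<lambda>V. nat \<lfloor>m * f V x\<rfloor>) \<V>)"
  define wt where "wt = (\<lambda>(k :: 'a set \<Rightarrow> nat) V. real (k V) / m)"
  have fle1: "f V x \<le> 1" if "V \<in> \<V>" "x \<in> X" for V x
  proof -
    have "f V x \<le> (\<Sum>V\<in>\<V>. f V x)" using fin that f0 by (intro member_le_sum) auto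
    thus ?thesis using f1[OF that(2)] by simp
  qed
  have rnd_supp: "f V x \<noteq> 0" if "V \<in> \<V>" "rnd x V \<noteq> 0" for V x using that unfolding rnd_def by auto
  have rnd_close: "\<bar>f V x - wt (rnd x) V\<bar> \<le> 1 / m" if V: "V \<in> \<V>" and x: "x \<in> X" for V x
  proof -
    have "real (nat \<lfloor>m * f V x\<rfloor>) = real_of_int \<lfloor>m * f V x\<rfloor>" using f0[OF V x] by simp
    hence "\<bar>m * f V x - real (rnd x V)\<bar> \<le> 1" unfolding rnd_def using V by simp linarith
    hence "\<bar>m * f V x - real (rnd x V)\<bar> / m \<le> 1 / m" by (intro divide_right_mono) auto
    moreover have "f V x - wt (rnd x) V = (m * f V x - real (rnd x V)) / m"
      unfolding wt_def using m by (simp add: field_simps)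
    ultimately show ?thesis by (simp add: abs_divide)
  qed
  have rnd_grid: "rnd x \<in> {k \<in> \<V> \<rightarrow>\<^sub>E {..m}. card {V \<in> \<V>. k V \<noteq> 0} \<le> d + 1}" if x: "x \<in> X" for x
  proof (intro CollectI conjI)
    have "\<lfloor>m * f V x\<rfloor> \<le> int m" if "V \<in> \<V>" for V
    proof -
      have "m * f V x \<le> real m * 1" using fle1[OF that x] by (intro mult_left_mono) auto
      thus ?thesis by (simp add: floor_le_iff)
    qed
    hence "nat \<lfloor>m * f V x\<rfloor> \<le> m" if "V \<in> \<V>" for V using that by (simp add: nat_le_iff)
    thus "rnd x \<in> \<V> \<rightarrow>\<^sub>E {..m}" unfolding rnd_def restrict_PiE_iff by auto
    have "card {V \<in> \<V>. rnd x V \<noteq> 0} \<le> card {V \<in> \<V>. f V x \<noteq> 0}"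
      using fin rnd_supp by (intro card_mono) auto
    thus "card {V \<in> \<V>. rnd x V \<noteq> 0} \<le> d + 1" using fmult[OF x] by linarith
  qed
  define Gr where "Gr = rnd ` X"
  have Gr: "finite Gr" "card Gr \<le> 2 ^ card \<V> * (m + 1) ^ (d + 1)"
  proof -
    have sub: "Gr \<subseteq> {k \<in> \<V> \<rightarrow>\<^sub>E {..m}. card {V \<in> \<V>. k V \<noteq> 0} \<le> d + 1}"
      unfolding Gr_def using rnd_grid by blast
    show "finite Gr" by (rule finite_subset[OF sub card_sparse_functions(1)[OF fin]])
    show "card Gr \<le> 2 ^ card \<V> * (m + 1) ^ (d + 1)"
      by (rule order_trans[OF card_mono[OF card_sparse_functions(1)[OF fin] sub] card_sparse_functions(2)[OF fin]])
  qed
  have wt_supp: "f V x \<noteq> 0" if "V \<in> \<V>" "wt (rnd x) V \<noteq> 0" for V x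
    using rnd_supp[OF that(1)] that(2) unfolding wt_def by auto
  have "\<forall>k\<in>Gr. \<exists>U D. diagonalizes n U D (A (wt k))"
    unfolding Gr_def using herm(1) wt_supp by (auto intro!: hermitian_diagonalizable AC)
  then obtain U D where UD: "\<And>k. k \<in> Gr \<Longrightarrow> diagonalizes n (U k) (D k) (A (wt k))" by metis
  have "\<forall>k\<in>Gr. \<exists>U D. diagonalizes n U D (B (wt k))"
    unfolding Gr_def using herm(2) wt_supp by (auto intro!: hermitian_diagonalizable BC)
  then obtain V E where VE: "\<And>k. k \<in> Gr \<Longrightarrow> diagonalizes n (V k) (E k) (B (wt k))" by metis
  define S where "S = (\<lambda>k. {i. i < n \<and> D k i \<ge> 4 * e1})"
  define S' where "S' = (\<lambda>k. {i. i < n \<and> E k i \<ge> \<sigma> / 2})"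
  have a'k: "op_close n q (a' x) (A (wt (rnd x)))" and b'k: "op_close n q (b' x) (B (wt (rnd x)))" if x: "x \<in> X" for x
  proof -
    have Lq: "real n * real n * (card \<V> * (1 / m * R)) \<le> q" unfolding q_def L_def by simp
    show "op_close n q (a' x) (A (wt (rnd x)))" unfolding a'_def A_def
    proof (rule weighted_sum_close_weights[OF fin _ _ R(1) _ Lq])
      show "\<bar>f V x - wt (rnd x) V\<bar> \<le> 1 / m" if "V \<in> \<V>" for V by (rule rnd_close[OF that x])
      show "wt (rnd x) V = 0" if "V \<in> \<V>" "f V x = 0" for V using wt_supp that by blast
      show "cmod (a (pt V) $$ (i, j)) \<le> R" if "V \<in> \<V>" "f V x \<noteq> 0" "i < n" "j < n" for V i j
        using R(2) ptX[OF that(1) x that(2)] that by blast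
    qed
    show "op_close n q (b' x) (B (wt (rnd x)))" unfolding b'_def B_def
    proof (rule weighted_sum_close_weights[OF fin _ _ R(1) _ Lq])
      show "\<bar>f V x - wt (rnd x) V\<bar> \<le> 1 / m" if "V \<in> \<V>" for V by (rule rnd_close[OF that x])
      show "wt (rnd x) V = 0" if "V \<in> \<V>" "f V x = 0" for V using wt_supp that by blast
      show "cmod (b (pt V) $$ (i, j)) \<le> R" if "V \<in> \<V>" "f V x \<noteq> 0" "i < n" "j < n" for V i j
        using R(3) ptX[OF that(1) x that(2)] that by blast
    qed
  qed
  \<comment> \<open>The matrices at a rounded point are within \<open>q + \<tau>\<close> of the values of \<open>a\<close> and \<open>b\<close> at \<open>x\<close>, hence within
    \<open>3 e1\<close> and \<open>3 s / 8\<close> of those at the base point \<open>z\<close>.\<close>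
  have ranks: "2 * card (S k) + d \<le> 2 * card (S' k)" if k: "k \<in> Gr" for k
  proof -
    obtain x where x: "x \<in> X" and kx: "k = rnd x" using k unfolding Gr_def by blast
    obtain z s where z: "z \<in> X" and s: "s \<ge> \<sigma>" and az: "op_close n e1 (a x) (a z)" and bz: "op_close n (s / 8) (b x) (b z)"
      and gap: "\<forall>u\<in>carrier_vec n. qform (b z) (b z *\<^sub>v u) \<ge> s * (cvec_norm (b z *\<^sub>v u))\<^sup>2"
      using base[OF x] by blast
    have "op_close n (q + \<tau> + e1) (A (wt k)) (a z)" unfolding kx
      by (rule op_close_trans[OF op_close_trans[OF op_close_sym[OF a'k[OF x] a'C AC] a'a[OF x]] az])
         (use AC a'C aC x z in auto)
    hence "card (S k) \<le> vec_space.rank n (a z)" unfolding S_def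
      using q\<tau> \<tau> e1 by (intro few_large_eigenvalues_near[OF aC[OF z] UD[OF k]]) auto
    moreover have "op_close n (q + \<tau> + s / 8) (B (wt k)) (b z)" unfolding kx
      by (rule op_close_trans[OF op_close_trans[OF op_close_sym[OF b'k[OF x] b'C BC] b'b[OF x]] bz])
         (use BC b'C bC x z in auto)
    hence "vec_space.rank n (b z) \<le> card (S' k)" unfolding S'_def
      using q\<tau> \<tau> \<sigma> s gap by (intro many_large_eigenvalues_near[OF bC[OF z] VE[OF k], where \<sigma> = s]) auto
    ultimately show ?thesis using rank[OF z] by linarith
  qed
  let ?F = "(\<lambda>k. (U k, S k, V k, S' k)) ` Gr"
  have F: "finite ?F" "card ?F \<le> 2 ^ card \<V> * (m + 1) ^ (d + 1)"
    using Gr card_image_le[OF Gr(1), of "\<lambda>k. (U k, S k, V k, S' k)"] by auto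
  have "\<forall>f\<in>?F. frame_pair n d f"
    using UD VE ranks unfolding frame_pair_def diagonalizes_def S_def S'_def by auto
  with F have "\<exists>T\<in>carrier_mat n n. (\<forall>i<n. \<forall>j<n. cmod (T $$ (i, j)) \<le> 2) \<and> (\<forall>f\<in>?F. transversal n (\<Lambda> / m) T f)"
    by (intro gen[THEN spec, THEN mp] conjI)
  then obtain T where T: "T \<in> carrier_mat n n" "\<forall>i<n. \<forall>j<n. cmod (T $$ (i, j)) \<le> 2"
    and good: "\<And>k. k \<in> Gr \<Longrightarrow> transversal n (\<Lambda> / m) T (U k, S k, V k, S' k)" by auto
  obtain U1 D1 where UD1: "\<And>x. x \<in> X \<Longrightarrow> diagonalizes n (U1 x) (D1 x) (a' x)"
    using hermitian_field_diagonalization[OF a'c a'h] by blast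
  obtain V1 E1 where VE1: "\<And>x. x \<in> X \<Longrightarrow> diagonalizes n (V1 x) (E1 x) (b' x)"
    using hermitian_field_diagonalization[OF b'c b'h] by blast
  define \<phi> where "\<phi> = (\<lambda>t. sqrt (max 0 (t - 5 * e1)))"
  define \<psi> where "\<psi> = (\<lambda>t. min 1 (max 0 (8 / \<sigma> * (t - \<sigma> / 4))))"
  define P where "P = (\<lambda>x. spectral_mat n (U1 x) (\<lambda>i. \<phi> (D1 x i)))"
  define Q where "Q = (\<lambda>x. spectral_mat n (V1 x) (\<lambda>i. \<psi> (E1 x i)))"
  have P: "P \<in> matC X n" unfolding P_def
    by (rule functional_calculus_continuous[OF X a'c _ UD1]) (auto simp: \<phi>_def intro!: continuous_intros)
  have Q: "Q \<in> matC X n" unfolding Q_def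
    by (rule functional_calculus_continuous[OF X b'c _ VE1]) (use \<sigma> in \<open>auto simp: \<psi>_def intro!: continuous_intros\<close>)
  define w where "w = (\<lambda>x. Q x * T * P x)"
  have w: "w \<in> matC X n" unfolding w_def by (intro matC_mult matC_const P Q T(1))
  define C where "C = 8 / \<sigma> * (real m)\<^sup>2"
  have C: "C \<ge> 0" unfolding C_def using \<sigma> by simp
  have "qform (a x) \<xi> \<le> e * (cvec_norm \<xi>)\<^sup>2 + C * qform (b x) (w x *\<^sub>v \<xi>)"
    if x: "x \<in> X" and xi: "\<xi> \<in> carrier_vec n" for x \<xi>
  proof -
    have u1: "unitary_mat n (U1 x)" and a'x: "a' x = spectral_mat n (U1 x) (D1 x)"
      using UD1[OF x] unfolding diagonalizes_spectral_mat by auto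
    have v1: "unitary_mat n (V1 x)" and b'x: "b' x = spectral_mat n (V1 x) (E1 x)"
      using VE1[OF x] unfolding diagonalizes_spectral_mat by auto
    have k: "rnd x \<in> Gr" unfolding Gr_def using x by blast
    define \<eta> where "\<eta> = P x *\<^sub>v \<xi>"
    have eta: "\<eta> \<in> carrier_vec n" unfolding \<eta>_def using matC_D(1)[OF P x] xi by auto
    define \<zeta> where "\<zeta> = T *\<^sub>v \<eta>"
    have ze: "\<zeta> \<in> carrier_vec n" unfolding \<zeta>_def using T(1) eta by auto
    have eta0: "(mat_adjoint (U1 x) *\<^sub>v \<eta>) $ j = 0" if j: "j < n" "D1 x j < 4 * e1 + \<tau>" for j
    proof -
      have "mat_adjoint (U1 x) *\<^sub>v \<eta> = vec n (\<lambda>i. complex_of_real (\<phi> (D1 x i)) * (mat_adjoint (U1 x) *\<^sub>v \<xi>) $ i)"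
        unfolding \<eta>_def P_def spectral_mat_vec[OF u1 xi] by (rule unitary_cancel(1)[OF u1]) simp
      moreover have "\<phi> (D1 x j) = 0" unfolding \<phi>_def using j \<tau> by simp
      ultimately show ?thesis using j by simp
    qed
    have psi1: "1 \<le> \<psi> (E1 x i)" if "\<sigma> / 2 - \<tau> < E1 x i" for i
    proof -
      have "\<sigma> / 8 \<le> E1 x i - \<sigma> / 4" using that \<tau> by linarith
      hence "8 / \<sigma> * (\<sigma> / 8) \<le> 8 / \<sigma> * (E1 x i - \<sigma> / 4)" using \<sigma> by (intro mult_left_mono) auto
      thus ?thesis unfolding \<psi>_def using \<sigma> by simp
    qed
    have \<Lambda>q: "(2 * real n ^ 5 + 2 * real n ^ 4) * (q / \<tau>) + real n ^ 2 * (1 / m) \<le> \<Lambda> / m"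
    proof -
      have "\<Lambda> / m = (2 * real n ^ 5 + 2 * real n ^ 4) * (q / \<tau>) + real n ^ 2 * (1 / m) + 1 / m"
        unfolding \<Lambda>_def q_def by (simp add: add_divide_distrib)
      thus ?thesis by simp
    qed
    have "1 / m * cvec_norm \<eta> \<le> cvec_norm (spectral_mat n (V1 x) (\<lambda>i. \<psi> (E1 x i)) *\<^sub>v (T *\<^sub>v \<eta>))"
    proof (rule transversality_estimate[OF UD1[OF x] VE1[OF x] UD[OF k] VE[OF k] a'k[OF x] b'k[OF x] q0 \<tau>(1) T
          good[OF k, unfolded S_def S'_def] \<Lambda>q _ q1 eta eta0])
    qed (use psi1 in auto)
    moreover have wxi: "w x *\<^sub>v \<xi> = Q x *\<^sub>v \<zeta>"
      unfolding w_def \<zeta>_def \<eta>_def using matC_D(1)[OF P x] matC_D(1)[OF Q x] T(1) xi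
      by (simp add: assoc_mult_mat_vec[of _ n n _ n] mult_carrier_mat[of _ n n _ n] mult_mat_vec_carrier[of _ n n])
    ultimately have "1 / m * cvec_norm \<eta> \<le> cvec_norm (w x *\<^sub>v \<xi>)" unfolding \<zeta>_def Q_def by simp
    hence "cvec_norm \<eta> \<le> m * cvec_norm (w x *\<^sub>v \<xi>)" using m(2) by (simp add: field_simps)
    hence 1: "(cvec_norm \<eta>)\<^sup>2 \<le> (real m)\<^sup>2 * (cvec_norm (w x *\<^sub>v \<xi>))\<^sup>2"
      by (metis cvec_norm_nonneg power_mono power_mult_distrib)
    have wx: "w x *\<^sub>v \<xi> \<in> carrier_vec n" using matC_D(1)[OF w x] xi by auto
    have "\<sigma> / 4 * (cvec_norm (w x *\<^sub>v \<xi>))\<^sup>2 \<le> qform (b' x) (w x *\<^sub>v \<xi>)"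
    proof -
      let ?c = "\<lambda>i. (cmod ((mat_adjoint (V1 x) *\<^sub>v \<zeta>) $ i))\<^sup>2"
      have "\<sigma> / 4 * (cvec_norm (w x *\<^sub>v \<xi>))\<^sup>2 = (\<Sum>i<n. \<sigma> / 4 * ((\<psi> (E1 x i))\<^sup>2 * ?c i))"
        unfolding wxi Q_def spectral_mat_norm_sq[OF v1 ze] sum_distrib_left ..
      also have "\<dots> \<le> (\<Sum>i<n. \<psi> (E1 x i) * E1 x i * \<psi> (E1 x i) * ?c i)"
      proof (rule sum_mono)
        fix i
        have "\<sigma> / 4 * (\<psi> (E1 x i))\<^sup>2 \<le> E1 x i * (\<psi> (E1 x i))\<^sup>2"
        proof (cases "E1 x i \<le> \<sigma> / 4")
          case True
          hence "8 / \<sigma> * (E1 x i - \<sigma> / 4) \<le> 0" using \<sigma> by (intro mult_nonneg_nonpos) auto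
          hence "\<psi> (E1 x i) = 0" unfolding \<psi>_def by simp
          thus ?thesis by simp
        next
          case False
          thus ?thesis by (intro mult_right_mono) auto
        qed
        hence "\<sigma> / 4 * (\<psi> (E1 x i))\<^sup>2 * ?c i \<le> E1 x i * (\<psi> (E1 x i))\<^sup>2 * ?c i"
          by (rule mult_right_mono) simp
        thus "\<sigma> / 4 * ((\<psi> (E1 x i))\<^sup>2 * ?c i) \<le> \<psi> (E1 x i) * E1 x i * \<psi> (E1 x i) * ?c i"
          by (simp only: power2_eq_square mult_ac)
      qed
      also have "\<dots> = qform (mat_adjoint (Q x) * b' x * Q x) \<zeta>"
        unfolding Q_def b'x spectral_mat_adjoint[OF v1] spectral_mat_mult[OF v1] qform_spectral_mat[OF v1 ze] ..
      also have "\<dots> = qform (b' x) (Q x *\<^sub>v \<zeta>)"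
        by (rule qform_congruence[OF b'C matC_D(1)[OF Q x] ze])
      finally show ?thesis unfolding wxi .
    qed
    moreover have "qform (b' x) (w x *\<^sub>v \<xi>) \<le> qform (b x) (w x *\<^sub>v \<xi>) + \<sigma> / 8 * (cvec_norm (w x *\<^sub>v \<xi>))\<^sup>2"
      using op_close_qform[OF op_close_mono[OF b'b[OF x] \<tau>(3)] b'C bC[OF x] wx] by linarith
    ultimately have "\<sigma> / 8 * (cvec_norm (w x *\<^sub>v \<xi>))\<^sup>2 \<le> qform (b x) (w x *\<^sub>v \<xi>)" by linarith
    hence "(cvec_norm (w x *\<^sub>v \<xi>))\<^sup>2 \<le> 8 / \<sigma> * qform (b x) (w x *\<^sub>v \<xi>)" using \<sigma> by (simp add: field_simps)
    hence "(real m)\<^sup>2 * (cvec_norm (w x *\<^sub>v \<xi>))\<^sup>2 \<le> (real m)\<^sup>2 * (8 / \<sigma> * qform (b x) (w x *\<^sub>v \<xi>))"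
      by (rule mult_left_mono) simp
    with 1 have 2: "(cvec_norm \<eta>)\<^sup>2 \<le> C * qform (b x) (w x *\<^sub>v \<xi>)" unfolding C_def by (simp add: mult_ac)
    let ?c = "\<lambda>i. (cmod ((mat_adjoint (U1 x) *\<^sub>v \<xi>) $ i))\<^sup>2"
    have "qform (a' x) \<xi> = (\<Sum>i<n. D1 x i * ?c i)" unfolding a'x by (rule qform_spectral_mat[OF u1 xi])
    also have "\<dots> \<le> (\<Sum>i<n. 5 * e1 * ?c i + (\<phi> (D1 x i))\<^sup>2 * ?c i)"
    proof (rule sum_mono)
      fix i
      have "D1 x i \<le> 5 * e1 + (\<phi> (D1 x i))\<^sup>2" unfolding \<phi>_def by simp
      hence "D1 x i * ?c i \<le> (5 * e1 + (\<phi> (D1 x i))\<^sup>2) * ?c i" by (rule mult_right_mono) simp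
      thus "D1 x i * ?c i \<le> 5 * e1 * ?c i + (\<phi> (D1 x i))\<^sup>2 * ?c i" by (simp only: distrib_right)
    qed
    also have "\<dots> = 5 * e1 * (cvec_norm \<xi>)\<^sup>2 + (cvec_norm \<eta>)\<^sup>2"
      unfolding \<eta>_def P_def spectral_mat_norm_sq[OF u1 xi] norm_sq_coordinates[OF u1 xi] sum.distrib sum_distrib_left ..
    finally have "qform (a' x) \<xi> \<le> 5 * e1 * (cvec_norm \<xi>)\<^sup>2 + (cvec_norm \<eta>)\<^sup>2" .
    moreover have "qform (a x) \<xi> \<le> qform (a' x) \<xi> + e1 * (cvec_norm \<xi>)\<^sup>2"
      using op_close_qform[OF op_close_mono[OF a'a[OF x] \<tau>(2)] a'C aC[OF x] xi] by linarith
    moreover have "e * (cvec_norm \<xi>)\<^sup>2 = 5 * e1 * (cvec_norm \<xi>)\<^sup>2 + e1 * (cvec_norm \<xi>)\<^sup>2"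
      unfolding e1_def by (simp add: algebra_simps)
    ultimately show ?thesis using 2 by linarith
  qed
  thus ?thesis using w C by blast
qed

text \<open>The condition \<open>d \<le> 2(s - r)\<close> on the ranks \<open>r\<close> of \<open>a\<close> and \<open>s\<close> of \<open>b\<close> is the one under which
  \<open>general_position\<close> finds its matrix.\<close>

theorem cuntz_comparison:
  fixes X :: "'a::metric_space set"
  assumes "compact X" "covering_dim_le X d" "matC_positive X n a" "matC_positive X n b"
    and "\<And>x. x \<in> X \<Longrightarrow> 2 * vec_space.rank n (a x) + d \<le> 2 * vec_space.rank n (b x)"
  shows "cuntz_subeq X n a b"
  using assms by (intro cuntz_subeq_if_dominated dominated_if_rank_gap)

theorem theorem3p15:
  fixes X :: "'a::metric_space set" and d n :: nat
    and a b :: "'a \<Rightarrow> complex mat"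
  assumes "compact X"
    and "has_covering_dim X d"
    and "matC_positive X n a"
    and "matC_positive X n b"
    and "\<forall>x\<in>X. vec_space.rank n (a x) + 9 * d \<le> vec_space.rank n (b x)"
  shows "cuntz_subeq X n a b"
proof (rule cuntz_comparison)
  show "covering_dim_le X d" using assms(2) unfolding has_covering_dim_def ..
  show "2 * vec_space.rank n (a x) + d \<le> 2 * vec_space.rank n (b x)" if "x \<in> X" for x
    using assms(5) that by fastforce
qed (use assms in auto)

end
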